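(* Let $d\ge 1$ and let $1\le q\le p<\infty$ satisfy $p>d(q-1)$. Let $\gamma\in\mathbb{R}\setminus[-qd,0]$. There is a constant $C$ depending only on $d,\gamma,p,q$ such that for every convex domain $\Omega\subset\mathbb{R}^d$ with finite ball deviation $\mathrm{dev}(\Omega)$, every pair of weights $(u,w)\in A_q(\Omega)$, every $f\in C^1(\Omega)$ and every $\lambda>0$, $$\mu^u_\gamma\big(E_{\lambda,\gamma/p}(f)\big)\le C\,[u,w]_{A_q(\Omega)}\Big(\frac{\mathrm{dev}(\Omega)}{\lambda}\Big)^{p}\int_\Omega|\nabla f(y)|^p\,w(y)\,dy .$$
   Context: A domain is a nonempty open connected set. The ball deviation of $\Omega\subset\mathbb{R}^d$ is $$\mathrm{dev}(\Omega)=\sup_{x\in\Omega}\ \sup_{0<r\le\mathrm{diam}(\Omega)}\frac{|B(x,r)|}{|B(x,r)\cap\Omega|},$$ where $\mathrm{diam}(\Omega)=\sup_{x,y\in\Omega}|x-y|\in(0,\infty]$, $r$ is finite, $B(x,r)$ is the ball of center $x$ and radius $r$, and $|E|$ is Lebesgue measure. For $b\in\mathbb{R}$ and $x\ne y$ in $\Omega$ put $\mathfrak{D}_bf(x,y)=\frac{|f(y)-f(x)|}{|y-x|^{1+b}}$, and $\mathfrak{D}_bf(x,x)=0$. For $\lambda>0$, $E_{\lambda,b}(f)=\{(x,y)\in\Omega\times\Omega:\mathfrak{D}_bf(x,y)>\lambda\}$. For a nonnegative measurable function $u$ on $\Omega$, $\mu^u_\gamma$ is the measure on $\Omega\times\Omega$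 given by $d\mu^u_\gamma(x,y)=u(x)|y-x|^{\gamma-d}\,dx\,dy$. Weights $u,w$ are measurable functions on $\Omega$ with values in $[0,\infty)$. For $1<q<\infty$ and $q'=q/(q-1)$, $(u,w)\in A_q(\Omega)$ means $$[u,w]_{A_q(\Omega)}:=\sup_B\frac1{|B|}\int_{B\cap\Omega}u(x)\,dx\,\Big(\frac1{|B|}\int_{B\cap\Omega}w(y)^{-q'/q}\,dy\Big)^{q/q'}<\infty,$$ the supremum over all balls $B\subset\mathbb{R}^d$. For $q=1$, $(u,w)\in A_1(\Omega)$ means that there is a constant $K<\infty$ with $\frac1{|B|}\int_{B\cap\Omega}u(x)\,dx\le K\,\operatorname{ess\,inf}_{y\in B\cap\Omega}w(y)$ for every ball $B\subset\mathbb{R}^d$; $[u,w]_{A_1(\Omega)}$ is the infimum of all such $K$. The convention $0\cdot\infty=0$ is used. *)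

theory Defs
  imports "HOL-Analysis.Analysis"
begin

definition is_domain :: "'a::euclidean_space set \<Rightarrow> bool" where
  "is_domain \<Omega> \<longleftrightarrow> \<Omega> \<noteq> {} \<and> open \<Omega> \<and> connected \<Omega>"

(* The library's real-valued diameter carries no information for unbounded sets. *)
definition ediam :: "'a::metric_space set \<Rightarrow> ennreal" where
  "ediam \<Omega> = (SUP x\<in>\<Omega>. SUP y\<in>\<Omega>. ennreal (dist x y))"

definition ball_dev :: "'a::euclidean_space set \<Rightarrow> ennreal" where
  "ball_dev \<Omega> = (SUP x\<in>\<Omega>. SUP r\<in>{r::real. 0 < r \<and> ennreal r \<le> ediam \<Omega>}.
     emeasure lebesgue (ball x r) / emeasure lebesgue (ball x r \<inter> \<Omega>))"

(* Powers of extended nonnegative reals, meant for exponents a > 0 only. *)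
definition epowr :: "ennreal \<Rightarrow> real \<Rightarrow> ennreal" where
  "epowr t a = (if t = top then top else ennreal (enn2real t powr a))"

definition gradient :: "('a::real_inner \<Rightarrow> real) \<Rightarrow> 'a \<Rightarrow> 'a" where
  "gradient f x = (THE g. GDERIV f x :> g)"

definition C1_on :: "('a::real_inner \<Rightarrow> real) \<Rightarrow> 'a set \<Rightarrow> bool" where
  "C1_on f \<Omega> \<longleftrightarrow> (\<forall>x\<in>\<Omega>. f differentiable (at x)) \<and> continuous_on \<Omega> (gradient f)"

definition diff_quot :: "real \<Rightarrow> ('a::real_normed_vector \<Rightarrow> real) \<Rightarrow> 'a \<Rightarrow> 'a \<Rightarrow> real" where
  "diff_quot b f x y = (if x = y then 0 else \<bar>f y - f x\<bar> / norm (y - x) powr (1 + b))"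

definition level_set ::
    "'a::real_normed_vector set \<Rightarrow> real \<Rightarrow> real \<Rightarrow> ('a \<Rightarrow> real) \<Rightarrow> ('a \<times> 'a) set" where
  "level_set \<Omega> lam b f = {(x, y). x \<in> \<Omega> \<and> y \<in> \<Omega> \<and> diff_quot b f x y > lam}"

definition weight_on :: "'a::euclidean_space set \<Rightarrow> ('a \<Rightarrow> real) \<Rightarrow> bool" where
  "weight_on \<Omega> u \<longleftrightarrow> u \<in> borel_measurable (lebesgue_on \<Omega>) \<and> (\<forall>x\<in>\<Omega>. 0 \<le> u x)"

(* On the Lebesgue-null diagonal the density is 0, since 0 powr s = 0 for every s. *)
definition mu_weight ::
    "'a::euclidean_space set \<Rightarrow> ('a \<Rightarrow> real) \<Rightarrow> real \<Rightarrow> ('a \<times> 'a) measure" where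
  "mu_weight \<Omega> u \<gamma> = density (lebesgue_on (\<Omega> \<times> \<Omega>))
     (\<lambda>(x, y). ennreal (u x * norm (y - x) powr (\<gamma> - real DIM('a))))"

definition ess_inf_on :: "'a::euclidean_space set \<Rightarrow> ('a \<Rightarrow> real) \<Rightarrow> ennreal" where
  "ess_inf_on A w = Sup {c. AE y in lebesgue. y \<in> A \<longrightarrow> c \<le> ennreal (w y)}"

definition A1_const ::
    "'a::euclidean_space set \<Rightarrow> ('a \<Rightarrow> real) \<Rightarrow> ('a \<Rightarrow> real) \<Rightarrow> ennreal" where
  "A1_const \<Omega> u w = Inf {K. K < top \<and> (\<forall>a. \<forall>r>0.
     (\<integral>\<^sup>+x\<in>ball a r \<inter> \<Omega>. ennreal (u x) \<partial>lebesgue) / emeasure lebesgue (ball a r)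
       \<le> K * ess_inf_on (ball a r \<inter> \<Omega>) w)}"

(* The power w(y)^(-q'/q) must be infinite where w(y) = 0, whereas 0 powr s = 0 for negative s;
   hence the inverse of the positive power is taken in the extended nonnegative reals. *)
definition Aq_gt1_const ::
    "real \<Rightarrow> 'a::euclidean_space set \<Rightarrow> ('a \<Rightarrow> real) \<Rightarrow> ('a \<Rightarrow> real) \<Rightarrow> ennreal" where
  "Aq_gt1_const q \<Omega> u w = (let q' = q / (q - 1) in
     (SUP a. SUP r\<in>{0<..}.
        (\<integral>\<^sup>+x\<in>ball a r \<inter> \<Omega>. ennreal (u x) \<partial>lebesgue) / emeasure lebesgue (ball a r) *
        epowr ((\<integral>\<^sup>+y\<in>ball a r \<inter> \<Omega>. inverse (ennreal (w y powr (q' / q))) \<partial>lebesgue)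
                 / emeasure lebesgue (ball a r)) (q / q')))"

definition Aq_const ::
    "real \<Rightarrow> 'a::euclidean_space set \<Rightarrow> ('a \<Rightarrow> real) \<Rightarrow> ('a \<Rightarrow> real) \<Rightarrow> ennreal" where
  "Aq_const q \<Omega> u w = (if q = 1 then A1_const \<Omega> u w else Aq_gt1_const q \<Omega> u w)"

(* For q = 1, finiteness of the infimum is existence of an admissible K, as Inf {} = top. *)
definition Aq_pair ::
    "real \<Rightarrow> 'a::euclidean_space set \<Rightarrow> ('a \<Rightarrow> real) \<Rightarrow> ('a \<Rightarrow> real) \<Rightarrow> bool" where
  "Aq_pair q \<Omega> u w \<longleftrightarrow> weight_on \<Omega> u \<and> weight_on \<Omega> w \<and> Aq_const q \<Omega> u w < top"

end

(* Put s = p/q, D = dim, b = gamma/p, g = |grad f|^s. If (x,y) lies in the level set and r = |x - y|,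
   integrate f along the segments from x and from y to the points of the part of B(x,r) inside
   Omega, whose measure is at least |B(x,r)|/dev(Omega). This bounds lambda r^(1+b) by a sum over j
   of scaled integrals of |grad f| over B(x, 2r/2^j) and B(y, 2r/2^j). By pigeonhole (with a loss
   2^(-eps j)) one term is large, so some dyadic cube Q of side l comparable to r/2^j, close to x or
   to y, is heavy: the integral of g over Q is at least T_j l^(D + gamma/q). The A_q condition and
   Hoelder's inequality bound the mu-measure of the pairs attached to one such cube by the integral
   of |grad f|^p w over Q, times l^(gamma + qD) (integral of g over Q)^(-q). Along the cubes
   containing a fixed point these factors sum to at most C T_j^(-q): if gamma < -qD because they
   decay geometrically in the side length, starting from the smallest heavy cube, and if gamma > 0
   because only the maximal heavy cube is kept (the pairs then have distance about 2^m l with any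
   m <= j, and 2^(m gamma) is summable). The condition p > D(q-1) makes the resulting series in j
   converge. Smallest and maximal heavy cubes exist after restricting to 2^(-N) < |x - y| <= 2^N;
   N tends to infinity at the end. *)
theory Submission
  imports Defs
begin

section \<open>Hoelder's inequality and the weight condition\<close>

text \<open>The power s = p/q is forced by the weight condition: A_q controls the q-th power of the
  integral of a test function by the integral of its q-th power against w, and the q-th power of
  |grad f|^(p/q) is |grad f|^p. Cube masses then have the critical scaling l^beta with beta = D +
  gamma/q, and the sign of beta q = gamma + qD decides whether the sum over the cubes containing a
  point converges upwards. For -qD <= gamma <= 0 neither this sum nor the one over m is geometric.
  The obstacle is that u is integrated in x while the heavy cube may lie near y. Then u has to be
  controlled on a ball of radius about 2^m l, which costs 2^(m D q) in the A_q bound, and the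
  confinement of y to a ball of radius about l gives back only 2^(-m D). The resulting loss 2^(j D
  (q-1)) is set against T_j^(-q), which is of order 2^(-j (p (1-eps) + gamma)). With the factor 2^(j
  gamma) of the kernel there remains 2^(-j (p (1-eps) - D (q-1))), and eps is chosen to leave half
  of p - D (q-1).\<close>

lemma epowr_1 [simp]: "epowr t 1 = t"
  by (cases t) (auto simp: epowr_def)

lemma epowr_0_left [simp]: "epowr 0 a = 0"
  by (simp add: epowr_def)

lemma epowr_top [simp]: "epowr top a = top"
  by (simp add: epowr_def)

lemma epowr_ennreal: "0 \<le> t \<Longrightarrow> epowr (ennreal t) a = ennreal (t powr a)"
  by (simp add: epowr_def)

lemma epowr_mono: "s \<le> t \<Longrightarrow> 0 \<le> a \<Longrightarrow> epowr s a \<le> epowr t a"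
  by (cases s; cases t) (auto simp: epowr_ennreal powr_mono2 top_unique intro!: ennreal_leI)

lemma epowr_eq_0_iff: "0 < a \<Longrightarrow> epowr t a = 0 \<longleftrightarrow> t = 0"
  by (cases t) (auto simp: epowr_ennreal ennreal_eq_0_iff not_le)

lemma epowr_eq_top_iff: "epowr t a = top \<longleftrightarrow> t = top"
  by (cases t) (auto simp: epowr_ennreal)

lemma epowr_mult: "0 < a \<Longrightarrow> epowr (s * t) a = epowr s a * epowr t a"
proof (cases s; cases t)
  assume "0 < a" "s = top" "t = top" then show ?thesis by simp
next
  fix r assume "0 < a" "s = top" "t = ennreal r" "0 \<le> r"
  then show ?thesis by (cases "r = 0") (auto simp: epowr_ennreal ennreal_top_mult)
next
  fix r assume "0 < a" "t = top" "s = ennreal r" "0 \<le> r"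
  then show ?thesis by (cases "r = 0") (auto simp: epowr_ennreal ennreal_mult_top)
next
  fix r r' assume "0 < a" "s = ennreal r" "t = ennreal r'" "0 \<le> r" "0 \<le> r'"
  then show ?thesis
    by (simp add: epowr_ennreal powr_mult flip: ennreal_mult)
qed

lemma ennreal_divide_mult_cancel:
  fixes x c :: ennreal
  assumes "c \<noteq> 0" "c \<noteq> top"
  shows "x / c * c = x"
  using ennreal_mult_divide_eq[OF assms, of x]
  by (metis ennreal_divide_times ennreal_times_divide)

lemma emeasure_lborel_ball_pos: "0 < R \<Longrightarrow> emeasure lborel (ball (a::'a::euclidean_space) R) \<noteq> 0"
  using unit_ball_vol_pos[of "real DIM('a)"]
  by (simp add: emeasure_ball ennreal_eq_0_iff not_le del: unit_ball_vol_pos)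

lemma emeasure_lborel_ball_neq_top: "emeasure lborel (ball (a::'a::euclidean_space) R) \<noteq> top"
  using emeasure_lborel_ball_finite[of a R] by simp

text \<open>Integrating this tangent inequality yields Hoelder's inequality without normalising integrals that may be infinite.\<close>

lemma powr_tangent_le:
  fixes c g s :: real
  assumes s: "1 < s" and c: "0 < c" and g: "0 \<le> g"
  shows "s * c powr (s - 1) * g \<le> g powr s + (s - 1) * c powr s"
proof -
  define s' where "s' = s / (s - 1)"
  have s': "1 < s'" "1 / s + 1 / s' = 1"
    using s by (auto simp: s'_def field_simps)
  have "g * c powr (s - 1) \<le> g powr s / s + (c powr (s - 1)) powr s' / s'"
    using Youngs_inequality[OF s s'(1) s'(2) g, of "c powr (s - 1)"] by simp
  also have "(c powr (s - 1)) powr s' = c powr s"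
    using s by (simp add: powr_powr s'_def)
  finally have "s * (g * c powr (s - 1)) \<le> s * (g powr s / s + c powr s / s')"
    using s by (intro mult_left_mono) auto
  also have "\<dots> = g powr s + (s - 1) * c powr s"
    using s by (simp add: s'_def field_simps)
  finally show ?thesis by (simp add: mult_ac)
qed

text \<open>Hoelder with exponents s and s/(s-1), applied to g w^(1/s) and w^(-1/s) and raised to
  the power s. The dual integral has to be finite: if w = 0 on a nonnull A, the product on the right
  is 0 times infinity, hence 0, whatever g is.\<close>

lemma weighted_Holder:
  fixes g w :: "'b \<Rightarrow> real"
  assumes s: "1 < s" and [measurable]: "g \<in> borel_measurable M" "w \<in> borel_measurable M" "A \<in> sets M"
    and g: "\<And>x. x \<in> A \<Longrightarrow> 0 \<le> g x" and w: "\<And>x. x \<in> A \<Longrightarrow> 0 \<le> w x"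
    and fin: "(\<integral>\<^sup>+x\<in>A. inverse (ennreal (w x powr (1 / (s - 1)))) \<partial>M) < top"
  shows "epowr (\<integral>\<^sup>+x\<in>A. ennreal (g x) \<partial>M) s \<le> (\<integral>\<^sup>+x\<in>A. ennreal (g x powr s * w x) \<partial>M) *
           epowr (\<integral>\<^sup>+x\<in>A. inverse (ennreal (w x powr (1 / (s - 1)))) \<partial>M) (s - 1)"
    (is "epowr ?X s \<le> ?J * epowr ?W (s - 1)")
proof -
  define t where "t = 1 / (s - 1)"
  have t: "0 < t" using s by (simp add: t_def)
  have W_def: "?W = (\<integral>\<^sup>+x\<in>A. inverse (ennreal (w x powr t)) \<partial>M)" by (simp add: t_def)
  have X0: "?X = 0" if "?W = 0"
  proof -
    have "AE x in M. inverse (ennreal (w x powr t)) * indicator A x = 0"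
      using that unfolding W_def by (subst (asm) nn_integral_0_iff_AE) auto
    then have "AE x in M. ennreal (g x) * indicator A x = 0"
      by eventually_elim (auto split: split_indicator)
    then show ?thesis by (subst nn_integral_0_iff_AE) auto
  qed
  have main: "ennreal (s * \<theta> powr (s - 1)) * ?X \<le> ?J + ennreal ((s - 1) * \<theta> powr s) * ?W"
    if th: "0 < \<theta>" for \<theta>
  proof -
    have "ennreal (s * \<theta> powr (s - 1)) * ?X =
        (\<integral>\<^sup>+x. ennreal (s * \<theta> powr (s - 1)) * (ennreal (g x) * indicator A x) \<partial>M)"
      by (subst nn_integral_cmult) auto
    also have "\<dots> \<le> (\<integral>\<^sup>+x. ennreal (g x powr s * w x) * indicator A x +
       ennreal ((s - 1) * \<theta> powr s) * (inverse (ennreal (w x powr t)) * indicator A x) \<partial>M)"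
    proof (intro nn_integral_mono)
      fix x
      show "ennreal (s * \<theta> powr (s - 1)) * (ennreal (g x) * indicator A x) \<le>
        ennreal (g x powr s * w x) * indicator A x +
        ennreal ((s - 1) * \<theta> powr s) * (inverse (ennreal (w x powr t)) * indicator A x)"
      proof (cases "x \<in> A")
        case True
        show ?thesis
        proof (cases "w x = 0")
          case True
          \<comment> \<open>Where w vanishes the dual term is infinite with a positive
            coefficient.\<close>
          then show ?thesis using s th \<open>x \<in> A\<close>
            by (simp add: ennreal_mult_top)
        next
          case False
          then have wp: "0 < w x" using w[OF True] by simp
          \<comment> \<open>This choice makes \<open>c powr (s - 1) * w x\<close> independent of x,
            so the tangent inequality integrates to a bound for a constant multiple of the integral
            of g.\<close>
          define c where "c = \<theta> * w x powr (- t)"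
          have c: "0 < c" using th wp by (simp add: c_def)
          have t1: "t * (s - 1) = 1" using s by (simp add: t_def)
          have e1: "c powr (s - 1) * w x = \<theta> powr (s - 1)"
            using th wp s by (simp add: c_def powr_mult powr_powr t1 powr_neg_one)
          have "-t * s + 1 = -t" using s by (simp add: t_def field_simps)
          then have e2: "c powr s * w x = \<theta> powr s * w x powr (- t)"
          proof -
            have "w x powr (- t) = w x powr (- t * s) * w x powr 1"
              using \<open>-t * s + 1 = -t\<close> by (subst powr_add[symmetric]) simp
            moreover have "c powr s = \<theta> powr s * w x powr (- t * s)"
              using th wp by (simp add: c_def powr_mult powr_powr)
            ultimately show ?thesis using wp by simp
          qed
          have "s * c powr (s - 1) * g x * w x \<le> (g x powr s + (s - 1) * c powr s) * w x"
            using powr_tangent_le[OF s c g[OF True]] wp by (intro mult_right_mono) auto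
          then have "s * \<theta> powr (s - 1) * g x \<le> g x powr s * w x + (s - 1) * \<theta> powr s * w x powr (- t)"
            using e1 e2 by (simp add: algebra_simps)
          moreover have "inverse (ennreal (w x powr t)) = ennreal (w x powr (- t))"
            using wp by (simp add: inverse_ennreal powr_minus)
          ultimately show ?thesis using True s th wp g[OF True]
            by (simp add: ennreal_leI flip: ennreal_mult ennreal_plus)
        qed
      qed simp
    qed
    also have "\<dots> = ?J + ennreal ((s - 1) * \<theta> powr s) * ?W"
      unfolding W_def by (subst nn_integral_add) (auto simp: nn_integral_cmult)
    finally show ?thesis .
  qed
  show ?thesis
  proof (cases "?W = 0 \<or> ?J = top")
    case True
    then show ?thesis using X0 s
      by (auto simp: ennreal_top_mult epowr_eq_0_iff)
  next
    case False
    obtain W where W: "?W = ennreal W" "0 < W"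
      using fin False by (cases ?W) (auto simp: less_le)
    obtain J where J: "?J = ennreal J" "0 \<le> J"
      using False by (cases ?J) auto
    have "?X \<noteq> top"
    proof
      assume "?X = top"
      then show False using main[of 1] s W J
        by (simp add: ennreal_mult_top top_unique flip: ennreal_mult)
    qed
    then obtain X where X: "?X = ennreal X" "0 \<le> X" by (cases ?X) auto
    have "X powr s \<le> J * W powr (s - 1)"
    proof (cases "X = 0")
      case False
      then have Xp: "0 < X" using X by simp
      \<comment> \<open>With \<theta> = X / W the left side is s times, and the last term s - 1
        times, the same quantity; one copy of it is left below J.\<close>
      have "s * (X / W) powr (s - 1) * X \<le> J + (s - 1) * (X / W) powr s * W"
        using main[of "X / W"] Xp W J X s
        by (simp add: ennreal_le_iff flip: ennreal_mult ennreal_plus)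
      moreover have "(X / W) powr (s - 1) * X = (X / W) powr s * W"
        using Xp W by (simp add: powr_divide powr_diff field_simps)
      ultimately have "s * ((X / W) powr s * W) \<le> J + (s - 1) * ((X / W) powr s * W)"
        by (simp only: mult.assoc)
      then have "(X / W) powr s * W \<le> J"
        by (simp add: left_diff_distrib)
      moreover have "(X / W) powr s * W = X powr s / W powr (s - 1)"
        using Xp W by (simp add: powr_divide powr_diff field_simps)
      ultimately show ?thesis using W(2) by (simp add: pos_divide_le_eq)
    qed (use J in auto)
    then show ?thesis using W J X
      by (simp add: epowr_ennreal flip: ennreal_mult)
  qed
qed

section \<open>The weight condition on a single ball\<close>

lemma ess_inf_on_mult_le:
  fixes w :: "'a::euclidean_space \<Rightarrow> real"
  assumes "Q \<subseteq> A" and g: "g \<in> borel_measurable lebesgue" and [measurable]: "Q \<in> sets lebesgue"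
  shows "ess_inf_on A w * (\<integral>\<^sup>+x\<in>Q. g x \<partial>lebesgue) \<le> (\<integral>\<^sup>+x\<in>Q. ennreal (w x) * g x \<partial>lebesgue)"
proof -
  note [measurable] = g
  have "c * (\<integral>\<^sup>+x\<in>Q. g x \<partial>lebesgue) \<le> (\<integral>\<^sup>+x\<in>Q. ennreal (w x) * g x \<partial>lebesgue)"
    if "AE y in lebesgue. y \<in> A \<longrightarrow> c \<le> ennreal (w y)" for c
  proof -
    have "c * (\<integral>\<^sup>+x\<in>Q. g x \<partial>lebesgue) = (\<integral>\<^sup>+x. c * (g x * indicator Q x) \<partial>lebesgue)"
      by (rule nn_integral_cmult[symmetric]) measurable
    also have "\<dots> \<le> (\<integral>\<^sup>+x\<in>Q. ennreal (w x) * g x \<partial>lebesgue)"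
      using that
    proof (intro nn_integral_mono_AE, eventually_elim)
      fix x assume "x \<in> A \<longrightarrow> c \<le> ennreal (w x)"
      then show "c * (g x * indicator Q x) \<le> ennreal (w x) * g x * indicator Q x"
        using \<open>Q \<subseteq> A\<close> by (cases "x \<in> Q") (auto intro: mult_right_mono)
    qed
    finally show ?thesis .
  qed
  then show ?thesis
    unfolding ess_inf_on_def SUP_mult_right_ennreal[of "\<lambda>x. x", simplified image_ident]
    by (auto intro!: SUP_least)
qed

text \<open>As w is real-valued, some sublevel set {w <= n} has a nonnull part in A, and every
  essential lower bound is at most n there. On a null set the essential infimum is
  \<open>top\<close>.\<close>

lemma ess_inf_on_less_top:
  fixes w :: "'a::euclidean_space \<Rightarrow> real"
  assumes w: "w \<in> borel_measurable lebesgue" and A: "A \<in> sets lebesgue" "emeasure lebesgue A \<noteq> 0"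
  shows "ess_inf_on A w < top"
proof (rule ccontr)
  note [measurable] = w
  assume "\<not> ess_inf_on A w < top"
  then have top: "ess_inf_on A w = top" using top.not_eq_extremum by blast
  have "\<exists>n::nat. emeasure lebesgue (A \<inter> {x. w x \<le> real n}) \<noteq> 0"
  proof (rule ccontr)
    assume *: "\<not> ?thesis"
    have "emeasure lebesgue A = emeasure lebesgue (\<Union>n::nat. A \<inter> {x. w x \<le> real n})"
      by (rule arg_cong[where f="emeasure lebesgue"]) (auto intro: real_arch_simple)
    also have "\<dots> = 0"
      using * A by (intro emeasure_UN_eq_0) auto
    finally show False using A by simp
  qed
  then obtain n :: nat where n: "emeasure lebesgue (A \<inter> {x. w x \<le> real n}) \<noteq> 0" by blast
  define Q where "Q = A \<inter> {x. w x \<le> real n}"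
  have Qm [measurable]: "Q \<in> sets lebesgue" using A unfolding Q_def by measurable
  have "c \<le> ennreal (real n)" if "AE y in lebesgue. y \<in> A \<longrightarrow> c \<le> ennreal (w y)" for c
  proof (rule ccontr)
    assume c: "\<not> c \<le> ennreal (real n)"
    have "AE y in lebesgue. y \<notin> Q"
      using that
    proof eventually_elim
      fix y assume y: "y \<in> A \<longrightarrow> c \<le> ennreal (w y)"
      show "y \<notin> Q"
      proof
        assume "y \<in> Q"
        then have "c \<le> ennreal (w y)" "ennreal (w y) \<le> ennreal (real n)"
          using y by (auto simp: Q_def intro: ennreal_leI)
        with c show False by (metis order_trans)
      qed
    qed
    then have "emeasure lebesgue Q = 0"
      by (subst AE_iff_null_sets[symmetric, unfolded null_sets_def, simplified] | simp add: AE_iff_null_sets null_setsD1)+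
    then show False using n by (simp add: Q_def)
  qed
  then have "ess_inf_on A w \<le> ennreal (real n)"
    unfolding ess_inf_on_def by (intro Sup_least) auto
  then show False using top by (simp add: top_unique)
qed

text \<open>Lets the infimum in \<open>A1_const\<close> serve as an admissible constant. The value c
  = top has to be excluded, since the infimum may be 0 and 0 * top = 0.\<close>

lemma ennreal_Inf_mult_bound:
  fixes x c :: ennreal
  assumes "\<And>K. K \<in> S \<Longrightarrow> x \<le> K * c" "c < top" "S \<noteq> {}"
  shows "x \<le> Inf S * c"
proof (cases "c = 0")
  case False
  have "x / c \<le> K" if "K \<in> S" for K
    using assms(1)[OF that] False assms(2)
    by (metis divide_le_posI_ennreal mult.commute not_gr_zero)
  then have "x / c \<le> Inf S" by (intro Inf_greatest)
  then have "x / c * c \<le> Inf S * c" by (rule mult_right_mono) simp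
  then show ?thesis using False assms(2)
    by (simp add: ennreal_divide_mult_cancel)
qed (use assms in auto)

lemma A1_const_ball_le:
  fixes u w :: "'a::euclidean_space \<Rightarrow> real"
  assumes "A1_const \<Omega> u w < top" "0 < R" "ess_inf_on (ball a R \<inter> \<Omega>) w < top"
  shows "(\<integral>\<^sup>+x\<in>ball a R \<inter> \<Omega>. ennreal (u x) \<partial>lebesgue) \<le>
     A1_const \<Omega> u w * emeasure lebesgue (ball a R) * ess_inf_on (ball a R \<inter> \<Omega>) w"
proof -
  define S where "S = {K. K < top \<and> (\<forall>a. \<forall>r>0.
     (\<integral>\<^sup>+x\<in>ball a r \<inter> \<Omega>. ennreal (u x) \<partial>lebesgue) / emeasure lebesgue (ball a r)
       \<le> K * ess_inf_on (ball a r \<inter> \<Omega>) w)}"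
  have S: "A1_const \<Omega> u w = Inf S" by (simp add: A1_const_def S_def)
  have B: "emeasure lebesgue (ball a R) \<noteq> 0" "emeasure lebesgue (ball a R) \<noteq> top"
    using assms(2) by (simp_all add: emeasure_lborel_ball_pos emeasure_lborel_ball_neq_top)
  have "(\<integral>\<^sup>+x\<in>ball a R \<inter> \<Omega>. ennreal (u x) \<partial>lebesgue) / emeasure lebesgue (ball a R)
     \<le> Inf S * ess_inf_on (ball a R \<inter> \<Omega>) w"
  proof (rule ennreal_Inf_mult_bound)
    show "S \<noteq> {}" using assms(1) S by auto
  qed (use assms in \<open>auto simp: S_def\<close>)
  then have "(\<integral>\<^sup>+x\<in>ball a R \<inter> \<Omega>. ennreal (u x) \<partial>lebesgue) / emeasure lebesgue (ball a R) * emeasure lebesgue (ball a R)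
     \<le> Inf S * ess_inf_on (ball a R \<inter> \<Omega>) w * emeasure lebesgue (ball a R)"
    by (rule mult_right_mono) simp
  then show ?thesis using B
    by (simp add: S ennreal_divide_mult_cancel) (simp add: mult_ac)
qed

lemma Aq_gt1_const_ball_le:
  fixes u w :: "'a::euclidean_space \<Rightarrow> real"
  assumes q: "1 < q" and R: "0 < R"
  shows "(\<integral>\<^sup>+x\<in>ball a R \<inter> \<Omega>. ennreal (u x) \<partial>lebesgue) *
      epowr (\<integral>\<^sup>+y\<in>ball a R \<inter> \<Omega>. inverse (ennreal (w y powr (1 / (q - 1)))) \<partial>lebesgue) (q - 1)
    \<le> Aq_gt1_const q \<Omega> u w * epowr (emeasure lebesgue (ball a R)) q"
proof -
  let ?b = "emeasure lebesgue (ball a R)"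
  let ?U = "\<integral>\<^sup>+x\<in>ball a R \<inter> \<Omega>. ennreal (u x) \<partial>lebesgue"
  let ?W = "\<integral>\<^sup>+y\<in>ball a R \<inter> \<Omega>. inverse (ennreal (w y powr (1 / (q - 1)))) \<partial>lebesgue"
  have B: "?b \<noteq> 0" "?b \<noteq> top" using R by (simp_all add: emeasure_lborel_ball_pos emeasure_lborel_ball_neq_top)
  have q': "q / (q - 1) / q = 1 / (q - 1)" "q / (q / (q - 1)) = q - 1" using q by auto
  have "?U / ?b * epowr (?W / ?b) (q - 1) \<le> Aq_gt1_const q \<Omega> u w"
    unfolding Aq_gt1_const_def Let_def q'
    by (rule SUP_upper2[of a], simp, rule SUP_upper2[of R]) (use R in auto)
  then have "?U / ?b * epowr (?W / ?b) (q - 1) * epowr ?b q \<le> Aq_gt1_const q \<Omega> u w * epowr ?b q"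
    by (rule mult_right_mono) simp
  moreover have "epowr ?b q = ?b * epowr ?b (q - 1)"
    using B q by (cases ?b) (auto simp: epowr_ennreal powr_mult_base simp flip: ennreal_mult)
  moreover have "?U / ?b * epowr (?W / ?b) (q - 1) * (?b * epowr ?b (q - 1)) =
     (?U / ?b * ?b) * epowr (?W / ?b * ?b) (q - 1)"
    using q by (simp add: epowr_mult mult_ac)
  moreover have "?U / ?b * ?b = ?U" "?W / ?b * ?b = ?W"
    using B by (simp_all add: ennreal_divide_mult_cancel)
  ultimately show ?thesis by simp
qed

text \<open>The set Q may be much smaller than the ball: shrinking the domain only raises the
  essential infimum (q = 1) or lowers the dual integral (q > 1). The ball can therefore be inflated
  until it contains the points x, while the gradient is integrated over the cube alone.\<close>

lemma Aq_pair_ball_le: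
  fixes u w g :: "'a::euclidean_space \<Rightarrow> real"
  assumes q: "1 \<le> q" and R: "0 < R" and Om: "\<Omega> \<in> sets lebesgue" and A: "Aq_pair q \<Omega> u w"
    and Qm: "Q \<in> sets lebesgue" and QB: "Q \<subseteq> ball a R"
    and g: "g \<in> borel_measurable lebesgue" and g0: "\<And>x. 0 \<le> g x"
  shows "(\<integral>\<^sup>+x\<in>ball a R \<inter> \<Omega>. ennreal (u x) \<partial>lebesgue) * epowr (\<integral>\<^sup>+x\<in>Q \<inter> \<Omega>. ennreal (g x) \<partial>lebesgue) q
    \<le> Aq_const q \<Omega> u w * epowr (emeasure lebesgue (ball a R)) q *
       (\<integral>\<^sup>+x\<in>Q \<inter> \<Omega>. ennreal (g x powr q * w x) \<partial>lebesgue)" (is "?U * epowr ?G q \<le> ?K * epowr ?b q * ?I")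
proof -
  note [measurable] = Om Qm g
  \<comment> \<open>w is measurable on \<Omega> only; the extension by 0 is measurable
    everywhere.\<close>
  define w' where "w' x = (if x \<in> \<Omega> then w x else 0)" for x
  have w' [measurable]: "w' \<in> borel_measurable lebesgue"
    using A Om unfolding w'_def Aq_pair_def weight_on_def
    by (simp add: borel_measurable_if)
  have w'_eq: "x \<in> \<Omega> \<Longrightarrow> w' x = w x" for x by (simp add: w'_def)
  have w0: "x \<in> \<Omega> \<Longrightarrow> 0 \<le> w x" for x using A by (auto simp: Aq_pair_def weight_on_def)
  have I': "?I = (\<integral>\<^sup>+x\<in>Q \<inter> \<Omega>. ennreal (g x powr q * w' x) \<partial>lebesgue)"
    by (intro nn_integral_cong) (auto simp: w'_def split: split_indicator)
  have fin: "?K < top" using A by (simp add: Aq_pair_def)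
  show ?thesis
  proof (cases "q = 1")
    case True
    have g': "(\<integral>\<^sup>+x\<in>Q \<inter> \<Omega>. ennreal (w' x) * ennreal (g x) \<partial>lebesgue) = ?I"
      unfolding I' using True g0 w0
      by (intro nn_integral_cong) (auto simp: w'_def ennreal_mult mult.commute split: split_indicator)
    have ess: "ess_inf_on (ball a R \<inter> \<Omega>) w = ess_inf_on (ball a R \<inter> \<Omega>) w'"
      unfolding ess_inf_on_def by (rule arg_cong[where f=Sup]) (auto simp: w'_def elim: eventually_mono)
    show ?thesis
    \<comment> \<open>On a null set the essential infimum is infinite, so this case is treated
      apart.\<close>
    proof (cases "emeasure lebesgue (ball a R \<inter> \<Omega>) = 0")
      case True
      then have "ball a R \<inter> \<Omega> \<in> null_sets lebesgue" by (intro null_setsI) auto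
      then have "?U = 0" by (rule nn_integral_null_set)
      then show ?thesis by simp
    next
      case False
      then have e: "ess_inf_on (ball a R \<inter> \<Omega>) w < top"
        unfolding ess by (intro ess_inf_on_less_top) auto
      have "?U * ?G \<le> ?K * ?b * ess_inf_on (ball a R \<inter> \<Omega>) w * ?G"
        using A1_const_ball_le[OF _ R e, of u] fin \<open>q = 1\<close>
        by (intro mult_right_mono) (auto simp: Aq_const_def)
      also have "\<dots> = ?K * ?b * (ess_inf_on (ball a R \<inter> \<Omega>) w' * ?G)"
        by (simp add: ess mult.assoc)
      also have "\<dots> \<le> ?K * ?b * ?I"
        unfolding g'[symmetric] using QB
        by (intro mult_left_mono ess_inf_on_mult_le) auto
      finally show ?thesis using \<open>q = 1\<close> by simp
    qed
  next
    case False
    then have q1: "1 < q" using q by simp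
    let ?W = "\<lambda>A w. \<integral>\<^sup>+y\<in>A \<inter> \<Omega>. inverse (ennreal (w y powr (1 / (q - 1)))) \<partial>lebesgue"
    have W': "?W A w = ?W A w'" for A
      by (intro nn_integral_cong) (auto simp: w'_def split: split_indicator)
    have b: "epowr ?b q < top"
      using emeasure_lborel_ball_neq_top[of a R] by (simp add: epowr_eq_top_iff flip: top.not_eq_extremum)
    have Key: "?U * epowr (?W (ball a R) w) (q - 1) \<le> ?K * epowr ?b q"
      using Aq_gt1_const_ball_le[OF q1 R] q1 by (simp add: Aq_const_def)
    show ?thesis
    proof (cases "?W (ball a R) w = top")
      case True
      \<comment> \<open>An infinite dual integral is compatible with a finite constant only if u has
        integral 0 over the ball.\<close>
      have "?K * epowr ?b q < top" using fin b by (simp add: ennreal_mult_less_top)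
      with Key True have "?U = 0" by (auto simp: ennreal_mult_top top_unique split: if_splits)
      then show ?thesis by simp
    next
      case False
      have WQ: "?W Q w' \<le> ?W (ball a R) w'"
        using QB by (intro nn_integral_mono) (auto split: split_indicator)
      then have Wfin: "?W Q w' < top" using False by (auto simp: W' less_top[symmetric] top_unique)
      have "epowr ?G q \<le> ?I * epowr (?W Q w') (q - 1)"
        unfolding I' using Wfin g0 w0 q1
        by (intro weighted_Holder) (auto simp: w'_eq)
      also have "\<dots> \<le> ?I * epowr (?W (ball a R) w) (q - 1)"
        using WQ q1 unfolding W' by (intro mult_left_mono epowr_mono) auto
      finally have "?U * epowr ?G q \<le> ?U * (?I * epowr (?W (ball a R) w) (q - 1))"
        by (rule mult_left_mono) simp
      also have "\<dots> = (?U * epowr (?W (ball a R) w) (q - 1)) * ?I"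
        by (simp add: mult_ac)
      also have "\<dots> \<le> (?K * epowr ?b q) * ?I"
        by (intro mult_right_mono Key) simp
      finally show ?thesis .
    qed
  qed
qed

section \<open>Differences of a function and averages of its gradient\<close>

text \<open>\<open>gradient\<close> is a definite description. Existence is the Riesz representation
  of the derivative in the standard basis; uniqueness follows by testing two candidates against
  their difference.\<close>

lemma has_derivative_gradient:
  fixes f :: "'a::euclidean_space \<Rightarrow> real"
  assumes "f differentiable (at x)"
  shows "(f has_derivative (\<lambda>h. h \<bullet> gradient f x)) (at x)"
proof -
  obtain D where D: "(f has_derivative D) (at x)"
    using assms by (auto simp: differentiable_def)
  then have lin: "linear D" by (intro has_derivative_linear)
  define g where "g = (\<Sum>i\<in>Basis. D i *\<^sub>R i)"
  have "D h = h \<bullet> g" for h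
  proof -
    have "D h = D (\<Sum>i\<in>Basis. (h \<bullet> i) *\<^sub>R i)" by (simp add: euclidean_representation)
    also have "\<dots> = h \<bullet> g"
      by (simp add: linear_sum[OF lin] linear_scale[OF lin] g_def inner_sum_right mult.commute)
    finally show ?thesis .
  qed
  then have "D = (\<lambda>h. h \<bullet> g)" by auto
  then have "GDERIV f x :> g" using D by (simp add: gderiv_def)
  moreover have "g' = g" if "GDERIV f x :> g'" for g'
  proof -
    have "(\<lambda>h. h \<bullet> g') = (\<lambda>h. h \<bullet> g)"
      using that \<open>GDERIV f x :> g\<close> unfolding gderiv_def by (rule has_derivative_unique)
    then have "(g' - g) \<bullet> g' = (g' - g) \<bullet> g" by (rule fun_cong)
    then have "(g' - g) \<bullet> (g' - g) = 0" by (simp add: inner_diff_right)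
    then show ?thesis by simp
  qed
  ultimately have "gradient f x = g" unfolding gradient_def by (rule the_equality)
  then show ?thesis using \<open>GDERIV f x :> g\<close> by (simp add: gderiv_def)
qed

text \<open>The fundamental theorem of calculus along the segment, which stays in \<Omega> by
  convexity. The interval is left open at 0 because it will be split into the intervals (2^-(j+1),
  2^-j].\<close>

lemma C1_on_segment_bound:
  fixes f :: "'a::euclidean_space \<Rightarrow> real"
  assumes f: "C1_on f \<Omega>" and conv: "convex \<Omega>" and x: "x \<in> \<Omega>" and z: "z \<in> \<Omega>"
  shows "ennreal \<bar>f x - f z\<bar> \<le>
    ennreal (norm (z - x)) * (\<integral>\<^sup>+t\<in>{0<..1}. ennreal (norm (gradient f (x + t *\<^sub>R (z - x)))) \<partial>lborel)"
proof -
  define \<phi> where "\<phi> t = x + t *\<^sub>R (z - x)" for t :: real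
  have \<phi>: "\<phi> t \<in> \<Omega>" if "t \<in> {0..1}" for t
    using convexD_alt[OF conv x z, of t] that by (simp add: \<phi>_def algebra_simps)
  have continuous_on_phi: "continuous_on {0..1} \<phi>"
    unfolding \<phi>_def by (intro continuous_intros)
  have cont: "continuous_on {0..1} (\<lambda>t. gradient f (\<phi> t))"
    using f unfolding C1_on_def
    by (intro continuous_on_compose2[of \<Omega> "gradient f" "{0..1}" \<phi>] continuous_on_phi) (auto dest: \<phi>)
  have "((\<lambda>t. f (\<phi> t)) has_vector_derivative ((z - x) \<bullet> gradient f (\<phi> t))) (at t within {0..1})"
    if "t \<in> {0..1}" for t
  proof -
    have "(f has_derivative (\<lambda>h. h \<bullet> gradient f (\<phi> t))) (at (\<phi> t))"
      using f \<phi>[OF that] by (intro has_derivative_gradient) (auto simp: C1_on_def)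
    moreover have "(\<phi> has_derivative (\<lambda>h. h *\<^sub>R (z - x))) (at t within {0..1})"
    proof -
      have "(\<phi> has_derivative (\<lambda>h. 0 + h *\<^sub>R (z - x))) (at t within {0..1})"
        unfolding \<phi>_def
        by (intro has_derivative_add has_derivative_const has_derivative_scaleR_left has_derivative_ident)
      then show ?thesis by simp
    qed
    ultimately have "((\<lambda>t. f (\<phi> t)) has_derivative (\<lambda>h. (h *\<^sub>R (z - x)) \<bullet> gradient f (\<phi> t))) (at t within {0..1})"
      by (rule has_derivative_compose[rotated])
    then show ?thesis by (simp add: has_vector_derivative_def)
  qed
  then have I: "((\<lambda>t. (z - x) \<bullet> gradient f (\<phi> t)) has_integral (f (\<phi> 1) - f (\<phi> 0))) {0..1}"
    by (intro fundamental_theorem_of_calculus) auto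
  have J: "(\<lambda>t. norm (z - x) * norm (gradient f (\<phi> t))) integrable_on {0..1}"
    by (intro integrable_continuous_interval continuous_intros cont)
  define J where "J = integral {0..1} (\<lambda>t. norm (z - x) * norm (gradient f (\<phi> t)))"
  have "norm (f (\<phi> 1) - f (\<phi> 0)) \<le> J"
    unfolding J_def integral_unique[OF I, symmetric]
    by (rule integral_norm_bound_integral[OF has_integral_integrable[OF I] J])
      (simp add: Cauchy_Schwarz_ineq2)
  then have "ennreal \<bar>f x - f z\<bar> \<le> ennreal J"
    by (intro ennreal_leI) (simp add: \<phi>_def abs_minus_commute)
  also have "ennreal J = (\<integral>\<^sup>+t. ennreal (indicator {0..1} t * (norm (z - x) * norm (gradient f (\<phi> t)))) \<partial>lborel)"
    using nn_integral_has_integral_lebesgue[of "{0..1}" "\<lambda>t. norm (z - x) * norm (gradient f (\<phi> t))" J]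
      integrable_integral[OF J]
    by (simp add: J_def nn_integral_completion)
  also have "\<dots> = (\<integral>\<^sup>+t\<in>{0..1}. ennreal (norm (z - x) * norm (gradient f (\<phi> t))) \<partial>lborel)"
    by (auto intro!: nn_integral_cong split: split_indicator)
  also have "\<dots> = (\<integral>\<^sup>+t. ennreal (norm (z - x)) * (ennreal (norm (gradient f (\<phi> t))) * indicator {0<..1} t) \<partial>lborel)"
    using AE_lborel_singleton[of "0::real"]
    by (intro nn_integral_cong_AE, eventually_elim) (auto simp: ennreal_mult split: split_indicator)
  also have "\<dots> = ennreal (norm (z - x)) * (\<integral>\<^sup>+t\<in>{0<..1}. ennreal (norm (gradient f (\<phi> t))) \<partial>lborel)"
  proof (rule nn_integral_cmult)
    \<comment> \<open>Beyond the segment nothing is known about the gradient along the line, so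
      measurability is proved for the function cut off to [0,1].\<close>
    define G where "G = (\<lambda>t. indicator {0..1} t *\<^sub>R gradient f (\<phi> t))"
    have [measurable]: "G \<in> borel_measurable lborel"
      using borel_measurable_continuous_on_indicator[OF _ cont] by (simp add: G_def)
    have "(\<lambda>t. ennreal (norm (G t)) * indicator {0<..1} t) \<in> borel_measurable lborel"
      by measurable
    also have "(\<lambda>t. ennreal (norm (G t)) * indicator {0<..1} t) =
      (\<lambda>t. ennreal (norm (gradient f (\<phi> t))) * indicator {0<..1} t)"
      by (auto simp: G_def split: split_indicator)
    finally show "(\<lambda>t. ennreal (norm (gradient f (\<phi> t))) * indicator {0<..1} t) \<in> borel_measurable lborel" .
  qed
  finally show ?thesis by (simp add: \<phi>_def)
qed

section \<open>Averages of segment integrals\<close>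

lemma nn_integral_lborel_affine:
  fixes F :: "'a::euclidean_space \<Rightarrow> ennreal"
  assumes [measurable]: "F \<in> borel_measurable borel" and c: "0 < c"
  shows "(\<integral>\<^sup>+z. F (s + c *\<^sub>R z) \<partial>lborel) = ennreal (1 / c ^ DIM('a)) * (\<integral>\<^sup>+z. F z \<partial>lborel)"
proof -
  have "(\<integral>\<^sup>+z. F z \<partial>lborel) =
      (\<integral>\<^sup>+z. F z \<partial>density (distr lborel borel (\<lambda>z. s + c *\<^sub>R z)) (\<lambda>_. ennreal (\<bar>c\<bar> ^ DIM('a))))"
    using c by (intro arg_cong[where f="\<lambda>M. nn_integral M F"] lborel_affine) auto
  also have "\<dots> = ennreal (c ^ DIM('a)) * (\<integral>\<^sup>+z. F (s + c *\<^sub>R z) \<partial>lborel)"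
    using c by (simp add: nn_integral_density nn_integral_distr nn_integral_cmult)
  finally have "ennreal (1 / c ^ DIM('a)) * (\<integral>\<^sup>+z. F z \<partial>lborel) =
      (ennreal (1 / c ^ DIM('a)) * ennreal (c ^ DIM('a))) * (\<integral>\<^sup>+z. F (s + c *\<^sub>R z) \<partial>lborel)"
    by (simp only: mult.assoc)
  also have "ennreal (1 / c ^ DIM('a)) * ennreal (c ^ DIM('a)) = 1"
    using c by (subst ennreal_mult[symmetric]) auto
  finally show ?thesis by simp
qed

lemma dyadic_fraction:
  fixes t :: real
  assumes "0 < t" "t \<le> 1"
  obtains j :: nat where "1 / 2 ^ Suc j < t" "t \<le> 1 / 2 ^ j"
proof -
  define j where "j = (LEAST j. 1 / 2 ^ Suc j < t)"
  have "\<exists>n. (1/2) ^ n < t" using assms(1) by (intro real_arch_pow_inv) auto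
  then obtain n where n: "(1/2) ^ n < t" by blast
  have "1 / 2 ^ Suc n < t"
  proof -
    have "(1/2::real) ^ Suc n \<le> (1/2) ^ n" by simp
    with n have "(1/2) ^ Suc n < t" by linarith
    then show ?thesis by (simp only: power_one_over)
  qed
  then have 1: "1 / 2 ^ Suc j < t" unfolding j_def by (rule LeastI)
  have "t \<le> 1 / 2 ^ j"
  proof (cases j)
    case 0 then show ?thesis using assms by simp
  next
    case (Suc i)
    then have "\<not> 1 / 2 ^ Suc i < t" unfolding j_def by (intro not_less_Least) simp
    then show ?thesis using Suc by simp
  qed
  with 1 show ?thesis using that by blast
qed

lemma suminf_upper_term_ennreal: "f j \<le> (\<Sum>j. f j)" for f :: "nat \<Rightarrow> ennreal"
  using sum_le_suminf[of f "{j}"] by simp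

text \<open>A dyadic form of the Riesz potential bound. For t in (2^-(j+1), 2^-j] the substitution v
  = x + t (z - x) contributes t^-D <= 2^((j+1) D) and maps S into the ball of radius \<rho> / 2^j,
  while the t-interval has length 2^-(j+1).\<close>

lemma nn_integral_cone_le:
  fixes H :: "'a::euclidean_space \<Rightarrow> ennreal"
  assumes [measurable]: "H \<in> borel_measurable borel" "S \<in> sets borel" and S: "S \<subseteq> ball x \<rho>"
  shows "(\<integral>\<^sup>+z\<in>S. (\<integral>\<^sup>+t\<in>{0<..1::real}. H (x + t *\<^sub>R (z - x)) \<partial>lborel) \<partial>lborel)
     \<le> (\<Sum>j. ennreal (2 ^ (Suc j * DIM('a)) / 2 ^ Suc j) * (\<integral>\<^sup>+v\<in>ball x (\<rho> / 2 ^ j). H v \<partial>lborel))"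
proof -
  define \<Psi> where "\<Psi> r = (\<integral>\<^sup>+v\<in>ball x r. H v \<partial>lborel)" for r
  define I where "I j = {1 / 2 ^ Suc j<..1 / 2 ^ j::real}" for j
  have "(\<integral>\<^sup>+z\<in>S. (\<integral>\<^sup>+t\<in>{0<..1::real}. H (x + t *\<^sub>R (z - x)) \<partial>lborel) \<partial>lborel) =
      (\<integral>\<^sup>+z. (\<integral>\<^sup>+t. H (x + t *\<^sub>R (z - x)) * indicator {0<..1} t * indicator S z \<partial>lborel) \<partial>lborel)"
    by (subst nn_integral_multc) auto
  also have "\<dots> = (\<integral>\<^sup>+t. (\<integral>\<^sup>+z. H (x + t *\<^sub>R (z - x)) * indicator {0<..1} t * indicator S z \<partial>lborel) \<partial>lborel)"
    by (intro lborel_pair.Fubini') measurable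
  also have "\<dots> \<le> (\<integral>\<^sup>+t. (\<Sum>j. ennreal (2 ^ (Suc j * DIM('a))) * \<Psi> (\<rho> / 2 ^ j) * indicator (I j) t) \<partial>lborel)"
  proof (intro nn_integral_mono)
    fix t :: real
    show "(\<integral>\<^sup>+z. H (x + t *\<^sub>R (z - x)) * indicator {0<..1} t * indicator S z \<partial>lborel) \<le>
      (\<Sum>j. ennreal (2 ^ (Suc j * DIM('a))) * \<Psi> (\<rho> / 2 ^ j) * indicator (I j) t)"
    proof (cases "0 < t \<and> t \<le> 1")
      case True
      then obtain j where j: "1 / 2 ^ Suc j < t" "t \<le> 1 / 2 ^ j" using dyadic_fraction by blast
      have "(\<integral>\<^sup>+z. H (x + t *\<^sub>R (z - x)) * indicator {0<..1} t * indicator S z \<partial>lborel) \<le>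
         (\<integral>\<^sup>+z. H ((x - t *\<^sub>R x) + t *\<^sub>R z) * indicator (ball x (\<rho> / 2 ^ j)) ((x - t *\<^sub>R x) + t *\<^sub>R z) \<partial>lborel)"
      proof (intro nn_integral_mono)
        fix z
        have eq: "x + t *\<^sub>R (z - x) = (x - t *\<^sub>R x) + t *\<^sub>R z" by (simp add: algebra_simps)
        have "(x - t *\<^sub>R x) + t *\<^sub>R z \<in> ball x (\<rho> / 2 ^ j)" if "z \<in> S"
        proof -
          have d: "dist x z < \<rho>" using that S by auto
          have "dist x ((x - t *\<^sub>R x) + t *\<^sub>R z) = t * dist x z"
            using True by (simp add: dist_norm norm_minus_commute flip: eq)
          also have "\<dots> \<le> 1 / 2 ^ j * dist x z" using j by (intro mult_right_mono) auto
          also have "\<dots> < 1 / 2 ^ j * \<rho>" using d by (intro mult_strict_left_mono) auto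
          finally show ?thesis by simp
        qed
        then show "H (x + t *\<^sub>R (z - x)) * indicator {0<..1} t * indicator S z \<le>
          H ((x - t *\<^sub>R x) + t *\<^sub>R z) * indicator (ball x (\<rho> / 2 ^ j)) ((x - t *\<^sub>R x) + t *\<^sub>R z)"
          using True unfolding eq by (auto split: split_indicator)
      qed
      also have "\<dots> = ennreal (1 / t ^ DIM('a)) * \<Psi> (\<rho> / 2 ^ j)"
        unfolding \<Psi>_def using True
        by (intro nn_integral_lborel_affine[of "\<lambda>v. H v * indicator (ball x (\<rho> / 2 ^ j)) v"]
            borel_measurable_times_ennreal borel_measurable_indicator) auto
      also have "\<dots> \<le> ennreal (2 ^ (Suc j * DIM('a))) * \<Psi> (\<rho> / 2 ^ j)"
      proof (intro mult_right_mono ennreal_leI)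
        have "1 / t \<le> 2 ^ Suc j" using j(1) True by (simp add: field_simps)
        then have "(1 / t) ^ DIM('a) \<le> (2 ^ Suc j) ^ DIM('a)"
          using True by (intro power_mono) auto
        then show "1 / t ^ DIM('a) \<le> 2 ^ (Suc j * DIM('a))"
          by (simp only: power_one_over power_mult)
      qed simp
      also have "\<dots> = ennreal (2 ^ (Suc j * DIM('a))) * \<Psi> (\<rho> / 2 ^ j) * indicator (I j) t"
        using j by (simp add: I_def)
      also have "\<dots> \<le> (\<Sum>j. ennreal (2 ^ (Suc j * DIM('a))) * \<Psi> (\<rho> / 2 ^ j) * indicator (I j) t)"
        by (rule suminf_upper_term_ennreal)
      finally show ?thesis .
    qed auto
  qed
  also have "\<dots> = (\<Sum>j. ennreal (2 ^ (Suc j * DIM('a))) * \<Psi> (\<rho> / 2 ^ j) * emeasure lborel (I j))"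
    by (subst nn_integral_suminf) (auto simp: I_def nn_integral_cmult_indicator)
  also have "\<dots> = (\<Sum>j. ennreal (2 ^ (Suc j * DIM('a)) / 2 ^ Suc j) * \<Psi> (\<rho> / 2 ^ j))"
  proof (intro arg_cong[where f=suminf] ext)
    fix j :: nat
    have "emeasure lborel (I j) = ennreal (1 / 2 ^ Suc j)"
      by (simp add: I_def field_simps)
    moreover have "ennreal (2 ^ (Suc j * DIM('a)) / 2 ^ Suc j) =
        ennreal (2 ^ (Suc j * DIM('a))) * ennreal (1 / 2 ^ Suc j)"
      by (subst ennreal_mult[symmetric]) auto
    ultimately show "ennreal (2 ^ (Suc j * DIM('a))) * \<Psi> (\<rho> / 2 ^ j) * emeasure lborel (I j) =
      ennreal (2 ^ (Suc j * DIM('a)) / 2 ^ Suc j) * \<Psi> (\<rho> / 2 ^ j)"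
      by (simp only: mult_ac)
  qed
  finally show ?thesis by (simp add: \<Psi>_def)
qed

text \<open>The radius |x - y| is admissible in \<open>ball_dev\<close>, being at most the diameter.
  Openness makes the intersection nonnull, so the quotient can be multiplied out.\<close>

lemma ball_dev_bound:
  fixes \<Omega> :: "'a::euclidean_space set"
  assumes fin: "ball_dev \<Omega> < top" and op: "open \<Omega>" and x: "x \<in> \<Omega>" and y: "y \<in> \<Omega>" and xy: "x \<noteq> y"
  shows "emeasure lborel (ball x (dist x y)) \<le> ball_dev \<Omega> * emeasure lborel (ball x (dist x y) \<inter> \<Omega>)"
proof -
  let ?B = "ball x (dist x y)"
  have "ennreal (dist x y) \<le> ediam \<Omega>"
    unfolding ediam_def using x y by (meson SUP_upper2 SUP_upper)
  then have *: "emeasure lebesgue ?B / emeasure lebesgue (?B \<inter> \<Omega>) \<le> ball_dev \<Omega>"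
    unfolding ball_dev_def using xy
    by (intro SUP_upper2[OF x] SUP_upper2[of "dist x y"]) auto
  have 1: "emeasure lebesgue (?B \<inter> \<Omega>) \<noteq> top"
    using emeasure_mono[of "?B \<inter> \<Omega>" ?B lebesgue] emeasure_lborel_ball_neq_top[of x "dist x y"] op
    by (auto simp: top_unique)
  have "x \<in> ?B \<inter> \<Omega>" using x xy by simp
  then have 2: "emeasure lebesgue (?B \<inter> \<Omega>) \<noteq> 0"
  proof -
    have "\<not> negligible (?B \<inter> \<Omega>)"
      using \<open>x \<in> ?B \<inter> \<Omega>\<close> op by (intro open_not_negligible open_Int open_ball) blast+
    moreover have "?B \<inter> \<Omega> \<in> sets lebesgue" using op by auto
    ultimately show ?thesis by (simp add: negligible_iff_null_sets null_sets_def)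
  qed
  have "emeasure lebesgue ?B = emeasure lebesgue ?B / emeasure lebesgue (?B \<inter> \<Omega>) * emeasure lebesgue (?B \<inter> \<Omega>)"
    by (rule ennreal_divide_mult_cancel[OF 2 1, symmetric])
  also have "\<dots> \<le> ball_dev \<Omega> * emeasure lebesgue (?B \<inter> \<Omega>)"
    by (rule mult_right_mono[OF *]) simp
  finally show ?thesis using op by simp
qed

text \<open>Extending \<open>gradient f\<close> by 0 makes it Borel measurable on the whole space, where its value outside \<open>\<Omega>\<close> would be an arbitrary choice.\<close>

definition grad_norm :: "'a::euclidean_space set \<Rightarrow> ('a \<Rightarrow> real) \<Rightarrow> 'a \<Rightarrow> real" where
  "grad_norm \<Omega> f x = norm (indicator \<Omega> x *\<^sub>R gradient f x)"

lemma grad_norm_nonneg [simp]: "0 \<le> grad_norm \<Omega> f x"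
  by (simp add: grad_norm_def)

lemma grad_norm_measurable:
  assumes "C1_on f \<Omega>" "open \<Omega>"
  shows "grad_norm \<Omega> f \<in> borel_measurable borel"
proof -
  have [measurable]: "(\<lambda>x. indicator \<Omega> x *\<^sub>R gradient f x) \<in> borel_measurable borel"
    using assms by (intro borel_measurable_continuous_on_indicator) (auto simp: C1_on_def)
  show ?thesis unfolding grad_norm_def[abs_def] by measurable
qed

lemma C1_on_average_bound:
  fixes f :: "'a::euclidean_space \<Rightarrow> real"
  assumes f: "C1_on f \<Omega>" and conv: "convex \<Omega>" and op: "open \<Omega>" and x: "x \<in> \<Omega>"
    and S: "S \<in> sets borel" "S \<subseteq> ball x \<rho> \<inter> \<Omega>"
  shows "(\<integral>\<^sup>+z\<in>S. ennreal \<bar>f x - f z\<bar> \<partial>lborel) \<le> ennreal \<rho> *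
    (\<Sum>j. ennreal (2 ^ (Suc j * DIM('a)) / 2 ^ Suc j) * (\<integral>\<^sup>+v\<in>ball x (\<rho> / 2 ^ j). ennreal (grad_norm \<Omega> f v) \<partial>lborel))"
proof -
  note [measurable] = grad_norm_measurable[OF f op] S(1)
  have "(\<integral>\<^sup>+z\<in>S. ennreal \<bar>f x - f z\<bar> \<partial>lborel) \<le>
    (\<integral>\<^sup>+z. ennreal \<rho> * ((\<integral>\<^sup>+t\<in>{0<..1}. ennreal (grad_norm \<Omega> f (x + t *\<^sub>R (z - x))) \<partial>lborel) * indicator S z) \<partial>lborel)"
  proof (intro nn_integral_mono)
    fix z
    show "ennreal \<bar>f x - f z\<bar> * indicator S z \<le>
      ennreal \<rho> * ((\<integral>\<^sup>+t\<in>{0<..1}. ennreal (grad_norm \<Omega> f (x + t *\<^sub>R (z - x))) \<partial>lborel) * indicator S z)"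
    proof (cases "z \<in> S")
      case True
      then have z: "z \<in> \<Omega>" "norm (z - x) \<le> \<rho>" using S(2) by (auto simp: dist_norm norm_minus_commute)
      have seg: "x + t *\<^sub>R (z - x) \<in> \<Omega>" if "t \<in> {0<..1}" for t
        using convexD_alt[OF conv x z(1), of t] that by (simp add: algebra_simps)
      have "ennreal \<bar>f x - f z\<bar> \<le> ennreal (norm (z - x)) *
          (\<integral>\<^sup>+t\<in>{0<..1}. ennreal (norm (gradient f (x + t *\<^sub>R (z - x)))) \<partial>lborel)"
        by (rule C1_on_segment_bound[OF f conv x z(1)])
      also have "(\<integral>\<^sup>+t\<in>{0<..1}. ennreal (norm (gradient f (x + t *\<^sub>R (z - x)))) \<partial>lborel) =
         (\<integral>\<^sup>+t\<in>{0<..1}. ennreal (grad_norm \<Omega> f (x + t *\<^sub>R (z - x))) \<partial>lborel)"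
        using seg by (intro nn_integral_cong) (auto simp: grad_norm_def split: split_indicator)
      also have "ennreal (norm (z - x)) * \<dots> \<le> ennreal \<rho> * \<dots>"
        using z(2) by (intro mult_right_mono ennreal_leI) auto
      finally show ?thesis using True by simp
    qed simp
  qed
  also have "\<dots> = ennreal \<rho> * (\<integral>\<^sup>+z\<in>S. (\<integral>\<^sup>+t\<in>{0<..1}. ennreal (grad_norm \<Omega> f (x + t *\<^sub>R (z - x))) \<partial>lborel) \<partial>lborel)"
    by (rule nn_integral_cmult) measurable
  also have "\<dots> \<le> ennreal \<rho> * (\<Sum>j. ennreal (2 ^ (Suc j * DIM('a)) / 2 ^ Suc j) * (\<integral>\<^sup>+v\<in>ball x (\<rho> / 2 ^ j). ennreal (grad_norm \<Omega> f v) \<partial>lborel))"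
    using S by (intro mult_left_mono nn_integral_cone_le) auto
  finally show ?thesis .
qed

lemma suminf_geometric_ennreal:
  fixes \<epsilon> \<theta> :: real
  assumes "0 < \<epsilon>" "0 \<le> \<theta>"
  shows "(\<Sum>j::nat. ennreal (\<theta> * 2 powr (- \<epsilon> * real j))) = ennreal (\<theta> / (1 - 2 powr - \<epsilon>))"
proof -
  have r: "0 < 2 powr - \<epsilon>" "2 powr - \<epsilon> < (1::real)"
    using assms by (auto simp: powr_less_one)
  have "2 powr (- \<epsilon> * real j) = (2 powr - \<epsilon>) ^ j" for j
    by (simp add: powr_powr flip: powr_realpow)
  moreover have "(\<lambda>j. \<theta> * (2 powr - \<epsilon>) ^ j) sums (\<theta> * (1 / (1 - 2 powr - \<epsilon>)))"
    using r by (intro sums_mult geometric_sums) auto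
  ultimately have "(\<lambda>j. \<theta> * 2 powr (- \<epsilon> * real j)) sums (\<theta> / (1 - 2 powr - \<epsilon>))"
    by simp
  then show ?thesis using assms by (intro suminf_ennreal_eq) auto
qed

text \<open>For z in S = B(x, r) \<inter> \<Omega> the triangle inequality gives L < |f x - f z| +
  |f y - f z|. Integrate over S, whose measure is at least |B(x, r)| / \<kappa>, and apply
  \<open>C1_on_average_bound\<close> at both points: if all terms lay below a geometric sequence of
  ratio 2^-\<epsilon>, its sum would be too small.\<close>

lemma difference_imp_large_average:
  fixes f :: "'a::euclidean_space \<Rightarrow> real" and \<epsilon> L :: real
  assumes f: "C1_on f \<Omega>" and conv: "convex \<Omega>" and op: "open \<Omega>" and dev: "ball_dev \<Omega> < top"
    and x: "x \<in> \<Omega>" and y: "y \<in> \<Omega>" and xy: "x \<noteq> y" and eps: "0 < \<epsilon>" and L: "0 < L" "L < \<bar>f y - f x\<bar>"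
  defines "r \<equiv> dist x y" and "\<kappa> \<equiv> enn2real (ball_dev \<Omega>)"
  shows "\<exists>j. \<exists>c\<in>{x, y}. ennreal ((1 - 2 powr - \<epsilon>) * unit_ball_vol (real DIM('a)) / 8 * (L / r) * (r ^ DIM('a) / \<kappa>)
      * 2 powr (- \<epsilon> * real j)) \<le>
    ennreal (2 ^ (Suc j * DIM('a)) / 2 ^ Suc j) * (\<integral>\<^sup>+v\<in>ball c (2 * r / 2 ^ j). ennreal (grad_norm \<Omega> f v) \<partial>lborel)"
proof (rule ccontr)
  define V where "V = unit_ball_vol (real DIM('a))"
  have V: "0 < V" by (simp add: V_def)
  define S where "S = ball x r \<inter> \<Omega>"
  have Sm [measurable]: "S \<in> sets borel" using op by (simp add: S_def)
  define T where "T c j = ennreal (2 ^ (Suc j * DIM('a)) / 2 ^ Suc j) *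
    (\<integral>\<^sup>+v\<in>ball c (2 * r / 2 ^ j). ennreal (grad_norm \<Omega> f v) \<partial>lborel)" for c and j :: nat
  \<comment> \<open>The 8 is made of a 2 for the radius 2 r, a 2 for the two endpoints, and a 2 that
    turns the final inequality into a contradiction.\<close>
  define \<theta> where "\<theta> = (1 - 2 powr - \<epsilon>) * V / 8 * (L / r) * (r ^ DIM('a) / \<kappa>)"
  have r: "0 < r" using xy by (simp add: r_def)
  have dev': "ball_dev \<Omega> = ennreal \<kappa>" using dev by (simp add: \<kappa>_def)
  have B: "ennreal (V * r ^ DIM('a)) \<le> ennreal \<kappa> * emeasure lborel S"
    using ball_dev_bound[OF dev op x y xy] r
    by (simp add: S_def dev' V_def r_def[symmetric] emeasure_ball)
  have Sfin: "emeasure lborel S \<noteq> top"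
    using emeasure_mono[of S "ball x r" lborel] emeasure_lborel_ball_neq_top[of x r]
    by (auto simp: top_unique S_def)
  then obtain s where s: "emeasure lborel S = ennreal s" "0 \<le> s" by (cases "emeasure lborel S") auto
  have k0: "0 \<le> \<kappa>" by (simp add: \<kappa>_def)
  have B': "V * r ^ DIM('a) \<le> \<kappa> * s"
    using B s k0 by (simp add: ennreal_le_iff flip: ennreal_mult)
  moreover have pos: "0 < V * r ^ DIM('a)" using V r by simp
  ultimately have "0 < \<kappa> * s" by linarith
  then have \<kappa>: "0 < \<kappa>" and s0: "0 < s" using k0 s(2) by (auto simp: zero_less_mult_iff)
  have e1: "2 powr - \<epsilon> < (1::real)" using eps by (simp add: powr_less_one)
  have \<theta>: "0 < \<theta>" using e1 V L r \<kappa> by (simp add: \<theta>_def)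
  assume "\<not> ?thesis"
  then have neg: "T c j \<le> ennreal (\<theta> * 2 powr (- \<epsilon> * real j))" if "c \<in> {x, y}" for c j
    using that by (auto simp: not_le T_def \<theta>_def V_def intro: less_imp_le)
  have avg: "(\<integral>\<^sup>+z\<in>S. ennreal \<bar>f c - f z\<bar> \<partial>lborel) \<le> ennreal (2 * r * (\<theta> / (1 - 2 powr - \<epsilon>)))" if c: "c \<in> {x, y}" for c
  proof -
    \<comment> \<open>The radius 2 r serves both centres, since S lies in B(x, r) and y has distance
      r from x.\<close>
    have "S \<subseteq> ball c (2 * r) \<inter> \<Omega>"
    proof
      fix z assume "z \<in> S"
      then have z: "dist x z < r" "z \<in> \<Omega>" by (auto simp: S_def)
      have "dist y z \<le> r + dist x z" unfolding r_def by (metis dist_commute dist_triangle)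
      then have "dist y z < 2 * r" "dist x z < 2 * r" using z(1) r by linarith+
      then have "dist c z < 2 * r" using c by auto
      then show "z \<in> ball c (2 * r) \<inter> \<Omega>" using z by simp
    qed
    then have "(\<integral>\<^sup>+z\<in>S. ennreal \<bar>f c - f z\<bar> \<partial>lborel) \<le> ennreal (2 * r) * (\<Sum>j. T c j)"
      unfolding T_def using c x y by (intro C1_on_average_bound[OF f conv op]) auto
    also have "\<dots> \<le> ennreal (2 * r) * (\<Sum>j. ennreal (\<theta> * 2 powr (- \<epsilon> * real j)))"
      by (intro mult_left_mono suminf_le neg c) auto
    also have "\<dots> = ennreal (2 * r) * ennreal (\<theta> / (1 - 2 powr - \<epsilon>))"
      using \<theta> eps by (subst suminf_geometric_ennreal) auto
    also have "\<dots> = ennreal (2 * r * (\<theta> / (1 - 2 powr - \<epsilon>)))"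
      using r \<theta> e1 by (intro ennreal_mult[symmetric]) auto
    finally show ?thesis .
  qed
  have fc: "continuous_on \<Omega> f"
    using f unfolding C1_on_def
    by (auto intro!: continuous_at_imp_continuous_on differentiable_imp_continuous_within)
  have fm: "(\<lambda>z. ennreal \<bar>f c - f z\<bar> * indicator S z) \<in> borel_measurable lborel" for c
  proof -
    have [measurable]: "(\<lambda>z. indicator S z *\<^sub>R f z) \<in> borel_measurable borel"
      using fc by (intro borel_measurable_continuous_on_indicator) (auto simp: S_def op intro: continuous_on_subset)
    have "(\<lambda>z. ennreal \<bar>f c - indicator S z *\<^sub>R f z\<bar> * indicator S z) \<in> borel_measurable lborel" by measurable
    also have "(\<lambda>z. ennreal \<bar>f c - indicator S z *\<^sub>R f z\<bar> * indicator S z) = (\<lambda>z. ennreal \<bar>f c - f z\<bar> * indicator S z)"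
      by (auto split: split_indicator)
    finally show ?thesis .
  qed
  have "ennreal (L * s) = (\<integral>\<^sup>+z. ennreal L * indicator S z \<partial>lborel)"
    using s L by (simp add: nn_integral_cmult_indicator ennreal_mult)
  also have "\<dots> \<le> (\<integral>\<^sup>+z. ennreal \<bar>f x - f z\<bar> * indicator S z + ennreal \<bar>f y - f z\<bar> * indicator S z \<partial>lborel)"
  proof (intro nn_integral_mono)
    fix z
    have "L \<le> \<bar>f x - f z\<bar> + \<bar>f y - f z\<bar>" using L(2) by linarith
    then show "ennreal L * indicator S z \<le> ennreal \<bar>f x - f z\<bar> * indicator S z + ennreal \<bar>f y - f z\<bar> * indicator S z"
      by (auto split: split_indicator intro!: ennreal_leI simp flip: ennreal_plus)
  qed
  also have "\<dots> = (\<integral>\<^sup>+z\<in>S. ennreal \<bar>f x - f z\<bar> \<partial>lborel) + (\<integral>\<^sup>+z\<in>S. ennreal \<bar>f y - f z\<bar> \<partial>lborel)"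
    by (intro nn_integral_add fm)
  also have "\<dots> \<le> ennreal (2 * r * (\<theta> / (1 - 2 powr - \<epsilon>))) + ennreal (2 * r * (\<theta> / (1 - 2 powr - \<epsilon>)))"
    by (intro add_mono avg) auto
  also have "\<dots> = ennreal (4 * r * (\<theta> / (1 - 2 powr - \<epsilon>)))"
    using r \<theta> e1 by (subst ennreal_plus[symmetric]) auto
  finally have "L * s \<le> 4 * r * (\<theta> / (1 - 2 powr - \<epsilon>))"
    using r \<theta> e1 by (subst (asm) ennreal_le_iff) auto
  also have "\<dots> = L * (V * r ^ DIM('a) / \<kappa>) / 2"
  proof -
    have "\<theta> / (1 - 2 powr - \<epsilon>) = V / 8 * (L / r) * (r ^ DIM('a) / \<kappa>)"
      using e1 eps by (simp add: \<theta>_def)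
    then show ?thesis using r by simp
  qed
  also have "\<dots> \<le> L * s / 2"
    using B' L \<kappa> by (simp add: field_simps)
  finally show False using L s0 by (simp add: mult_pos_pos not_le)
qed

section \<open>Dyadic cubes\<close>

text \<open>The lower corner of the half-open dyadic cube of side 2^k containing x;
  \<open>powr\<close> admits negative k. A cube is addressed by a pair (k, a) with a in
  \<open>range (corner k)\<close>.\<close>

definition corner :: "int \<Rightarrow> 'a::euclidean_space \<Rightarrow> 'a" where
  "corner k x = (\<Sum>i\<in>Basis. (2 powr real_of_int k * real_of_int \<lfloor>(x \<bullet> i) / 2 powr real_of_int k\<rfloor>) *\<^sub>R i)"

lemma corner_inner:
  "i \<in> Basis \<Longrightarrow> corner k x \<bullet> i = 2 powr real_of_int k * real_of_int \<lfloor>(x \<bullet> i) / 2 powr real_of_int k\<rfloor>"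
  by (simp add: corner_def inner_sum_left_Basis)

text \<open>Nestedness of the dyadic grid: the cube of generation k' containing x depends only on
  the smaller cube containing x. In each coordinate, the floor of t / 2^n is the integer quotient of
  the floor of t by 2^n.\<close>

lemma corner_corner:
  fixes x :: "'a::euclidean_space"
  assumes "k \<le> k'"
  shows "corner k' (corner k x) = corner k' x"
proof (rule euclidean_eqI)
  fix i :: 'a assume i: "i \<in> Basis"
  define n where "n = nat (k' - k)"
  have k': "2 powr real_of_int k' = 2 powr real_of_int k * real_of_int (2 ^ n)"
    using assms by (simp add: n_def powr_add[symmetric] flip: powr_realpow)
  define t where "t = (x \<bullet> i) / 2 powr real_of_int k"
  have 1: "\<lfloor>(corner k x \<bullet> i) / 2 powr real_of_int k'\<rfloor> = \<lfloor>t\<rfloor> div 2 ^ n"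
    using floor_divide_of_int_eq[of "\<lfloor>t\<rfloor>" "2 ^ n", where ?'a=real] by (simp add: corner_inner[OF i] k' t_def)
  have 2: "\<lfloor>(x \<bullet> i) / 2 powr real_of_int k'\<rfloor> = \<lfloor>t\<rfloor> div 2 ^ n"
    using floor_divide_real_eq_div[of "2 ^ n" t] by (simp add: k' t_def)
  show "corner k' (corner k x) \<bullet> i = corner k' x \<bullet> i"
    unfolding corner_inner[OF i, of k'] 1 2 ..
qed

lemma corner_idem [simp]: "corner k (corner k x) = corner k x"
  by (rule corner_corner) simp

lemma corner_inner_bound:
  assumes "i \<in> Basis"
  shows "\<bar>(x - corner k x) \<bullet> i\<bar> \<le> 2 powr real_of_int k"
proof -
  let ?l = "2 powr real_of_int k"
  have "(x - corner k x) \<bullet> i = ?l * ((x \<bullet> i) / ?l - of_int \<lfloor>(x \<bullet> i) / ?l\<rfloor>)"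
    using assms by (simp add: inner_diff_left corner_inner right_diff_distrib)
  also have "\<bar>\<dots>\<bar> \<le> ?l * 1"
    unfolding abs_mult by (intro mult_mono) (auto, linarith+)
  finally show ?thesis by simp
qed

lemma dist_corner_le: "dist x (corner k x) \<le> real DIM('a) * 2 powr real_of_int k"
  for x :: "'a::euclidean_space"
proof -
  have "dist x (corner k x) \<le> (\<Sum>i\<in>Basis. \<bar>(x - corner k x) \<bullet> i\<bar>)"
    unfolding dist_norm by (rule norm_le_l1)
  also have "\<dots> \<le> (\<Sum>i\<in>(Basis::'a set). 2 powr real_of_int k)"
    by (intro sum_mono corner_inner_bound)
  finally show ?thesis by simp
qed

lemma corner_measurable [measurable]: "corner k \<in> borel_measurable borel"
  unfolding corner_def[abs_def] by measurable

definition cube :: "int \<Rightarrow> 'a::euclidean_space \<Rightarrow> 'a set" where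
  "cube k a = {x. corner k x = a}"

lemma cube_borel [measurable]: "cube k a \<in> sets borel"
  unfolding cube_def by measurable

lemma cube_subset_ball:
  fixes a :: "'a::euclidean_space"
  shows "cube k a \<subseteq> ball a (2 * real DIM('a) * 2 powr real_of_int k)"
proof
  fix x assume "x \<in> cube k a"
  then have "dist a x \<le> real DIM('a) * 2 powr real_of_int k"
    using dist_corner_le[of x k] by (auto simp: cube_def dist_commute)
  \<comment> \<open>The factor 2 provides the strict inequality of an open ball.\<close>
  also have "\<dots> < 2 * real DIM('a) * 2 powr real_of_int k" by simp
  finally show "x \<in> ball a (2 * real DIM('a) * 2 powr real_of_int k)" by simp
qed

lemma countable_range_corner: "countable (range (corner k :: 'a::euclidean_space \<Rightarrow> 'a))"
proof -
  define h where "h v = (\<Sum>i\<in>Basis. (2 powr real_of_int k * real_of_int (v i)) *\<^sub>R i)" for v :: "'a \<Rightarrow> int"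
  have "range (corner k) \<subseteq> h ` (Basis \<rightarrow>\<^sub>E UNIV)"
  proof
    fix a assume "a \<in> range (corner k :: 'a \<Rightarrow> 'a)"
    then obtain x where a: "a = corner k x" by auto
    define v where "v = restrict (\<lambda>i. \<lfloor>(x \<bullet> i) / 2 powr real_of_int k\<rfloor>) Basis"
    have "a = h v" by (auto simp: a h_def v_def corner_def intro!: sum.cong)
    moreover have "v \<in> Basis \<rightarrow>\<^sub>E UNIV" by (simp add: v_def)
    ultimately show "a \<in> h ` (Basis \<rightarrow>\<^sub>E UNIV)" by blast
  qed
  moreover have "countable (h ` (Basis \<rightarrow>\<^sub>E UNIV))"
    by (intro countable_image countable_PiE) auto
  ultimately show ?thesis by (rule countable_subset)
qed

text \<open>In units of the side, coordinates differ from those of c by less than 2, so their floors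
  differ by at most 2: five values in each direction.\<close>

lemma finite_ball_corners:
  fixes c :: "'a::euclidean_space" and k :: int
  defines "A \<equiv> corner k ` ball c (2 * 2 powr real_of_int k)"
  shows "finite A" and "card A \<le> 5 ^ DIM('a)"
proof -
  define l :: real where "l = 2 powr real_of_int k"
  have l: "0 < l" by (simp add: l_def)
  define h where "h v = (\<Sum>i\<in>Basis. (l * real_of_int (\<lfloor>(c \<bullet> i) / l\<rfloor> + v i)) *\<^sub>R i)" for v :: "'a \<Rightarrow> int"
  define E :: "('a \<Rightarrow> int) set" where "E = Basis \<rightarrow>\<^sub>E {-2..2}"
  have E: "finite E" "card E = 5 ^ DIM('a)"
    by (auto simp: E_def card_PiE intro!: finite_PiE)
  have sub: "A \<subseteq> h ` E"
  proof
    fix a assume "a \<in> A"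
    then obtain x where x: "dist c x < 2 * l" "a = corner k x" by (auto simp: A_def l_def)
    define v where "v = restrict (\<lambda>i. \<lfloor>(x \<bullet> i) / l\<rfloor> - \<lfloor>(c \<bullet> i) / l\<rfloor>) Basis"
    have "a = h v" by (auto simp: x h_def v_def corner_def l_def intro!: sum.cong)
    moreover have "v \<in> E"
    proof -
      have "\<lfloor>(x \<bullet> i) / l\<rfloor> - \<lfloor>(c \<bullet> i) / l\<rfloor> \<in> {-2..2}" if i: "i \<in> Basis" for i
      proof -
        have "\<bar>(x - c) \<bullet> i\<bar> < 2 * l"
          using Basis_le_norm[OF i, of "x - c"] x(1) by (simp add: dist_norm norm_minus_commute)
        then have "\<bar>(x \<bullet> i) / l - (c \<bullet> i) / l\<bar> < 2"
          using l by (simp add: inner_diff_left pos_divide_less_eq flip: diff_divide_distrib)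
        then show ?thesis by (simp add: abs_less_iff) linarith
      qed
      then show ?thesis by (auto simp: E_def v_def)
    qed
    ultimately show "a \<in> h ` E" by blast
  qed
  then show "finite A" using E(1) by (auto intro: finite_subset)
  show "card A \<le> 5 ^ DIM('a)"
    using surj_card_le[OF E(1) sub] E(2) by simp
qed

text \<open>Pigeonhole: at most 5^D cubes meet the ball and together they cover it; the one of
  largest mass is taken. The point x records that this cube meets the ball.\<close>

lemma large_cube_in_ball:
  fixes c :: "'a::euclidean_space" and H :: "'a \<Rightarrow> ennreal"
  assumes [measurable]: "H \<in> borel_measurable borel"
  obtains x where "dist c x < 2 * 2 powr real_of_int k"
    and "(\<integral>\<^sup>+v\<in>ball c (2 * 2 powr real_of_int k). H v \<partial>lborel)
      \<le> ennreal (5 ^ DIM('a)) * (\<integral>\<^sup>+v\<in>cube k (corner k x). H v \<partial>lborel)"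
proof (rule ccontr)
  define A where "A = corner k ` ball c (2 * 2 powr real_of_int k)"
  note fin = finite_ball_corners[of k c, folded A_def]
  let ?I = "\<integral>\<^sup>+v\<in>ball c (2 * 2 powr real_of_int k). H v \<partial>lborel"
  have "c \<in> ball c (2 * 2 powr real_of_int k)" by simp
  then have ne: "A \<noteq> {}" by (auto simp: A_def)
  obtain a where a: "a \<in> A" and max: "\<And>b. b \<in> A \<Longrightarrow>
      (\<integral>\<^sup>+v\<in>cube k b. H v \<partial>lborel) \<le> (\<integral>\<^sup>+v\<in>cube k a. H v \<partial>lborel)"
    using finite_has_maximal2 ne
      Max_in[of "(\<lambda>b. \<integral>\<^sup>+v\<in>cube k b. H v \<partial>lborel) ` A"] Max_ge[of "(\<lambda>b. \<integral>\<^sup>+v\<in>cube k b. H v \<partial>lborel) ` A"] fin(1)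
    by (smt (verit) finite_imageI imageE imageI image_is_empty)
  have "?I \<le> (\<integral>\<^sup>+v. (\<Sum>b\<in>A. H v * indicator (cube k b) v) \<partial>lborel)"
  proof (intro nn_integral_mono)
    fix v
    show "H v * indicator (ball c (2 * 2 powr real_of_int k)) v \<le> (\<Sum>b\<in>A. H v * indicator (cube k b) v)"
    proof (cases "v \<in> ball c (2 * 2 powr real_of_int k)")
      case True
      then have "corner k v \<in> A" by (auto simp: A_def)
      then have "H v * indicator (cube k (corner k v)) v \<le> (\<Sum>b\<in>A. H v * indicator (cube k b) v)"
        using fin(1) by (intro member_le_sum) auto
      then show ?thesis using True by (simp add: cube_def)
    qed simp
  qed
  also have "\<dots> = (\<Sum>b\<in>A. \<integral>\<^sup>+v\<in>cube k b. H v \<partial>lborel)"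
    by (rule nn_integral_sum) measurable
  also have "\<dots> \<le> (\<Sum>b\<in>A. \<integral>\<^sup>+v\<in>cube k a. H v \<partial>lborel)"
    by (intro sum_mono max)
  also have "\<dots> = of_nat (card A) * (\<integral>\<^sup>+v\<in>cube k a. H v \<partial>lborel)" by simp
  also have "\<dots> \<le> of_nat (5 ^ DIM('a)) * (\<integral>\<^sup>+v\<in>cube k a. H v \<partial>lborel)"
    using fin(2) by (intro mult_right_mono of_nat_mono) auto
  also have "of_nat (5 ^ DIM('a)) = ennreal (5 ^ DIM('a))"
    by (simp add: ennreal_of_nat_eq_real_of_nat)
  finally have *: "?I \<le> ennreal (5 ^ DIM('a)) * (\<integral>\<^sup>+v\<in>cube k a. H v \<partial>lborel)" .
  assume "\<not> thesis"
  with * a show False using that by (auto simp: A_def)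
qed

section \<open>The measure of pairs near a cube\<close>

text \<open>If f is not measurable, \<open>density\<close> may fail to be a measure, and
  \<open>emeasure\<close> is then 0. The inequality thus gives access to \<open>mu_weight\<close>
  without a measurability proof for its density on the product.\<close>

lemma emeasure_density_le: "emeasure (density M f) A \<le> (\<integral>\<^sup>+x. f x * indicator A x \<partial>M)"
  by (simp add: density_def emeasure_measure_of_conv)

text \<open>Counterpart of \<open>mu_weight\<close> on the Borel product of the whole space;
  \<Omega> is to be remembered only through U, a Borel version of u extended by 0.\<close>

definition weight_kernel_measure :: "('a::euclidean_space \<Rightarrow> ennreal) \<Rightarrow> real \<Rightarrow> ('a \<times> 'a) measure" where
  "weight_kernel_measure U \<gamma> =
     density (lborel \<Otimes>\<^sub>M lborel) (\<lambda>(x, y). U x * ennreal (norm (y - x) powr (\<gamma> - real DIM('a))))"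

lemma sets_weight_kernel_measure [measurable_cong]: "sets (weight_kernel_measure U \<gamma>) = sets (borel \<Otimes>\<^sub>M borel)"
  by (simp add: weight_kernel_measure_def cong: sets_pair_measure_cong)

lemma AE_lborel_pair_fst:
  assumes "AE x in lborel. P (x::'a::euclidean_space)"
  shows "AE z in (lborel \<Otimes>\<^sub>M lborel :: ('a \<times> 'b::euclidean_space) measure). P (fst z)"
proof -
  obtain N where N: "{x. \<not> P x} \<subseteq> N" "N \<in> null_sets lborel"
    using assms by (auto elim!: AE_E simp: null_sets_def)
  have "emeasure (lborel \<Otimes>\<^sub>M lborel) (N \<times> (UNIV :: 'b set)) = 0"
    using N(2) by (subst lborel.emeasure_pair_measure_Times) auto
  moreover have "N \<times> (UNIV :: 'b set) \<in> sets (lborel \<Otimes>\<^sub>M lborel)"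
    using N(2) by auto
  ultimately have "N \<times> (UNIV :: 'b set) \<in> null_sets (lborel \<Otimes>\<^sub>M lborel)" by (intro null_setsI)
  then show ?thesis by (rule AE_I') (use N(1) in auto)
qed

text \<open>The weight u is only Lebesgue measurable; replacing it by a Borel version U makes Tonelli on the Borel product available.\<close>

lemma mu_weight_le:
  fixes u :: "'a::euclidean_space \<Rightarrow> real"
  assumes Om: "open \<Omega>" and u0: "\<And>x. x \<in> \<Omega> \<Longrightarrow> 0 \<le> u x"
    and U: "AE x in lborel. ennreal (u x) * indicator \<Omega> x = U x" and [measurable]: "U \<in> borel_measurable borel"
    and E: "E \<subseteq> \<Omega> \<times> \<Omega>" "E \<in> sets borel"
  shows "emeasure (mu_weight \<Omega> u \<gamma>) E \<le> emeasure (weight_kernel_measure U \<gamma>) E"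
proof -
  have Em [measurable]: "E \<in> sets (borel \<Otimes>\<^sub>M borel)" using E(2) by (simp only: borel_prod)
  let ?F = "\<lambda>(x, y). ennreal (u x * norm (y - x) powr (\<gamma> - real DIM('a)))"
  let ?F' = "\<lambda>(x, y). U x * ennreal (norm (y - x) powr (\<gamma> - real DIM('a)))"
  have "emeasure (mu_weight \<Omega> u \<gamma>) E \<le> (\<integral>\<^sup>+z. ?F z * indicator E z \<partial>lebesgue_on (\<Omega> \<times> \<Omega>))"
    unfolding mu_weight_def by (rule emeasure_density_le)
  also have "\<dots> = (\<integral>\<^sup>+z. ?F z * indicator E z * indicator (\<Omega> \<times> \<Omega>) z \<partial>lebesgue)"
    using Om by (subst nn_integral_restrict_space) (auto simp: open_Times)
  also have "\<dots> = (\<integral>\<^sup>+z. ?F z * indicator E z * indicator (\<Omega> \<times> \<Omega>) z \<partial>(lborel \<Otimes>\<^sub>M lborel))"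
    by (simp add: nn_integral_completion lborel_prod)
  also have "\<dots> \<le> (\<integral>\<^sup>+z. ?F' z * indicator E z \<partial>(lborel \<Otimes>\<^sub>M lborel))"
    using AE_lborel_pair_fst[OF U]
  proof (intro nn_integral_mono_AE, eventually_elim)
    fix z :: "'a \<times> 'a" assume z: "ennreal (u (fst z)) * indicator \<Omega> (fst z) = U (fst z)"
    show "?F z * indicator E z * indicator (\<Omega> \<times> \<Omega>) z \<le> ?F' z * indicator E z"
    proof (cases "z \<in> \<Omega> \<times> \<Omega>")
      case True
      then have "U (fst z) = ennreal (u (fst z))" using z by auto
      then show ?thesis using True u0 by (cases z) (auto simp: ennreal_mult split: split_indicator)
    qed (use E in auto)
  qed
  also have "\<dots> = emeasure (weight_kernel_measure U \<gamma>) E"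
    unfolding weight_kernel_measure_def by (subst emeasure_density) (auto simp: Em)
  finally show ?thesis .
qed

lemma powr_le_on_dyadic_annulus:
  fixes t \<rho> s :: real
  assumes "\<rho> / 2 < t" "t \<le> \<rho>" "0 < \<rho>"
  shows "t powr s \<le> 2 powr \<bar>s\<bar> * \<rho> powr s"
proof (cases "0 \<le> s")
  case True
  then have "t powr s \<le> 1 * \<rho> powr s" using assms by (auto intro: powr_mono2)
  also have "1 * \<rho> powr s \<le> 2 powr \<bar>s\<bar> * \<rho> powr s"
    by (intro mult_right_mono ge_one_powr_ge_zero) auto
  finally show ?thesis .
next
  case False
  then have "t powr s \<le> (\<rho> / 2) powr s" using assms by (intro powr_mono2') auto
  also have "\<dots> = 2 powr \<bar>s\<bar> * \<rho> powr s" using assms False by (simp add: powr_divide powr_minus field_simps)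
  finally show ?thesis .
qed

text \<open>On the annulus the kernel is at most a constant times \<rho>^(\<gamma> - D), and Tonelli
  does the rest. The set Z x enclosing the y-section is left free because it will be either a ball
  about x or a fixed ball about the cube.\<close>

lemma weight_kernel_measure_annulus_le:
  fixes P :: "('a::euclidean_space \<times> 'a) set"
  assumes [measurable]: "U \<in> borel_measurable borel" "B \<in> sets borel" and Pm: "P \<in> sets (borel \<Otimes>\<^sub>M borel)" and \<rho>: "0 < \<rho>"
    and P: "\<And>x y. (x, y) \<in> P \<Longrightarrow> x \<in> B \<and> \<rho> / 2 < norm (y - x) \<and> norm (y - x) \<le> \<rho> \<and> y \<in> Z x"
    and Zm: "\<And>x. Z x \<in> sets borel" and Z: "\<And>x. emeasure lborel (Z x) \<le> v"
  shows "emeasure (weight_kernel_measure U \<gamma>) P \<le>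
    ennreal (2 powr \<bar>\<gamma> - real DIM('a)\<bar> * \<rho> powr (\<gamma> - real DIM('a))) * v * (\<integral>\<^sup>+x\<in>B. U x \<partial>lborel)"
proof -
  note [measurable] = Pm
  let ?s = "\<gamma> - real DIM('a)"
  let ?c = "ennreal (2 powr \<bar>?s\<bar> * \<rho> powr ?s)"
  let ?F = "\<lambda>x y. U x * ennreal (norm (y - x) powr ?s) * indicator P (x, y)"
  have "emeasure (weight_kernel_measure U \<gamma>) P = (\<integral>\<^sup>+z. (case z of (x, y) \<Rightarrow> ?F x y) \<partial>(lborel \<Otimes>\<^sub>M lborel))"
    unfolding weight_kernel_measure_def
    by (subst emeasure_density) (auto simp: Pm intro!: nn_integral_cong)
  also have "\<dots> = (\<integral>\<^sup>+x. \<integral>\<^sup>+y. ?F x y \<partial>lborel \<partial>lborel)"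
    by (subst lborel.nn_integral_fst[symmetric]) auto
  also have "\<dots> \<le> (\<integral>\<^sup>+x. (?c * v) * (U x * indicator B x) \<partial>lborel)"
  proof (intro nn_integral_mono)
    fix x
    have "(\<integral>\<^sup>+y. ?F x y \<partial>lborel) \<le> (\<integral>\<^sup>+y. U x * indicator B x * ?c * indicator (Z x) y \<partial>lborel)"
    proof (intro nn_integral_mono)
      fix y
      show "?F x y \<le> U x * indicator B x * ?c * indicator (Z x) y"
      proof (cases "(x, y) \<in> P")
        case True
        note P[OF this]
        moreover from this have "ennreal (norm (y - x) powr ?s) \<le> ?c"
          using \<rho> by (intro ennreal_leI powr_le_on_dyadic_annulus) auto
        ultimately show ?thesis using True by (auto intro!: mult_left_mono)
      qed simp
    qed
    also have "\<dots> = U x * indicator B x * ?c * emeasure lborel (Z x)"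
      using Zm by (intro nn_integral_cmult_indicator) auto
    also have "\<dots> \<le> U x * indicator B x * ?c * v"
      by (intro mult_left_mono Z) auto
    finally show "(\<integral>\<^sup>+y. ?F x y \<partial>lborel) \<le> (?c * v) * (U x * indicator B x)"
      by (simp only: mult_ac)
  qed
  also have "\<dots> = ?c * v * (\<integral>\<^sup>+x\<in>B. U x \<partial>lborel)"
    by (rule nn_integral_cmult) measurable
  finally show ?thesis .
qed

text \<open>z = top has to be excluded: for y = top the quotient \<open>top / top\<close> is
  0.\<close>

lemma ennreal_le_divide_of_mult_le:
  fixes x y z :: ennreal
  assumes "x * y \<le> z" "y \<noteq> 0" "z \<noteq> top"
  shows "x \<le> z / y"
proof (cases "y = top")
  case True
  then have "x = 0" using assms by (auto simp: ennreal_mult_top top_unique split: if_splits)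
  then show ?thesis by simp
next
  case False
  then have "x = x * y / y" using assms(2) by (simp add: ennreal_mult_divide_eq)
  also have "\<dots> \<le> z / y" using assms(1) by (rule divide_right_mono_ennreal)
  finally show ?thesis .
qed

text \<open>The flag b tells whether x or y is the point close to the cube (k, a), and |x - y| is
  about 2^m sides. The factor 5 D is the 4 D of \<open>heavy_cube_exists\<close> plus a D for the
  passage to a larger cube in \<open>maximal_heavy_cover\<close>.\<close>

definition pairs_near :: "bool \<Rightarrow> int \<Rightarrow> int \<Rightarrow> 'a::euclidean_space \<Rightarrow> ('a \<times> 'a) set" where
  "pairs_near b m k a = {(x, y). dist a (if b then x else y) < 5 * real DIM('a) * 2 powr real_of_int k \<and>
     2 powr real_of_int (k + m) / 2 < norm (y - x) \<and> norm (y - x) \<le> 2 powr real_of_int (k + m)}"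

lemma pairs_near_sets: "pairs_near b m k a \<in> sets (borel \<Otimes>\<^sub>M borel)"
proof -
  have "pairs_near b m k a = {z \<in> space (borel \<Otimes>\<^sub>M borel). dist a (if b then fst z else snd z) < 5 * real DIM('a) * 2 powr real_of_int k \<and>
     2 powr real_of_int (k + m) / 2 < norm (snd z - fst z) \<and> norm (snd z - fst z) \<le> 2 powr real_of_int (k + m)}"
    by (auto simp: pairs_near_def space_pair_measure)
  also have "\<dots> \<in> sets (borel \<Otimes>\<^sub>M borel)" by (cases b) simp_all
  finally show ?thesis .
qed

text \<open>Let l be the side, \<rho> = 2^m l, and M the ratio by which a ball of radius about l
  must be inflated to contain all x. The annulus bound gives \<rho>^(\<gamma> - D) times a y-volume
  of order (\<rho> / M)^D times the integral of u, and the weight condition on the inflated ball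
  costs (M l)^(D q). The net loss M^(D (q - 1)) is the second term of the exponent.\<close>

lemma weight_kernel_measure_pairs_near_le:
  fixes U :: "'a::euclidean_space \<Rightarrow> ennreal" and k m :: int
  assumes Um: "U \<in> borel_measurable borel" and q: "1 \<le> q"
    and A: "\<And>R. 0 < R \<Longrightarrow> cube k a \<subseteq> ball a R \<Longrightarrow>
      (\<integral>\<^sup>+x\<in>ball a R. U x \<partial>lborel) * epowr G q \<le> K * epowr (emeasure lborel (ball a R)) q * J"
    and fin: "K \<noteq> top" "J \<noteq> top" and G: "G \<noteq> 0"
  defines "D \<equiv> real DIM('a)" and "V \<equiv> unit_ball_vol (real DIM('a))"
  shows "emeasure (weight_kernel_measure U \<gamma>) (pairs_near b m k a) \<le>
    ennreal (2 powr \<bar>\<gamma> - D\<bar> * V * (5 * D + 1) powr D * V powr q * (5 * D + 1) powr (D * q) *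
      2 powr (real_of_int m * \<gamma> + max 0 (real_of_int m) * (D * (q - 1)))) *
    (K * (ennreal (2 powr (real_of_int k * (\<gamma> + D * q))) / epowr G q * J))"
proof -
  define l :: real where "l = 2 powr real_of_int k"
  define \<rho> :: real where "\<rho> = 2 powr real_of_int (k + m)"
  define \<mu> where "\<mu> = max 0 (real_of_int m)"
  \<comment> \<open>No inflation if x itself is close to the cube. Otherwise x is only within (5 D +
    2^m) l of a; for m < 0 the 2^m is below 1 and M is 1 again.\<close>
  define M :: real where "M = (if b then 1 else 2 powr \<mu>)"
  define R where "R = (5 * D + 1) * (M * l)"
  \<comment> \<open>For m >= 0 and y close to the cube, the ball about the cube is, up to a
    constant, smaller than the ball of radius \<rho> about x by the factor M^-D in volume.\<close>
  define Z where "Z x = (if b then cball x \<rho> else if 0 \<le> m then ball a (5 * D * l) else cball x \<rho>)" for x :: 'a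
  define s where "s = \<gamma> - D"
  have D: "1 \<le> D" by (simp add: D_def Suc_leI)
  have V: "0 < V" by (simp add: V_def)
  have l: "0 < l" and \<rho>: "0 < \<rho>" by (simp_all add: l_def \<rho>_def)
  have \<rho>l: "\<rho> = 2 powr real_of_int m * l" by (simp add: \<rho>_def l_def powr_add mult.commute)
  have M: "1 \<le> M" by (simp add: M_def \<mu>_def ge_one_powr_ge_zero)
  have R: "0 < R" using D M l by (simp add: R_def)
  define v where "v = V * ((5 * D + 1) powr D * (\<rho> / M) powr D)"
  have pw: "x ^ DIM('a) = x powr D" if "0 < x" for x using that by (simp add: D_def powr_realpow)
  have lR: "5 * D * l \<le> (5 * D + 1) * (M * l)"
    using mult_mono[of "5 * D" "5 * D + 1" l "M * l"] D M l by (simp add: mult_le_cancel_right1)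
  have "emeasure (weight_kernel_measure U \<gamma>) (pairs_near b m k a) \<le>
     ennreal (2 powr \<bar>s\<bar> * \<rho> powr s) * ennreal v * (\<integral>\<^sup>+x\<in>ball a R. U x \<partial>lborel)"
    unfolding s_def D_def
  proof (rule weight_kernel_measure_annulus_le[where Z = Z])
    fix x y assume xy: "(x, y) \<in> pairs_near b m k a"
    then have d: "dist a (if b then x else y) < 5 * D * l" "\<rho> / 2 < norm (y - x)" "norm (y - x) \<le> \<rho>"
      by (auto simp: pairs_near_def l_def \<rho>_def D_def)
    have "dist a x < R"
    proof (cases b)
      case True
      then show ?thesis using d(1) lR by (simp add: R_def)
    next
      case False
      have "dist a x \<le> dist a y + norm (y - x)" by (metis dist_triangle dist_norm)
      then have "dist a x < 5 * D * l + \<rho>" using d False by simp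
      also have "\<dots> \<le> 5 * D * (M * l) + M * l"
      proof (rule add_mono)
        show "5 * D * l \<le> 5 * D * (M * l)" using D M l by (simp add: mult_le_cancel_right1)
        have "2 powr real_of_int m \<le> M" using False by (simp add: M_def \<mu>_def)
        then show "\<rho> \<le> M * l" unfolding \<rho>l using l by (intro mult_right_mono) auto
      qed
      finally show ?thesis by (simp add: R_def algebra_simps)
    qed
    then show "x \<in> ball a R \<and> \<rho> / 2 < norm (y - x) \<and> norm (y - x) \<le> \<rho> \<and> y \<in> Z x"
      using d by (auto simp: Z_def dist_norm norm_minus_commute)
  next
    fix x :: 'a
    have one: "1 \<le> (5 * D + 1) powr D" using D by (intro ge_one_powr_ge_zero) auto
    have c1: "emeasure lborel (cball x \<rho>) \<le> ennreal v" if "M = 1"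
      using \<rho> V one that by (auto simp: emeasure_cball V_def[symmetric] pw v_def intro!: ennreal_leI mult_left_mono)
    have c2: "emeasure lborel (ball a (5 * D * l)) \<le> ennreal v" if "\<rho> / M = l"
    proof -
      have "(5 * D * l) powr D = (5 * D) powr D * l powr D" using D l by (simp add: powr_mult)
      also have "\<dots> \<le> (5 * D + 1) powr D * l powr D" using D by (intro mult_right_mono powr_mono2) auto
      finally show ?thesis using that V D l
        by (auto simp: emeasure_ball V_def[symmetric] pw v_def intro!: ennreal_leI mult_left_mono)
    qed
    show "emeasure lborel (Z x) \<le> ennreal v"
    proof (cases "b \<or> m < 0")
      case True
      then have "M = 1" by (auto simp: M_def \<mu>_def)
      then show ?thesis using c1 True by (auto simp: Z_def)
    next
      case False
      then have "\<rho> / M = l" by (simp add: M_def \<mu>_def \<rho>l)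
      then show ?thesis using c2 False by (auto simp: Z_def)
    qed
  qed (use Um \<rho> in \<open>auto simp: Z_def pairs_near_sets\<close>)
  also have "\<dots> \<le> ennreal (2 powr \<bar>s\<bar> * \<rho> powr s) * ennreal v *
      (K * epowr (emeasure lborel (ball a R)) q * J / epowr G q)"
  proof (intro mult_left_mono ennreal_le_divide_of_mult_le)
    have "2 * D * l \<le> R" using lR D l by (simp add: R_def)
    then have "cube k a \<subseteq> ball a R" using cube_subset_ball[of k a] by (auto simp: l_def D_def)
    then show "(\<integral>\<^sup>+x\<in>ball a R. U x \<partial>lborel) * epowr G q \<le> K * epowr (emeasure lborel (ball a R)) q * J"
      using A R by simp
    show "epowr G q \<noteq> 0" using G q by (simp add: epowr_eq_0_iff)
    show "K * epowr (emeasure lborel (ball a R)) q * J \<noteq> top"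
      using fin emeasure_lborel_ball_neq_top[of a R] by (simp add: ennreal_mult_eq_top_iff epowr_eq_top_iff)
  qed simp
  also have "epowr (emeasure lborel (ball a R)) q = ennreal (V powr q * (5 * D + 1) powr (D * q) * M powr (D * q) * l powr (D * q))"
    using R V D M l by (simp add: emeasure_ball V_def[symmetric] pw epowr_ennreal powr_mult powr_powr R_def)
  also have "ennreal (2 powr \<bar>s\<bar> * \<rho> powr s) * ennreal v *
      (K * ennreal (V powr q * (5 * D + 1) powr (D * q) * M powr (D * q) * l powr (D * q)) * J / epowr G q) =
      ennreal ((2 powr \<bar>s\<bar> * \<rho> powr s) * v * (V powr q * (5 * D + 1) powr (D * q) * M powr (D * q) * l powr (D * q))) *
      (K * (J / epowr G q))"
    using V by (simp add: v_def ennreal_mult divide_ennreal_def mult_ac)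
  also have "(2 powr \<bar>s\<bar> * \<rho> powr s) * v * (V powr q * (5 * D + 1) powr (D * q) * M powr (D * q) * l powr (D * q)) =
      (2 powr \<bar>s\<bar> * V * (5 * D + 1) powr D * V powr q * (5 * D + 1) powr (D * q)) *
      ((\<rho> powr s * \<rho> powr D) * (M powr (D * q) / M powr D) * l powr (D * q))"
    using \<rho> M by (simp add: v_def powr_divide)
  also have "(\<rho> powr s * \<rho> powr D) * (M powr (D * q) / M powr D) * l powr (D * q) =
      2 powr (real_of_int m * \<gamma>) * M powr (D * (q - 1)) * 2 powr (real_of_int k * (\<gamma> + D * q))"
  proof -
    have "\<rho> powr s * \<rho> powr D = \<rho> powr \<gamma>" by (simp add: s_def flip: powr_add)
    also have "\<dots> = 2 powr (real_of_int m * \<gamma> + real_of_int k * \<gamma>)"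
      by (simp add: \<rho>_def powr_powr algebra_simps)
    also have "\<dots> = 2 powr (real_of_int m * \<gamma>) * 2 powr (real_of_int k * \<gamma>)"
      by (simp add: powr_add)
    finally have "\<rho> powr s * \<rho> powr D = \<dots>" .
    moreover have "M powr (D * q) / M powr D = M powr (D * (q - 1))"
      by (simp add: right_diff_distrib powr_diff)
    moreover have "l powr (D * q) = 2 powr (real_of_int k * (D * q))" by (simp add: l_def powr_powr)
    ultimately show ?thesis by (simp add: distrib_left powr_add)
  qed
  \<comment> \<open>M is at most \<open>2 powr \<mu>\<close> for either flag, so the final bound is
    independent of b.\<close>
  also have "ennreal ((2 powr \<bar>s\<bar> * V * (5 * D + 1) powr D * V powr q * (5 * D + 1) powr (D * q)) *
      (2 powr (real_of_int m * \<gamma>) * M powr (D * (q - 1)) * 2 powr (real_of_int k * (\<gamma> + D * q)))) * (K * (J / epowr G q)) \<le>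
     ennreal ((2 powr \<bar>s\<bar> * V * (5 * D + 1) powr D * V powr q * (5 * D + 1) powr (D * q)) *
      (2 powr (real_of_int m * \<gamma>) * (2 powr \<mu>) powr (D * (q - 1)) * 2 powr (real_of_int k * (\<gamma> + D * q)))) * (K * (J / epowr G q))"
  proof (intro mult_right_mono ennreal_leI mult_left_mono powr_mono2)
    show "M \<le> 2 powr \<mu>" by (simp add: M_def \<mu>_def ge_one_powr_ge_zero)
  qed (use M D q V in auto)
  also have "\<dots> = ennreal (2 powr \<bar>s\<bar> * V * (5 * D + 1) powr D * V powr q * (5 * D + 1) powr (D * q) *
      2 powr (real_of_int m * \<gamma> + \<mu> * (D * (q - 1)))) *
    (K * (ennreal (2 powr (real_of_int k * (\<gamma> + D * q))) / epowr G q * J))"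
    using V by (simp add: powr_add powr_powr ennreal_mult divide_ennreal_def mult_ac)
  finally show ?thesis by (simp add: s_def \<mu>_def)
qed

section \<open>Sums over families of dyadic cubes\<close>

lemma countable_corners: "countable (SIGMA k:UNIV. range (corner k :: 'a::euclidean_space \<Rightarrow> 'a))"
  by (intro countable_SIGMA countable_range_corner) auto

lemma cube_corner_mono: "k \<le> k' \<Longrightarrow> cube k (corner k y) \<subseteq> cube k' (corner k' y)"
  unfolding cube_def by (auto, metis corner_corner)

text \<open>Tonelli exchanges the sum over cubes with the integral. A point lies in exactly one cube
  of each generation, so the inner sum runs over k only and \<open>chain\<close> bounds it; this
  takes the place of a bounded overlap property.\<close>

lemma nn_integral_cubes_le:
  fixes h :: "'a::euclidean_space \<Rightarrow> ennreal" and c :: "int \<Rightarrow> 'a \<Rightarrow> ennreal"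
  assumes h [measurable]: "h \<in> borel_measurable lebesgue"
    and F: "F \<subseteq> (SIGMA k:UNIV. range (corner k))"
    and chain: "\<And>y. (\<integral>\<^sup>+k. c k (corner k y) * indicator F (k, corner k y) \<partial>count_space UNIV) \<le> A"
  shows "(\<integral>\<^sup>+z. c (fst z) (snd z) * (\<integral>\<^sup>+v\<in>cube (fst z) (snd z). h v \<partial>lebesgue) \<partial>count_space F) \<le> A * (\<integral>\<^sup>+v. h v \<partial>lebesgue)"
proof -
  have cF: "countable F" using F countable_corners by (rule countable_subset)
  have [measurable]: "cube k a \<in> sets lebesgue" for k and a :: 'a
    using cube_borel[of k a] by (simp only: sets_completionI_sets sets_lborel)
  have "(\<integral>\<^sup>+z. c (fst z) (snd z) * (\<integral>\<^sup>+v\<in>cube (fst z) (snd z). h v \<partial>lebesgue) \<partial>count_space F) =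
     (\<integral>\<^sup>+z. (\<integral>\<^sup>+v. c (fst z) (snd z) * (h v * indicator (cube (fst z) (snd z)) v) \<partial>lebesgue) \<partial>count_space F)"
    by (intro nn_integral_cong nn_integral_cmult[symmetric]) measurable
  also have "\<dots> = (\<integral>\<^sup>+v. (\<integral>\<^sup>+z. c (fst z) (snd z) * (h v * indicator (cube (fst z) (snd z)) v) \<partial>count_space F) \<partial>lebesgue)"
    by (rule nn_integral_count_space_nn_integral[OF cF, symmetric]) measurable
  also have "\<dots> \<le> (\<integral>\<^sup>+v. A * h v \<partial>lebesgue)"
  proof (intro nn_integral_mono)
    fix v :: 'a
    have "(\<integral>\<^sup>+z. c (fst z) (snd z) * (h v * indicator (cube (fst z) (snd z)) v) \<partial>count_space F) =
      (\<integral>\<^sup>+z. h v * (c (fst z) (snd z) * indicator (cube (fst z) (snd z)) v * indicator F z) \<partial>count_space UNIV)"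
      by (subst nn_integral_count_space_indicator) (auto intro!: nn_integral_cong simp: mult_ac)
    also have "\<dots> = h v * (\<integral>\<^sup>+z. (c (fst z) (snd z) * indicator (cube (fst z) (snd z)) v * indicator F z) \<partial>count_space UNIV)"
      by (rule nn_integral_cmult) simp
    also have "(\<integral>\<^sup>+z. (c (fst z) (snd z) * indicator (cube (fst z) (snd z)) v * indicator F z) \<partial>count_space UNIV) =
      (\<integral>\<^sup>+k. \<integral>\<^sup>+a. c k a * indicator (cube k a) v * indicator F (k, a) \<partial>count_space UNIV \<partial>count_space UNIV)"
      by (subst nn_integral_fst_count_space[symmetric]) simp
    also have "\<dots> = (\<integral>\<^sup>+k. \<integral>\<^sup>+a. (c k a * indicator F (k, a)) * indicator {corner k v} a \<partial>count_space UNIV \<partial>count_space UNIV)"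
      by (intro nn_integral_cong) (auto simp: cube_def split: split_indicator)
    also have "\<dots> = (\<integral>\<^sup>+k. c k (corner k v) * indicator F (k, corner k v) \<partial>count_space UNIV)"
      by (intro nn_integral_cong) (subst nn_integral_indicator_singleton; simp)
    also have "h v * \<dots> \<le> h v * A" by (intro mult_left_mono chain) simp
    finally show "(\<integral>\<^sup>+z. c (fst z) (snd z) * (h v * indicator (cube (fst z) (snd z)) v) \<partial>count_space F) \<le> A * h v"
      by (simp add: mult.commute)
  qed
  also have "\<dots> = A * (\<integral>\<^sup>+v. h v \<partial>lebesgue)" by (rule nn_integral_cmult) measurable
  finally show ?thesis .
qed

lemma emeasure_countable_UN_le:
  assumes "countable I" and X: "\<And>i. i \<in> I \<Longrightarrow> X i \<in> sets M"
  shows "emeasure M (\<Union>i\<in>I. X i) \<le> (\<integral>\<^sup>+i. emeasure M (X i) \<partial>count_space I)"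
proof -
  have "emeasure M (\<Union>i\<in>I. X i) = (\<integral>\<^sup>+x. indicator (\<Union>i\<in>I. X i) x \<partial>M)"
    using assms by (subst nn_integral_indicator) (auto intro: sets.countable_UN')
  also have "\<dots> \<le> (\<integral>\<^sup>+x. (\<integral>\<^sup>+i. indicator (X i) x \<partial>count_space I) \<partial>M)"
  proof (intro nn_integral_mono)
    fix x
    show "indicator (\<Union>i\<in>I. X i) x \<le> (\<integral>\<^sup>+i. indicator (X i) x \<partial>count_space I)"
    proof (cases "x \<in> (\<Union>i\<in>I. X i)")
      case True
      then obtain i where i: "i \<in> I" "x \<in> X i" by blast
      have "1 = (\<integral>\<^sup>+j. indicator {i} j \<partial>count_space I)"
        using i by (subst nn_integral_indicator) auto
      also have "\<dots> \<le> (\<integral>\<^sup>+j. indicator (X j) x \<partial>count_space I)"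
        using i by (intro nn_integral_mono) (auto split: split_indicator)
      finally show ?thesis using True by simp
    qed simp
  qed
  also have "\<dots> = (\<integral>\<^sup>+i. (\<integral>\<^sup>+x. indicator (X i) x \<partial>M) \<partial>count_space I)"
    using assms by (intro nn_integral_count_space_nn_integral) auto
  also have "\<dots> = (\<integral>\<^sup>+i. emeasure M (X i) \<partial>count_space I)"
    using X by (intro nn_integral_cong) auto
  finally show ?thesis .
qed

section \<open>Heavy cubes\<close>

definition cube_mass :: "('a::euclidean_space \<Rightarrow> ennreal) \<Rightarrow> int \<Rightarrow> 'a \<Rightarrow> ennreal" where
  "cube_mass H k a = (\<integral>\<^sup>+v\<in>cube k a. H v \<partial>lborel)"

lemma cube_mass_corner_mono: "k \<le> k' \<Longrightarrow> cube_mass H k (corner k y) \<le> cube_mass H k' (corner k' y)"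
  unfolding cube_mass_def using cube_corner_mono[of k k' y]
  by (intro nn_integral_mono) (auto split: split_indicator)

text \<open>The threshold scales in such a way that \<open>cube_coeff\<close> of a heavy cube is at
  most T^-q at every side length.\<close>

definition heavy :: "('a::euclidean_space \<Rightarrow> ennreal) \<Rightarrow> real \<Rightarrow> real \<Rightarrow> int \<Rightarrow> 'a \<Rightarrow> bool" where
  "heavy H T \<beta> k a \<longleftrightarrow> ennreal (T * 2 powr (real_of_int k * \<beta>)) \<le> cube_mass H k a"

text \<open>With the \<beta> of \<open>cube_weights\<close> one has \<beta> q = \<gamma> + q D, so
  this is the factor left over by \<open>weight_kernel_measure_pairs_near_le\<close>.\<close>

definition cube_coeff :: "('a::euclidean_space \<Rightarrow> ennreal) \<Rightarrow> real \<Rightarrow> real \<Rightarrow> int \<Rightarrow> 'a \<Rightarrow> ennreal" where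
  "cube_coeff H q \<beta> k a = ennreal (2 powr (real_of_int k * (\<beta> * q))) / epowr (cube_mass H k a) q"

text \<open>The mass is compared with the threshold of another generation k0 because a cube inherits
  the mass of a smaller heavy cube inside it. The surplus exponent (k - k0) \<beta> q is what decays
  for \<beta> < 0.\<close>

lemma cube_coeff_le:
  assumes q: "1 \<le> q" and T: "0 < T" and le: "ennreal (T * 2 powr (real_of_int k0 * \<beta>)) \<le> cube_mass H k a"
  shows "cube_coeff H q \<beta> k a \<le> ennreal (T powr (- q) * 2 powr (real_of_int (k - k0) * (\<beta> * q)))"
proof -
  have pos: "0 < cube_mass H k a"
    using le T by (metis ennreal_less_zero_iff less_le_trans mult_pos_pos powr_gt_zero zero_neq_numeral)
  have "ennreal (2 powr (real_of_int k * (\<beta> * q))) =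
     ennreal (T powr (- q) * 2 powr (real_of_int (k - k0) * (\<beta> * q))) * ennreal ((T * 2 powr (real_of_int k0 * \<beta>)) powr q)"
    using T by (subst ennreal_mult[symmetric])
      (auto simp: powr_mult powr_powr powr_minus left_diff_distrib powr_diff field_simps)
  also have "\<dots> \<le> ennreal (T powr (- q) * 2 powr (real_of_int (k - k0) * (\<beta> * q))) * epowr (cube_mass H k a) q"
    using epowr_mono[OF le, of q] T q by (intro mult_left_mono) (auto simp: epowr_ennreal)
  finally show ?thesis
    unfolding cube_coeff_def using pos q
    by (intro divide_le_posI_ennreal) (auto simp: zero_less_iff_neq_zero epowr_eq_0_iff mult.commute)
qed

definition maximal_heavy :: "('a::euclidean_space \<Rightarrow> ennreal) \<Rightarrow> real \<Rightarrow> real \<Rightarrow> int \<Rightarrow> (int \<times> 'a) set" where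
  "maximal_heavy H T \<beta> N = {(k, a). a \<in> range (corner k) \<and> k \<le> N \<and> heavy H T \<beta> k a \<and>
     (\<forall>k'. k < k' \<longrightarrow> k' \<le> N \<longrightarrow> \<not> heavy H T \<beta> k' (corner k' a))}"

text \<open>Cubes containing y are nested, so two maximal ones coincide and the sum has at most one
  term.\<close>

lemma maximal_heavy_chain:
  fixes y :: "'a::euclidean_space"
  assumes q: "1 \<le> q" and T: "0 < T"
  shows "(\<integral>\<^sup>+k. cube_coeff H q \<beta> k (corner k y) * indicator (maximal_heavy H T \<beta> N) (k, corner k y) \<partial>count_space UNIV)
    \<le> ennreal (T powr (- q))"
proof (cases "\<exists>k. (k, corner k y) \<in> maximal_heavy H T \<beta> N")
  case True
  then obtain k where k: "(k, corner k y) \<in> maximal_heavy H T \<beta> N" by blast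
  have lt: "\<not> k1 < k2" if "(k1, corner k1 y) \<in> maximal_heavy H T \<beta> N" "(k2, corner k2 y) \<in> maximal_heavy H T \<beta> N" for k1 k2
    using that corner_corner[of k1 k2 y] by (auto simp: maximal_heavy_def)
  have "(\<integral>\<^sup>+k. cube_coeff H q \<beta> k (corner k y) * indicator (maximal_heavy H T \<beta> N) (k, corner k y) \<partial>count_space UNIV) \<le>
    (\<integral>\<^sup>+k'. cube_coeff H q \<beta> k' (corner k' y) * indicator {k} k' \<partial>count_space UNIV)"
    using lt[OF k] lt[OF _ k] by (intro nn_integral_mono) (force split: split_indicator)
  also have "\<dots> = cube_coeff H q \<beta> k (corner k y)"
    by (subst nn_integral_indicator_singleton) auto
  also have "\<dots> \<le> ennreal (T powr (- q))"
    using cube_coeff_le[OF q T, of k \<beta> H k "corner k y"] k by (auto simp: maximal_heavy_def heavy_def)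
  finally show ?thesis .
qed auto

definition heavy_above :: "('a::euclidean_space \<Rightarrow> ennreal) \<Rightarrow> real \<Rightarrow> real \<Rightarrow> int \<Rightarrow> (int \<times> 'a) set" where
  "heavy_above H T \<beta> N = {(k, a). a \<in> range (corner k) \<and> N \<le> k \<and> heavy H T \<beta> k a}"

text \<open>Let k0 be the smallest heavy generation at y. Every other cube of the chain contains
  that heavy cube, so its coefficient is at most T^-q 2^((k - k0) \<beta> q), and \<beta> < 0 makes
  the series geometric.\<close>

lemma heavy_above_chain:
  fixes y :: "'a::euclidean_space"
  assumes q: "1 \<le> q" and T: "0 < T" and \<beta>: "\<beta> < 0"
  shows "(\<integral>\<^sup>+k. cube_coeff H q \<beta> k (corner k y) * indicator (heavy_above H T \<beta> N) (k, corner k y) \<partial>count_space UNIV)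
    \<le> ennreal (T powr (- q) / (1 - 2 powr (\<beta> * q)))"
proof (cases "\<exists>k. (k, corner k y) \<in> heavy_above H T \<beta> N")
  case True
  then obtain k where k: "N \<le> k" "heavy H T \<beta> k (corner k y)" by (auto simp: heavy_above_def)
  \<comment> \<open>The lower cap N turns the search for the smallest heavy generation into one over
    the naturals, where a least element exists.\<close>
  define P where "P n \<longleftrightarrow> heavy H T \<beta> (N + int n) (corner (N + int n) y)" for n
  have "P (nat (k - N))" using k by (simp add: P_def)
  then have 1: "P (LEAST n. P n)" by (rule LeastI)
  define k0 where "k0 = N + int (LEAST n. P n)"
  have k0: "heavy H T \<beta> k0 (corner k0 y)" using 1 by (simp add: P_def k0_def)
  have min: "k0 \<le> k'" if k': "(k', corner k' y) \<in> heavy_above H T \<beta> N" for k'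
  proof -
    have "P (nat (k' - N))" "N \<le> k'" using k' by (auto simp: P_def heavy_above_def)
    then have "(LEAST n. P n) \<le> nat (k' - N)" by (intro Least_le)
    then show ?thesis using \<open>N \<le> k'\<close> by (simp add: k0_def)
  qed
  let ?c = "\<lambda>k. ennreal (T powr (- q) * 2 powr (real_of_int (k - k0) * (\<beta> * q)))"
  have "(\<integral>\<^sup>+k. cube_coeff H q \<beta> k (corner k y) * indicator (heavy_above H T \<beta> N) (k, corner k y) \<partial>count_space UNIV) \<le>
    (\<integral>\<^sup>+k. ?c k * indicator {k0..} k \<partial>count_space UNIV)"
  proof (intro nn_integral_mono)
    fix k
    show "cube_coeff H q \<beta> k (corner k y) * indicator (heavy_above H T \<beta> N) (k, corner k y) \<le> ?c k * indicator {k0..} k"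
    proof (cases "(k, corner k y) \<in> heavy_above H T \<beta> N")
      case True
      then have "k0 \<le> k" by (rule min)
      moreover have "ennreal (T * 2 powr (real_of_int k0 * \<beta>)) \<le> cube_mass H k (corner k y)"
        using k0 cube_mass_corner_mono[OF \<open>k0 \<le> k\<close>, of H y] by (auto simp: heavy_def intro: order_trans)
      ultimately show ?thesis using True cube_coeff_le[OF q T] by simp
    qed simp
  qed
  also have "\<dots> = (\<integral>\<^sup>+k. ?c k \<partial>count_space {k0..})"
    by (subst nn_integral_count_space_indicator) auto
  also have "\<dots> = (\<integral>\<^sup>+n. ?c (k0 + int n) \<partial>count_space UNIV)"
  proof (rule nn_integral_bij_count_space[symmetric])
    show "bij_betw (\<lambda>n. k0 + int n) UNIV {k0..}"
      by (rule bij_betwI[where g = "\<lambda>k. nat (k - k0)"]) auto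
  qed
  also have "\<dots> = (\<Sum>n::nat. ennreal (T powr (- q) * 2 powr (- (- (\<beta> * q)) * real n)))"
    by (simp add: nn_integral_count_space_nat mult.commute)
  also have "\<dots> = ennreal (T powr (- q) / (1 - 2 powr - (- (\<beta> * q))))"
    using \<beta> q by (intro suminf_geometric_ennreal) (auto simp: mult_neg_pos)
  finally show ?thesis by simp
qed auto

definition pairs_const :: "nat \<Rightarrow> real \<Rightarrow> real \<Rightarrow> real" where
  "pairs_const d q \<gamma> = 2 powr \<bar>\<gamma> - real d\<bar> * unit_ball_vol (real d) * (5 * real d + 1) powr real d *
     unit_ball_vol (real d) powr q * (5 * real d + 1) powr (real d * q)"

lemma pairs_const_nonneg: "0 \<le> pairs_const d q \<gamma>"
  by (simp add: pairs_const_def)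

text \<open>What the covering argument uses of the data. In the application U is a Borel version of
  u on \<Omega>, h is |grad f|^p w cut off to \<Omega>, H is |grad f|^(p/q), and K is the A_q
  constant.\<close>

locale cube_weights =
  fixes U h H :: "'a::euclidean_space \<Rightarrow> ennreal" and K :: ennreal and q \<gamma> \<beta> :: real
  assumes U_measurable: "U \<in> borel_measurable borel"
    and h_measurable: "h \<in> borel_measurable lebesgue"
    and q_ge_1: "1 \<le> q"
    and K_finite: "K \<noteq> top"
    and h_finite: "(\<integral>\<^sup>+v. h v \<partial>lebesgue) \<noteq> top"
    and ball_weight_le: "\<And>k a R. 0 < R \<Longrightarrow> cube k a \<subseteq> ball a R \<Longrightarrow>
      (\<integral>\<^sup>+x\<in>ball a R. U x \<partial>lborel) * epowr (cube_mass H k a) q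
        \<le> K * epowr (emeasure lborel (ball a R)) q * (\<integral>\<^sup>+v\<in>cube k a. h v \<partial>lebesgue)"
    and \<beta>_def: "\<beta> = real DIM('a) + \<gamma> / q"
begin

lemma pairs_near_family_le:
  assumes F: "F \<subseteq> (SIGMA k:UNIV. range (corner k))"
    and ne: "\<And>k a. (k, a) \<in> F \<Longrightarrow> cube_mass H k a \<noteq> 0"
    and chain: "\<And>y. (\<integral>\<^sup>+k. cube_coeff H q \<beta> k (corner k y) * indicator F (k, corner k y) \<partial>count_space UNIV) \<le> A"
  shows "emeasure (weight_kernel_measure U \<gamma>) (\<Union>z\<in>F. pairs_near b m (fst z) (snd z)) \<le>
    ennreal (pairs_const DIM('a) q \<gamma> * 2 powr (real_of_int m * \<gamma> + max 0 (real_of_int m) * (real DIM('a) * (q - 1)))) * (K * (A * (\<integral>\<^sup>+v. h v \<partial>lebesgue)))"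
proof -
  let ?B = "ennreal (pairs_const DIM('a) q \<gamma> * 2 powr (real_of_int m * \<gamma> + max 0 (real_of_int m) * (real DIM('a) * (q - 1))))"
  let ?J = "\<lambda>z. \<integral>\<^sup>+v\<in>cube (fst z) (snd z). h v \<partial>lebesgue"
  have \<beta>q: "\<gamma> + real DIM('a) * q = \<beta> * q" using q_ge_1 by (simp add: \<beta>_def distrib_right)
  have J: "?J z \<noteq> top" for z
  proof -
    have "?J z \<le> (\<integral>\<^sup>+v. h v \<partial>lebesgue)" by (intro nn_integral_mono) (auto split: split_indicator)
    then show ?thesis using h_finite by (auto simp: top_unique)
  qed
  have "emeasure (weight_kernel_measure U \<gamma>) (\<Union>z\<in>F. pairs_near b m (fst z) (snd z)) \<le>
    (\<integral>\<^sup>+z. emeasure (weight_kernel_measure U \<gamma>) (pairs_near b m (fst z) (snd z)) \<partial>count_space F)"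
    using F countable_corners
    by (intro emeasure_countable_UN_le) (auto intro: countable_subset simp: sets_weight_kernel_measure pairs_near_sets)
  also have "\<dots> \<le> (\<integral>\<^sup>+z. ?B * (K * (cube_coeff H q \<beta> (fst z) (snd z) * ?J z)) \<partial>count_space F)"
  proof (intro nn_integral_mono)
    fix z assume "z \<in> space (count_space F)"
    then have "cube_mass H (fst z) (snd z) \<noteq> 0" using ne[of "fst z" "snd z"] by simp
    then show "emeasure (weight_kernel_measure U \<gamma>) (pairs_near b m (fst z) (snd z)) \<le>
      ?B * (K * (cube_coeff H q \<beta> (fst z) (snd z) * ?J z))"
      unfolding pairs_const_def cube_coeff_def \<beta>q[symmetric]
      by (intro weight_kernel_measure_pairs_near_le U_measurable q_ge_1 K_finite J ball_weight_le)
  qed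
  also have "\<dots> = ?B * (K * (\<integral>\<^sup>+z. cube_coeff H q \<beta> (fst z) (snd z) * ?J z \<partial>count_space F))"
    by (simp add: nn_integral_cmult)
  also have "\<dots> \<le> ?B * (K * (A * (\<integral>\<^sup>+v. h v \<partial>lebesgue)))"
    by (intro mult_left_mono nn_integral_cubes_le h_measurable F chain) auto
  finally show ?thesis .
qed

definition cover :: "int \<Rightarrow> (int \<times> 'a) set \<Rightarrow> ('a \<times> 'a) set" where
  "cover m F = (\<Union>b. \<Union>z\<in>F. pairs_near b m (fst z) (snd z))"

lemma cover_sets: "F \<subseteq> (SIGMA k:UNIV. range (corner k)) \<Longrightarrow> cover m F \<in> sets (weight_kernel_measure U \<gamma>)"
  unfolding cover_def UNIV_bool using countable_subset[OF _ countable_corners, of F]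
  by (auto simp: sets_weight_kernel_measure intro!: sets.Un sets.countable_UN' pairs_near_sets)

text \<open>The factor 2 counts the two flags. The loss \<open>max 0 m\<close> is weakened to j, so
  that a sum over m <= j only meets the powers 2^(m \<gamma>).\<close>

lemma cover_le:
  assumes F: "F \<subseteq> (SIGMA k:UNIV. range (corner k))"
    and ne: "\<And>k a. (k, a) \<in> F \<Longrightarrow> cube_mass H k a \<noteq> 0"
    and chain: "\<And>y. (\<integral>\<^sup>+k. cube_coeff H q \<beta> k (corner k y) * indicator F (k, corner k y) \<partial>count_space UNIV) \<le> ennreal A"
    and A: "0 \<le> A" and m: "m \<le> int j"
  shows "emeasure (weight_kernel_measure U \<gamma>) (cover m F) \<le>
    ennreal (2 * pairs_const DIM('a) q \<gamma> * A * 2 powr (real_of_int m * \<gamma> + real j * (real DIM('a) * (q - 1)))) * (K * (\<integral>\<^sup>+v. h v \<partial>lebesgue))"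
proof -
  let ?P = "\<lambda>b. \<Union>z\<in>F. pairs_near b m (fst z) (snd z)"
  let ?B = "pairs_const DIM('a) q \<gamma> * 2 powr (real_of_int m * \<gamma> + real j * (real DIM('a) * (q - 1)))"
  have cF: "countable F" by (rule countable_subset[OF F countable_corners])
  have P: "?P b \<in> sets (weight_kernel_measure U \<gamma>)" for b
    unfolding sets_weight_kernel_measure using cF by (intro sets.countable_UN') (auto intro: pairs_near_sets)
  have *: "emeasure (weight_kernel_measure U \<gamma>) (?P b) \<le> ennreal ?B * (K * (ennreal A * (\<integral>\<^sup>+v. h v \<partial>lebesgue)))" for b
  proof -
    have "max 0 (real_of_int m) \<le> real j" using m by simp
    then have "real_of_int m * \<gamma> + max 0 (real_of_int m) * (real DIM('a) * (q - 1)) \<le> real_of_int m * \<gamma> + real j * (real DIM('a) * (q - 1))"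
      using q_ge_1 by (intro add_left_mono mult_right_mono) auto
    then have le: "pairs_const DIM('a) q \<gamma> * 2 powr (real_of_int m * \<gamma> + max 0 (real_of_int m) * (real DIM('a) * (q - 1))) \<le> ?B"
      using pairs_const_nonneg by (intro mult_left_mono) auto
    have "emeasure (weight_kernel_measure U \<gamma>) (?P b) \<le>
        ennreal (pairs_const DIM('a) q \<gamma> * 2 powr (real_of_int m * \<gamma> + max 0 (real_of_int m) * (real DIM('a) * (q - 1)))) *
        (K * (ennreal A * (\<integral>\<^sup>+v. h v \<partial>lebesgue)))"
      by (intro pairs_near_family_le F ne chain)
    also have "\<dots> \<le> ennreal ?B * (K * (ennreal A * (\<integral>\<^sup>+v. h v \<partial>lebesgue)))"
      by (intro mult_right_mono ennreal_leI le) simp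
    finally show ?thesis .
  qed
  have "cover m F = ?P True \<union> ?P False" unfolding cover_def UNIV_bool by auto
  then have "emeasure (weight_kernel_measure U \<gamma>) (cover m F) \<le>
      emeasure (weight_kernel_measure U \<gamma>) (?P True) + emeasure (weight_kernel_measure U \<gamma>) (?P False)"
    using emeasure_subadditive[OF P P] by simp
  also have "\<dots> \<le> ennreal ?B * (K * (ennreal A * (\<integral>\<^sup>+v. h v \<partial>lebesgue))) + ennreal ?B * (K * (ennreal A * (\<integral>\<^sup>+v. h v \<partial>lebesgue)))"
    by (intro add_mono *)
  also have "\<dots> = 2 * ennreal ?B * ennreal A * (K * (\<integral>\<^sup>+v. h v \<partial>lebesgue))"
    by (simp add: mult_2 distrib_left distrib_right mult_ac)
  also have "2 * ennreal ?B * ennreal A = ennreal (2 * pairs_const DIM('a) q \<gamma> * A * 2 powr (real_of_int m * \<gamma> + real j * (real DIM('a) * (q - 1))))"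
    using pairs_const_nonneg A by (simp add: ennreal_mult mult_ac)
  finally show ?thesis .
qed

lemma heavy_mass_neq_0: "0 < T \<Longrightarrow> heavy H T b k a \<Longrightarrow> cube_mass H k a \<noteq> 0"
  by (auto simp: heavy_def ennreal_eq_0_iff mult_le_0_iff)

lemma cover_heavy_above_le:
  assumes \<beta>: "\<beta> < 0" and T: "0 < T"
  shows "emeasure (weight_kernel_measure U \<gamma>) (cover (int j) (heavy_above H T \<beta> N)) \<le>
    ennreal (2 * pairs_const DIM('a) q \<gamma> / (1 - 2 powr (\<beta> * q)) * T powr (- q) * 2 powr (real j * (\<gamma> + real DIM('a) * (q - 1)))) * (K * (\<integral>\<^sup>+v. h v \<partial>lebesgue))"
proof -
  have "2 powr (\<beta> * q) < (1::real)" using \<beta> q_ge_1 by (intro powr_less_one) (auto simp: mult_neg_pos)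
  then have "emeasure (weight_kernel_measure U \<gamma>) (cover (int j) (heavy_above H T \<beta> N)) \<le>
    ennreal (2 * pairs_const DIM('a) q \<gamma> * (T powr (- q) / (1 - 2 powr (\<beta> * q))) * 2 powr (real_of_int (int j) * \<gamma> + real j * (real DIM('a) * (q - 1)))) * (K * (\<integral>\<^sup>+v. h v \<partial>lebesgue))"
    using heavy_mass_neq_0[OF T]
    by (intro cover_le heavy_above_chain q_ge_1 T \<beta>) (auto simp: heavy_above_def)
  then show ?thesis by (simp add: distrib_left mult_ac)
qed

text \<open>A maximal cube lying n generations above the cube first found sees the pair at a
  distance of about 2^(j - n) sides. Every n may occur, and \<gamma> > 0 makes the factors 2^((j -
  n) \<gamma>) summable.\<close>

lemma cover_maximal_heavy_le:
  assumes \<gamma>: "0 < \<gamma>" and T: "0 < T"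
  shows "emeasure (weight_kernel_measure U \<gamma>) (\<Union>n. cover (int j - int n) (maximal_heavy H T \<beta> N)) \<le>
    ennreal (2 * pairs_const DIM('a) q \<gamma> / (1 - 2 powr - \<gamma>) * T powr (- q) * 2 powr (real j * (\<gamma> + real DIM('a) * (q - 1)))) * (K * (\<integral>\<^sup>+v. h v \<partial>lebesgue))"
proof -
  let ?I = "K * (\<integral>\<^sup>+v. h v \<partial>lebesgue)"
  define \<theta> where "\<theta> = 2 * pairs_const DIM('a) q \<gamma> * T powr (- q) * 2 powr (real j * (\<gamma> + real DIM('a) * (q - 1)))"
  have \<theta>: "0 \<le> \<theta>" using pairs_const_nonneg by (simp add: \<theta>_def)
  have sub: "maximal_heavy H T \<beta> N \<subseteq> (SIGMA k:UNIV. range (corner k))" by (auto simp: maximal_heavy_def)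
  have *: "emeasure (weight_kernel_measure U \<gamma>) (cover (int j - int n) (maximal_heavy H T \<beta> N)) \<le>
     ennreal (\<theta> * 2 powr (- \<gamma> * real n)) * ?I" for n
  proof -
    have "emeasure (weight_kernel_measure U \<gamma>) (cover (int j - int n) (maximal_heavy H T \<beta> N)) \<le>
      ennreal (2 * pairs_const DIM('a) q \<gamma> * T powr (- q) * 2 powr (real_of_int (int j - int n) * \<gamma> + real j * (real DIM('a) * (q - 1)))) * ?I"
      using heavy_mass_neq_0[OF T]
      by (intro cover_le maximal_heavy_chain q_ge_1 T) (auto simp: maximal_heavy_def)
    also have "2 * pairs_const DIM('a) q \<gamma> * T powr (- q) * 2 powr (real_of_int (int j - int n) * \<gamma> + real j * (real DIM('a) * (q - 1))) =
      \<theta> * 2 powr (- \<gamma> * real n)"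
      by (simp add: \<theta>_def mult.assoc flip: powr_add) (simp add: algebra_simps)
    finally show ?thesis .
  qed
  have "emeasure (weight_kernel_measure U \<gamma>) (\<Union>n. cover (int j - int n) (maximal_heavy H T \<beta> N)) \<le>
    (\<Sum>n. emeasure (weight_kernel_measure U \<gamma>) (cover (int j - int n) (maximal_heavy H T \<beta> N)))"
    using cover_sets[OF sub] by (intro emeasure_subadditive_countably) auto
  also have "\<dots> \<le> (\<Sum>n. ennreal (\<theta> * 2 powr (- \<gamma> * real n)) * ?I)"
    by (intro suminf_le *) auto
  also have "\<dots> = ennreal (\<theta> / (1 - 2 powr - \<gamma>)) * ?I"
    using suminf_geometric_ennreal[OF \<gamma> \<theta>] by (subst ennreal_suminf_multc) simp
  finally show ?thesis by (simp add: \<theta>_def mult_ac)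
qed

end

section \<open>Covering the level set\<close>

text \<open>Hoelder with weight 1, that is Jensen for the power s; the volume of the cube is
  replaced by that of the ball in \<open>cube_subset_ball\<close>.\<close>

lemma cube_mass_powr_ge:
  fixes g :: "'a::euclidean_space \<Rightarrow> real"
  assumes g [measurable]: "g \<in> borel_measurable borel" and g0: "\<And>v. 0 \<le> g v" and s: "1 \<le> s" and \<xi>: "0 < \<xi>"
    and le: "ennreal \<xi> \<le> (\<integral>\<^sup>+v\<in>cube k a. ennreal (g v) \<partial>lborel)"
  shows "ennreal (\<xi> powr s / (unit_ball_vol (real DIM('a)) * (2 * real DIM('a) * 2 powr real_of_int k) ^ DIM('a)) powr (s - 1))
    \<le> cube_mass (\<lambda>v. ennreal (g v powr s)) k a"
proof -
  let ?v = "unit_ball_vol (real DIM('a)) * (2 * real DIM('a) * 2 powr real_of_int k) ^ DIM('a)"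
  have v: "0 < ?v" by simp
  show ?thesis
  proof (cases "s = 1")
    case True
    then show ?thesis using le \<xi> g0 v by (simp add: cube_mass_def)
  next
    case False
    then have s1: "1 < s" using s by simp
    have "emeasure lborel (cube k a) \<le> emeasure lborel (ball a (2 * real DIM('a) * 2 powr real_of_int k))"
      by (intro emeasure_mono cube_subset_ball) auto
    then have Q: "emeasure lborel (cube k a) \<le> ennreal ?v"
      by (simp add: emeasure_ball)
    have W: "(\<integral>\<^sup>+x\<in>cube k a. inverse (ennreal (1 powr (1 / (s - 1)))) \<partial>lborel) = emeasure lborel (cube k a)"
      by (simp add: nn_integral_indicator)
    have "ennreal (\<xi> powr s) \<le> epowr (\<integral>\<^sup>+v\<in>cube k a. ennreal (g v) \<partial>lborel) s"
      using epowr_mono[OF le, of s] s \<xi> by (simp add: epowr_ennreal)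
    also have "\<dots> \<le> (\<integral>\<^sup>+x\<in>cube k a. ennreal (g x powr s * 1) \<partial>lborel) * epowr (emeasure lborel (cube k a)) (s - 1)"
      unfolding W[symmetric]
      by (intro weighted_Holder s1 g0) (use Q W in \<open>auto intro: le_less_trans\<close>)
    also have "\<dots> \<le> (\<integral>\<^sup>+x\<in>cube k a. ennreal (g x powr s * 1) \<partial>lborel) * ennreal (?v powr (s - 1))"
      using epowr_mono[OF Q, of "s - 1"] s1 v by (intro mult_left_mono) (auto simp: epowr_ennreal)
    finally have *: "ennreal (\<xi> powr s) \<le> cube_mass (\<lambda>v. ennreal (g v powr s)) k a * ennreal (?v powr (s - 1))"
      by (simp add: cube_mass_def)
    have vp: "0 < ?v powr (s - 1)" using v by (metis powr_gt_zero less_irrefl)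
    have "ennreal (\<xi> powr s / ?v powr (s - 1)) = ennreal (\<xi> powr s) / ennreal (?v powr (s - 1))"
      using vp by (intro divide_ennreal[symmetric]) auto
    also have "\<dots> \<le> cube_mass (\<lambda>v. ennreal (g v powr s)) k a"
      using * vp by (intro divide_le_posI_ennreal) (auto simp: mult.commute)
    finally show ?thesis .
  qed
qed

lemma powr_ge_on_dyadic_annulus:
  fixes t \<rho> s :: real
  assumes "\<rho> / 2 < t" "t \<le> \<rho>" "0 < \<rho>"
  shows "2 powr (- \<bar>s\<bar>) * \<rho> powr s \<le> t powr s"
proof -
  have "t powr (- s) \<le> 2 powr \<bar>s\<bar> * \<rho> powr (- s)"
    using powr_le_on_dyadic_annulus[OF assms, of "- s"] by simp
  then show ?thesis using assms by (simp add: powr_minus field_simps)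
qed

lemma ball_dev_pos:
  fixes \<Omega> :: "'a::euclidean_space set"
  assumes "ball_dev \<Omega> < top" "open \<Omega>" "x \<in> \<Omega>" "y \<in> \<Omega>" "x \<noteq> y"
  shows "0 < enn2real (ball_dev \<Omega>)"
proof -
  have "ball_dev \<Omega> \<noteq> 0"
  proof
    assume "ball_dev \<Omega> = 0"
    then have "emeasure lborel (ball x (dist x y)) = 0" using ball_dev_bound[OF assms] by simp
    then show False using emeasure_lborel_ball_pos[of "dist x y" x] assms(5) by simp
  qed
  then show ?thesis using assms(1) by (simp add: enn2real_positive_iff zero_less_iff_neq_zero)
qed

text \<open>The first three factors come from \<open>difference_imp_large_average\<close>, the power
  of 2 after them is the part of 2^(-(j + 1) (d - 1)) free of j, 5^-d is the pigeonhole among cubes,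
  and the last factor pays for replacing |x - y| by a power of 2.\<close>

definition threshold_const :: "nat \<Rightarrow> real \<Rightarrow> real \<Rightarrow> real" where
  "threshold_const d \<epsilon> b = (1 - 2 powr - \<epsilon>) * unit_ball_vol (real d) / 8 * 2 powr (1 - real d) * 5 powr (- real d) *
     2 powr (- \<bar>real d + b\<bar>)"

text \<open>The T_j of the overview, for t = lam / dev. The power s and the denominator are those of
  \<open>cube_mass_powr_ge\<close>, with the powers of the side length split off.\<close>

definition threshold :: "nat \<Rightarrow> real \<Rightarrow> real \<Rightarrow> real \<Rightarrow> real \<Rightarrow> nat \<Rightarrow> real" where
  "threshold d \<epsilon> b s t j = (threshold_const d \<epsilon> b * t * 2 powr (real j * (1 + b - \<epsilon>))) powr s /
     (unit_ball_vol (real d) * (2 * real d) ^ d) powr (s - 1)"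

lemma threshold_const_pos: "0 < \<epsilon> \<Longrightarrow> 0 < threshold_const d \<epsilon> b"
  by (simp add: threshold_const_def powr_less_one)

text \<open>The exponent (D + b) s - D (s - 1) is the one that the computation produces: l^(D + b)
  is raised to the power s and divided by a volume of order l^D to the power s - 1. For b = \<gamma>
  / p and s = p / q it equals D + \<gamma> / q.\<close>

lemma heavy_cube_exists:
  fixes f :: "'a::euclidean_space \<Rightarrow> real"
  assumes f: "C1_on f \<Omega>" and conv: "convex \<Omega>" and op: "open \<Omega>" and dev: "ball_dev \<Omega> < top"
    and x: "x \<in> \<Omega>" and y: "y \<in> \<Omega>" and xy: "x \<noteq> y" and eps: "0 < \<epsilon>" and s: "1 \<le> s" and lam: "0 < lam"
    and L: "lam * dist x y powr (1 + b) < \<bar>f y - f x\<bar>"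
  obtains j :: nat and k :: int and z :: 'a and c where "c \<in> {x, y}"
    "heavy (\<lambda>v. ennreal (grad_norm \<Omega> f v powr s)) (threshold DIM('a) \<epsilon> b s (lam / enn2real (ball_dev \<Omega>)) j)
        ((real DIM('a) + b) * s - real DIM('a) * (s - 1)) k (corner k z)"
    "dist c (corner k z) < 4 * real DIM('a) * 2 powr real_of_int k"
    "2 powr real_of_int (k + int j) / 2 < dist x y" "dist x y \<le> 2 powr real_of_int (k + int j)"
proof -
  define D where "D = real DIM('a)"
  define V where "V = unit_ball_vol (real DIM('a))"
  define r where "r = dist x y"
  define \<kappa> where "\<kappa> = enn2real (ball_dev \<Omega>)"
  define g where "g = grad_norm \<Omega> f"
  define c1 where "c1 = (1 - 2 powr - \<epsilon>) * V / 8"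
  have r: "0 < r" using xy by (simp add: r_def)
  have \<kappa>: "0 < \<kappa>" unfolding \<kappa>_def by (rule ball_dev_pos[OF dev op x y xy])
  have D: "1 \<le> D" by (simp add: D_def Suc_leI)
  have V: "0 < V" by (simp add: V_def)
  have c1: "0 < c1" using V eps by (simp add: c1_def powr_less_one)
  have gm [measurable]: "g \<in> borel_measurable borel" unfolding g_def by (rule grad_norm_measurable[OF f op])
  have "0 < lam * r powr (1 + b)" using lam r by simp
  then obtain j :: nat and c where c: "c \<in> {x, y}" and
    big: "ennreal (c1 * (lam * r powr (1 + b) / r) * (r ^ DIM('a) / \<kappa>) * 2 powr (- \<epsilon> * real j)) \<le>
      ennreal (2 ^ (Suc j * DIM('a)) / 2 ^ Suc j) * (\<integral>\<^sup>+v\<in>ball c (2 * r / 2 ^ j). ennreal (g v) \<partial>lborel)"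
    using difference_imp_large_average[OF f conv op dev x y xy eps, of "lam * r powr (1 + b)"] L
    unfolding c1_def V_def \<kappa>_def r_def g_def by blast
  \<comment> \<open>Rounding up gives r <= 2^(k + j) < 2 r. Hence r / 2^j <= l, and the ball of
    radius 2 r / 2^j lies in the one of radius 2 l.\<close>
  define k where "k = \<lceil>log 2 r\<rceil> - int j"
  define l :: real where "l = 2 powr real_of_int k"
  define \<rho> :: real where "\<rho> = 2 powr real_of_int (k + int j)"
  have l: "0 < l" by (simp add: l_def)
  have \<rho>l: "\<rho> = l * 2 ^ j" by (simp add: \<rho>_def l_def powr_add powr_realpow)
  have r2: "r \<le> \<rho>"
  proof -
    have "r = 2 powr (log 2 r)" using r by simp
    also have "\<dots> \<le> \<rho>" unfolding \<rho>_def k_def by (intro powr_mono) auto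
    finally show ?thesis .
  qed
  have r1: "\<rho> / 2 < r"
  proof -
    have "\<rho> / 2 = 2 powr (real_of_int (k + int j) - 1)" by (simp add: \<rho>_def powr_diff)
    also have "\<dots> < 2 powr (log 2 r)" unfolding k_def by (intro powr_less_mono) (simp_all, linarith)
    also have "\<dots> = r" using r by simp
    finally show ?thesis .
  qed
  obtain z where z: "dist c z < 2 * l" and
    cz: "(\<integral>\<^sup>+v\<in>ball c (2 * l). ennreal (g v) \<partial>lborel) \<le> ennreal (5 ^ DIM('a)) * (\<integral>\<^sup>+v\<in>cube k (corner k z). ennreal (g v) \<partial>lborel)"
    using large_cube_in_ball[of "\<lambda>v. ennreal (g v)" c k] unfolding l_def by auto
  let ?X = "\<integral>\<^sup>+v\<in>cube k (corner k z). ennreal (g v) \<partial>lborel"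
  \<comment> \<open>The coefficient of the ball integral times the number of cubes that may share
    its mass.\<close>
  define \<alpha> :: real where "\<alpha> = 2 ^ (Suc j * DIM('a)) / 2 ^ Suc j * 5 ^ DIM('a)"
  define \<nu> where "\<nu> = c1 * (lam * r powr (1 + b) / r) * (r ^ DIM('a) / \<kappa>) * 2 powr (- \<epsilon> * real j)"
  define \<xi> where "\<xi> = threshold_const DIM('a) \<epsilon> b * (lam / \<kappa>) * 2 powr (real j * (1 + b - \<epsilon>)) * l powr (D + b)"
  have \<alpha>: "0 < \<alpha>" by (simp add: \<alpha>_def)
  have "ennreal \<nu> \<le> ennreal (2 ^ (Suc j * DIM('a)) / 2 ^ Suc j) * (\<integral>\<^sup>+v\<in>ball c (2 * r / 2 ^ j). ennreal (g v) \<partial>lborel)"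
    using big by (simp only: \<nu>_def)
  also have "\<dots> \<le> ennreal (2 ^ (Suc j * DIM('a)) / 2 ^ Suc j) * (\<integral>\<^sup>+v\<in>ball c (2 * l). ennreal (g v) \<partial>lborel)"
  proof (rule mult_left_mono, rule nn_integral_mono)
    have "2 * r / 2 ^ j \<le> 2 * l" using r2 by (simp add: \<rho>l field_simps)
    then show "ennreal (g v) * indicator (ball c (2 * r / 2 ^ j)) v \<le> ennreal (g v) * indicator (ball c (2 * l)) v" for v
      by (auto split: split_indicator)
  qed simp
  also have "\<dots> \<le> ennreal (2 ^ (Suc j * DIM('a)) / 2 ^ Suc j) * (ennreal (5 ^ DIM('a)) * ?X)"
    by (intro mult_left_mono cz) simp
  also have "\<dots> = ennreal \<alpha> * ?X"
    by (simp only: \<alpha>_def mult.assoc[symmetric] ennreal_mult[symmetric] zero_le_power zero_le_numeral divide_nonneg_nonneg)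
  finally have "ennreal \<nu> / ennreal \<alpha> \<le> ?X"
    using \<alpha> by (intro divide_le_posI_ennreal) auto
  moreover have "0 \<le> \<nu>" using c1 lam r \<kappa> by (simp add: \<nu>_def)
  ultimately have X: "ennreal (\<nu> / \<alpha>) \<le> ?X" using \<alpha> by (simp add: divide_ennreal)
  have "\<xi> \<le> \<nu> / \<alpha>"
  proof -
    have \<alpha>': "\<alpha> = 2 powr ((real j + 1) * (D - 1)) * 5 powr D"
      by (simp add: \<alpha>_def D_def powr_realpow powr_diff algebra_simps flip: powr_realpow)
         (simp add: powr_add)
    have rr: "r powr (1 + b) / r * r ^ DIM('a) = r powr (D + b)"
      using r by (simp add: D_def powr_add powr_realpow)
    have up: "\<nu> / \<alpha> = c1 * (lam / \<kappa>) * 2 powr (- \<epsilon> * real j) / \<alpha> * r powr (D + b)"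
      unfolding \<nu>_def rr[symmetric] by (simp add: field_simps)
    have mid: "c1 * (lam / \<kappa>) * 2 powr (- \<epsilon> * real j) / \<alpha> * (2 powr (- \<bar>D + b\<bar>) * \<rho> powr (D + b)) \<le>
        c1 * (lam / \<kappa>) * 2 powr (- \<epsilon> * real j) / \<alpha> * r powr (D + b)"
      using c1 lam \<kappa> \<alpha> r1 r2 r
      by (intro mult_left_mono powr_ge_on_dyadic_annulus) (auto simp: \<rho>_def)
    have \<rho>p: "\<rho> powr (D + b) = 2 powr (real j * (D + b)) * l powr (D + b)"
    proof -
      have "\<rho> powr (D + b) = (2 powr real j) powr (D + b) * l powr (D + b)"
        unfolding \<rho>l using l by (simp add: powr_mult powr_realpow mult.commute)
      then show ?thesis by (simp add: powr_powr)
    qed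
    have "c1 * (lam / \<kappa>) * 2 powr (- \<epsilon> * real j) / \<alpha> * (2 powr (- \<bar>D + b\<bar>) * (2 powr (real j * (D + b)) * l powr (D + b))) =
       c1 * (lam / \<kappa>) * 5 powr (- D) * 2 powr (- \<bar>D + b\<bar>) * l powr (D + b) *
       (2 powr (- \<epsilon> * real j) * 2 powr (- ((real j + 1) * (D - 1))) * 2 powr (real j * (D + b)))"
    proof -
      define e where "e = (real j + 1) * (D - 1)"
      have "\<alpha> = 2 powr e * 5 powr D" by (simp add: \<alpha>' e_def)
      then show ?thesis unfolding e_def[symmetric] by (simp add: powr_minus field_simps)
    qed
    \<comment> \<open>The exponents add up to (1 - D) + j (1 + b - \<epsilon>): the dimension drops
      out of the growth in j.\<close>
    also have "2 powr (- \<epsilon> * real j) * 2 powr (- ((real j + 1) * (D - 1))) * 2 powr (real j * (D + b)) =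
      2 powr (1 - D) * 2 powr (real j * (1 + b - \<epsilon>))"
      unfolding powr_add[symmetric] by (simp add: algebra_simps)
    also have "c1 * (lam / \<kappa>) * 5 powr (- D) * 2 powr (- \<bar>D + b\<bar>) * l powr (D + b) *
        (2 powr (1 - D) * 2 powr (real j * (1 + b - \<epsilon>))) = \<xi>"
      by (simp add: \<xi>_def threshold_const_def c1_def V_def D_def)
    finally show ?thesis using up mid unfolding \<rho>p by simp
  qed
  then have "ennreal \<xi> \<le> ?X" using X by (meson ennreal_leI order_trans)
  moreover have \<xi>0: "0 < \<xi>"
    using lam \<kappa> l threshold_const_pos[OF eps, of "DIM('a)" b] by (simp add: \<xi>_def)
  ultimately have "ennreal (\<xi> powr s / (V * (2 * D * l) ^ DIM('a)) powr (s - 1))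
      \<le> cube_mass (\<lambda>v. ennreal (g v powr s)) k (corner k z)"
    unfolding V_def D_def l_def using s by (intro cube_mass_powr_ge gm) (auto simp: g_def)
  moreover have "\<xi> powr s / (V * (2 * D * l) ^ DIM('a)) powr (s - 1) =
      threshold DIM('a) \<epsilon> b s (lam / \<kappa>) j * 2 powr (real_of_int k * ((D + b) * s - D * (s - 1)))"
  proof -
    have 1: "\<xi> powr s = (threshold_const DIM('a) \<epsilon> b * (lam / \<kappa>) * 2 powr (real j * (1 + b - \<epsilon>))) powr s * l powr ((D + b) * s)"
      unfolding \<xi>_def powr_powr[of l "D + b" s, symmetric] by (rule powr_mult)
    have "(V * (2 * D * l) ^ DIM('a)) = (V * (2 * D) ^ DIM('a)) * l powr D"
      using l by (simp add: power_mult_distrib D_def powr_realpow)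
    then have 2: "(V * (2 * D * l) ^ DIM('a)) powr (s - 1) = (V * (2 * D) ^ DIM('a)) powr (s - 1) * l powr (D * (s - 1))"
      using V D l by (simp add: powr_mult powr_powr)
    have 3: "2 powr (real_of_int k * ((D + b) * s - D * (s - 1))) = l powr ((D + b) * s) / l powr (D * (s - 1))"
      by (simp add: l_def powr_powr flip: powr_diff right_diff_distrib)
    show ?thesis
      unfolding 1 2 3 threshold_def by (simp add: V_def D_def)
  qed
  ultimately have heavy: "heavy (\<lambda>v. ennreal (g v powr s)) (threshold DIM('a) \<epsilon> b s (lam / \<kappa>) j)
      ((D + b) * s - D * (s - 1)) k (corner k z)"
    by (simp add: heavy_def)
  have "dist c (corner k z) \<le> dist c z + dist z (corner k z)" by (rule dist_triangle)
  also have "\<dots> < 2 * l + D * l" using z dist_corner_le[of z k] by (simp add: D_def l_def)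
  also have "\<dots> \<le> 4 * D * l" using D l by (simp add: mult_le_cancel_right flip: distrib_right)
  finally show ?thesis
    using that[OF c] heavy r1 r2 by (simp add: \<rho>_def l_def D_def r_def \<kappa>_def g_def)
qed

text \<open>Climb to the largest heavy ancestor up to generation N, chosen among finitely many. The
  corner moves by at most D times the new side, which turns 4 D into 5 D; since |x - y| is fixed,
  raising the generation by n lowers the distance index from j to j - n.\<close>

lemma maximal_heavy_cover:
  fixes z :: "'a::euclidean_space"
  assumes heavy: "heavy H T \<beta> k (corner k z)" and kN: "k \<le> N"
    and c: "c \<in> {x, y}" "dist c (corner k z) < 4 * real DIM('a) * 2 powr real_of_int k"
    and r: "2 powr real_of_int (k + int j) / 2 < norm (y - x)" "norm (y - x) \<le> 2 powr real_of_int (k + int j)"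
  shows "\<exists>n::nat. \<exists>b. \<exists>w\<in>maximal_heavy H T \<beta> N. (x, y) \<in> pairs_near b (int j - int n) (fst w) (snd w)"
proof -
  define S where "S = {k'. k \<le> k' \<and> k' \<le> N \<and> heavy H T \<beta> k' (corner k' z)}"
  have S: "finite S" "k \<in> S" using heavy kN by (auto simp: S_def intro: finite_subset[of _ "{k..N}"])
  define m where "m = Max S"
  have m: "m \<in> S" using S unfolding m_def by (intro Max_in) auto
  then have km: "k \<le> m" by (simp add: S_def)
  have max: "\<not> heavy H T \<beta> k' (corner k' z)" if "m < k'" "k' \<le> N" for k'
  proof
    assume "heavy H T \<beta> k' (corner k' z)"
    then have "k' \<in> S" using that km by (simp add: S_def)
    then have "k' \<le> m" using S(1) unfolding m_def by (intro Max_ge)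
    then show False using that by simp
  qed
  have in_max: "(m, corner m z) \<in> maximal_heavy H T \<beta> N"
    using m max by (auto simp: maximal_heavy_def S_def corner_corner)
  have "dist c (corner m z) \<le> dist c (corner k z) + dist (corner k z) (corner m (corner k z))"
    using dist_triangle[of c "corner m z" "corner k z"] km by (simp add: corner_corner)
  also have "\<dots> < 4 * real DIM('a) * 2 powr real_of_int k + real DIM('a) * 2 powr real_of_int m"
    using c(2) dist_corner_le[of "corner k z" m] by linarith
  also have "\<dots> \<le> 4 * real DIM('a) * 2 powr real_of_int m + real DIM('a) * 2 powr real_of_int m"
    using km by (intro add_right_mono mult_left_mono) auto
  finally have d: "dist (corner m z) c < 5 * real DIM('a) * 2 powr real_of_int m"
    by (simp add: dist_commute algebra_simps)
  define n where "n = nat (m - k)"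
  have e: "m + (int j - int n) = k + int j" using km by (simp add: n_def)
  have "(x, y) \<in> pairs_near (c = x) (int j - int n) m (corner m z)"
    using d r c(1) unfolding pairs_near_def e by auto
  then show ?thesis using in_max by (intro exI[of _ n] exI[of _ "c = x"] bexI[of _ "(m, corner m z)"]) auto
qed

text \<open>Since (p / q) q = p, the power -q of the threshold carries t^-p, which becomes the
  factor (dev / lam)^p of the final bound.\<close>

lemma threshold_powr_minus:
  fixes q p :: real
  assumes q: "1 \<le> q" and qp: "q \<le> p" and eps: "0 < \<epsilon>" and t: "0 < t" and d: "0 < d"
  shows "threshold d \<epsilon> (\<gamma> / p) (p / q) t j powr (- q) =
    threshold_const d \<epsilon> (\<gamma> / p) powr (- p) * (unit_ball_vol (real d) * (2 * real d) ^ d) powr (p - q) *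
      (1 / t) powr p * 2 powr (- (real j * (p * (1 - \<epsilon>) + \<gamma>)))"
    and "0 < threshold d \<epsilon> (\<gamma> / p) (p / q) t j"
proof -
  let ?c = "threshold_const d \<epsilon> (\<gamma> / p)"
  let ?v = "unit_ball_vol (real d) * (2 * real d) ^ d"
  let ?e = "real j * (1 + \<gamma> / p - \<epsilon>)"
  have c: "0 < ?c" by (rule threshold_const_pos[OF eps])
  have v: "0 < ?v" using d by simp
  have p: "0 < p" using q qp by simp
  have 1: "?c * t * 2 powr ?e > 0" using c t by simp
  have th: "threshold d \<epsilon> (\<gamma> / p) (p / q) t j = (?c * t * 2 powr ?e) powr (p / q) * ?v powr (- (p / q - 1))"
    by (simp only: threshold_def powr_minus divide_inverse)
  have pos: "0 < x \<Longrightarrow> 0 < x powr a" for x a :: real by simp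
  show "0 < threshold d \<epsilon> (\<gamma> / p) (p / q) t j"
    unfolding th by (intro mult_pos_pos pos 1 v)
  have e1: "p / q * - q = - p" "- (p / q - 1) * - q = p - q" using q by (auto simp: field_simps)
  have "threshold d \<epsilon> (\<gamma> / p) (p / q) t j powr (- q) =
     ((?c * t * 2 powr ?e) powr (p / q)) powr (- q) * (?v powr (- (p / q - 1))) powr (- q)"
    unfolding th by (intro powr_mult)
  also have "\<dots> = (?c * t * 2 powr ?e) powr (- p) * ?v powr (p - q)"
    unfolding powr_powr e1 ..
  also have "(?c * t * 2 powr ?e) powr (- p) = ?c powr (- p) * t powr (- p) * 2 powr (?e * - p)"
    by (simp only: powr_mult powr_powr)
  also have "?e * - p = - (real j * (p * (1 - \<epsilon>) + \<gamma>))" using p by (simp add: field_simps)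
  also have "t powr (- p) = (1 / t) powr p" using t by (simp add: powr_divide powr_minus_divide)
  finally show "threshold d \<epsilon> (\<gamma> / p) (p / q) t j powr (- q) =
    ?c powr (- p) * ?v powr (p - q) * (1 / t) powr p * 2 powr (- (real j * (p * (1 - \<epsilon>) + \<gamma>)))"
    by (simp only: mult_ac)
qed

text \<open>\<delta> is half of the gap p - d (q - 1), and \<epsilon> = \<delta> / p spends the
  other half on the pigeonhole over j. The conditional selects the ratio of a geometric series: over
  the height of the maximal ancestor for \<gamma> > 0, and along the heavy cubes containing a point
  otherwise.\<close>

definition weak_type_const :: "nat \<Rightarrow> real \<Rightarrow> real \<Rightarrow> real \<Rightarrow> real" where
  "weak_type_const d p q \<gamma> =
    (let \<delta> = (p - real d * (q - 1)) / 2; \<epsilon> = \<delta> / p in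
      2 * pairs_const d q \<gamma> / (1 - 2 powr (if 0 < \<gamma> then - \<gamma> else real d * q + \<gamma>)) *
      threshold_const d \<epsilon> (\<gamma> / p) powr (- p) * (unit_ball_vol (real d) * (2 * real d) ^ d) powr (p - q) /
      (1 - 2 powr - \<delta>))"

lemma truncated_level_set_bound:
  fixes f :: "'a::euclidean_space \<Rightarrow> real" and U h :: "'a \<Rightarrow> ennreal" and p q \<gamma> \<beta> :: real and N :: nat
  assumes q: "1 \<le> q" and qp: "q \<le> p" and pd: "p > real DIM('a) * (q - 1)" and \<gamma>: "\<gamma> \<notin> {- (q * real DIM('a))..0}"
    and f: "C1_on f \<Omega>" and conv: "convex \<Omega>" and op: "open \<Omega>" and dev: "ball_dev \<Omega> < top" and lam: "0 < lam"
    and cw: "cube_weights U h (\<lambda>v. ennreal (grad_norm \<Omega> f v powr (p / q))) K q \<gamma> \<beta>"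
  shows "emeasure (weight_kernel_measure U \<gamma>)
      {(x, y) \<in> level_set \<Omega> lam (\<gamma> / p) f. 2 powr - real N < norm (y - x) \<and> norm (y - x) \<le> 2 powr real N} \<le>
    ennreal (weak_type_const DIM('a) p q \<gamma> * (enn2real (ball_dev \<Omega>) / lam) powr p) * (K * (\<integral>\<^sup>+v. h v \<partial>lebesgue))"
    (is "emeasure ?M ?E \<le> _")
proof (cases "?E = {}")
  case False
  define H where "H = (\<lambda>v. ennreal (grad_norm \<Omega> f v powr (p / q)))"
  interpret cube_weights U h H K q \<gamma> \<beta> using cw by (simp add: H_def)
  let ?J = "K * (\<integral>\<^sup>+v. h v \<partial>lebesgue)"
  define \<delta> where "\<delta> = (p - real DIM('a) * (q - 1)) / 2"
  define \<epsilon> where "\<epsilon> = \<delta> / p"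
  define \<kappa> where "\<kappa> = enn2real (ball_dev \<Omega>)"
  define C4 where "C4 = 2 * pairs_const DIM('a) q \<gamma> / (1 - 2 powr (if 0 < \<gamma> then - \<gamma> else real DIM('a) * q + \<gamma>))"
  define C5 where "C5 = threshold_const DIM('a) \<epsilon> (\<gamma> / p) powr (- p) * (unit_ball_vol (real DIM('a)) * (2 * real DIM('a)) ^ DIM('a)) powr (p - q)"
  define T where "T = threshold DIM('a) \<epsilon> (\<gamma> / p) (p / q) (lam / \<kappa>)"
  have p: "0 < p" using q qp by simp
  have \<delta>: "0 < \<delta>" using pd by (simp add: \<delta>_def)
  have \<epsilon>: "0 < \<epsilon>" using \<delta> p by (simp add: \<epsilon>_def)
  have \<delta>': "p * (1 - \<epsilon>) - real DIM('a) * (q - 1) = \<delta>"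
  proof -
    have "p * \<epsilon> = \<delta>" using p by (simp add: \<epsilon>_def)
    then show ?thesis by (simp add: right_diff_distrib) (simp add: \<delta>_def field_simps)
  qed
  \<comment> \<open>Two distinct points of \<Omega> are needed to know that the deviation is
    positive.\<close>
  obtain x0 y0 where xy0: "x0 \<in> \<Omega>" "y0 \<in> \<Omega>" "x0 \<noteq> y0"
  proof -
    obtain z where "z \<in> ?E" using False by blast
    then show thesis using that[of "fst z" "snd z"] lam by (auto simp: level_set_def diff_quot_def split: if_splits)
  qed
  have \<kappa>: "0 < \<kappa>" unfolding \<kappa>_def by (rule ball_dev_pos[OF dev op xy0])
  have t: "0 < lam / \<kappa>" using lam \<kappa> by simp
  have s1: "1 \<le> p / q" using q qp by simp
  have T: "0 < T j" for j unfolding T_def by (rule threshold_powr_minus(2)[OF q qp \<epsilon> t]) simp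
  have Tq: "T j powr (- q) = C5 * (\<kappa> / lam) powr p * 2 powr (- (real j * (p * (1 - \<epsilon>) + \<gamma>)))" for j
    unfolding T_def C5_def using threshold_powr_minus(1)[OF q qp \<epsilon> t, of "DIM('a)" \<gamma> j] by simp
  have \<beta>q: "\<beta> * q = real DIM('a) * q + \<gamma>" using q by (simp add: \<beta>_def distrib_right)
  have neg: "\<beta> * q < 0" if "\<not> 0 < \<gamma>" using that \<gamma> by (auto simp: \<beta>q mult.commute)
  have C4: "0 \<le> C4"
    using neg pairs_const_nonneg[of "DIM('a)" q \<gamma>]
    by (auto simp: C4_def \<beta>q powr_less_one less_imp_le intro!: divide_nonneg_nonneg)
  have C5: "0 \<le> C5" by (simp add: C5_def)
  have \<beta>': "(real DIM('a) + \<gamma> / p) * (p / q) - real DIM('a) * (p / q - 1) = \<beta>"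
    using p q by (simp add: \<beta>_def field_simps)
  \<comment> \<open>The caps come from the truncation: 2^-N < |x - y| <= 2^N and 2^(k + j) / 2 < |x
    - y| <= 2^(k + j) imply -N < k + j <= N.\<close>
  define X where "X j = (if 0 < \<gamma> then \<Union>n. cover (int j - int n) (maximal_heavy H (T j) \<beta> (int N - int j))
      else cover (int j) (heavy_above H (T j) \<beta> (- int N - int j)))" for j :: nat
  have Xm: "X j \<in> sets ?M" for j
  proof -
    have "cover (int j - int n) (maximal_heavy H (T j) \<beta> (int N - int j)) \<in> sets ?M" for n
      by (intro cover_sets) (auto simp: maximal_heavy_def)
    moreover have "cover (int j) (heavy_above H (T j) \<beta> (- int N - int j)) \<in> sets ?M"
      by (intro cover_sets) (auto simp: heavy_above_def)
    ultimately show ?thesis by (simp add: X_def sets.countable_UN)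
  qed
  have X: "emeasure ?M (X j) \<le> ennreal (C4 * C5 * (\<kappa> / lam) powr p * 2 powr (- \<delta> * real j)) * ?J" for j
  proof -
    have "emeasure ?M (X j) \<le> ennreal (C4 * T j powr (- q) * 2 powr (real j * (\<gamma> + real DIM('a) * (q - 1)))) * ?J"
    proof (cases "0 < \<gamma>")
      case True
      then show ?thesis using cover_maximal_heavy_le[OF True T[of j], of j "int N - int j"]
        by (simp add: X_def C4_def)
    next
      case False
      have "\<beta> < 0" using neg[OF False] q by (simp add: mult_less_0_iff)
      then show ?thesis using cover_heavy_above_le[OF _ T[of j], of j "- int N - int j"] False
        by (simp add: X_def C4_def \<beta>q)
    qed
    also have "C4 * T j powr (- q) * 2 powr (real j * (\<gamma> + real DIM('a) * (q - 1))) =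
       C4 * C5 * (\<kappa> / lam) powr p * (2 powr (- (real j * (p * (1 - \<epsilon>) + \<gamma>))) * 2 powr (real j * (\<gamma> + real DIM('a) * (q - 1))))"
      unfolding Tq by (simp only: mult_ac)
    \<comment> \<open>Here \<gamma> cancels, and the condition p > D (q - 1) leaves a decaying
      exponent.\<close>
    also have "2 powr (- (real j * (p * (1 - \<epsilon>) + \<gamma>))) * 2 powr (real j * (\<gamma> + real DIM('a) * (q - 1))) = 2 powr (- \<delta> * real j)"
      unfolding powr_add[symmetric] \<delta>'[symmetric] by (simp add: algebra_simps)
    finally show ?thesis .
  qed
  have "?E \<subseteq> (\<Union>j. X j)"
  proof clarify
    fix x y assume E: "(x, y) \<in> level_set \<Omega> lam (\<gamma> / p) f" "2 powr - real N < norm (y - x)" "norm (y - x) \<le> 2 powr real N"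
    then have xy: "x \<in> \<Omega>" "y \<in> \<Omega>" "x \<noteq> y" using lam by (auto simp: level_set_def)
    have r: "dist x y = norm (y - x)" by (simp add: dist_norm norm_minus_commute)
    have pos: "0 < norm (y - x) powr (1 + \<gamma> / p)" using xy(3) by simp
    have "lam < \<bar>f y - f x\<bar> / norm (y - x) powr (1 + \<gamma> / p)"
      using E(1) xy(3) by (simp add: level_set_def diff_quot_def)
    then have large: "lam * dist x y powr (1 + \<gamma> / p) < \<bar>f y - f x\<bar>"
      unfolding r pos_less_divide_eq[OF pos] .
    obtain j :: nat and k :: int and z :: 'a and c where *: "c \<in> {x, y}"
      "heavy (\<lambda>v. ennreal (grad_norm \<Omega> f v powr (p / q)))
        (threshold DIM('a) \<epsilon> (\<gamma> / p) (p / q) (lam / enn2real (ball_dev \<Omega>)) j)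
        ((real DIM('a) + \<gamma> / p) * (p / q) - real DIM('a) * (p / q - 1)) k (corner k z)"
      "dist c (corner k z) < 4 * real DIM('a) * 2 powr real_of_int k"
      "2 powr real_of_int (k + int j) / 2 < dist x y" "dist x y \<le> 2 powr real_of_int (k + int j)"
      by (rule heavy_cube_exists[OF f conv op dev xy \<epsilon> s1 lam large])
    have heavy: "heavy H (T j) \<beta> k (corner k z)"
      using *(2) unfolding \<beta>' H_def T_def \<kappa>_def .
    show "(x, y) \<in> (\<Union>j. X j)"
    proof (cases "0 < \<gamma>")
      case True
      have "2 powr (real_of_int (k + int j) - 1) < 2 powr real N"
        using *(4) E(3) unfolding r by (simp add: powr_diff)
      then have "real_of_int (k + int j) - 1 < real N" by simp
      then have "k \<le> int N - int j" by linarith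
      then have "\<exists>n::nat. \<exists>b. \<exists>w\<in>maximal_heavy H (T j) \<beta> (int N - int j). (x, y) \<in> pairs_near b (int j - int n) (fst w) (snd w)"
        using *(4,5) unfolding r by (intro maximal_heavy_cover[OF heavy _ *(1,3)])
      then have "(x, y) \<in> X j" using True by (auto simp: X_def cover_def)
      then show ?thesis by blast
    next
      case False
      have "2 powr - real N < 2 powr real_of_int (k + int j)" by (rule less_le_trans[OF E(2) *(5)[unfolded r]])
      then have "- real N < real_of_int (k + int j)" by simp
      then have "- int N - int j \<le> k" by linarith
      then have "(k, corner k z) \<in> heavy_above H (T j) \<beta> (- int N - int j)"
        using heavy by (simp add: heavy_above_def)
      moreover have "dist (corner k z) c < 5 * real DIM('a) * 2 powr real_of_int k"
      proof -
        have "4 * real DIM('a) * 2 powr real_of_int k \<le> 5 * real DIM('a) * 2 powr real_of_int k" by (intro mult_right_mono) auto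
        from less_le_trans[OF *(3) this] show ?thesis by (simp only: dist_commute)
      qed
      then have "(x, y) \<in> pairs_near (c = x) (int j) k (corner k z)"
        using *(1,4,5) by (auto simp: pairs_near_def r)
      ultimately have "(x, y) \<in> cover (int j) (heavy_above H (T j) \<beta> (- int N - int j))"
        unfolding cover_def by (intro UN_I[of "c = x"] UN_I[of "(k, corner k z)"]) simp_all
      then have "(x, y) \<in> X j" using False by (simp add: X_def)
      then show ?thesis by blast
    qed
  qed
  then have "emeasure ?M ?E \<le> emeasure ?M (\<Union>j. X j)"
    using Xm by (intro emeasure_mono) auto
  also have "\<dots> \<le> (\<Sum>j. emeasure ?M (X j))"
    using Xm by (intro emeasure_subadditive_countably) auto
  also have "\<dots> \<le> (\<Sum>j. ennreal (C4 * C5 * (\<kappa> / lam) powr p * 2 powr (- \<delta> * real j)) * ?J)"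
    by (intro suminf_le X) auto
  also have "\<dots> = ennreal (C4 * C5 * (\<kappa> / lam) powr p / (1 - 2 powr - \<delta>)) * ?J"
  proof -
    have "0 \<le> C4 * C5 * (\<kappa> / lam) powr p" using C4 C5 by (intro mult_nonneg_nonneg powr_ge_zero)
    then show ?thesis by (simp only: ennreal_suminf_multc suminf_geometric_ennreal[OF \<delta>])
  qed
  also have "C4 * C5 * (\<kappa> / lam) powr p / (1 - 2 powr - \<delta>) = weak_type_const DIM('a) p q \<gamma> * (\<kappa> / lam) powr p"
    unfolding weak_type_const_def Let_def C4_def C5_def \<epsilon>_def \<delta>_def by simp
  finally show ?thesis by (simp add: \<kappa>_def)
next
  case True
  then show ?thesis by (simp only: emeasure_empty zero_le)
qed

section \<open>From the truncated to the full level set\<close>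

lemma open_level_set:
  fixes f :: "'a::euclidean_space \<Rightarrow> real"
  assumes "continuous_on \<Omega> f" "open \<Omega>" and lam: "0 < lam"
  shows "open (level_set \<Omega> lam b f)"
proof -
  define S where "S = (\<Omega> \<times> \<Omega>) \<inter> {z. fst z \<noteq> snd z}"
  define \<phi> where "\<phi> z = \<bar>f (snd z) - f (fst z)\<bar> / norm (snd z - fst z) powr (1 + b)" for z
  have "open S"
    unfolding S_def using assms(2)
    by (intro open_Int open_Times open_Collect_neq continuous_intros)
  moreover have "continuous_on S \<phi>"
  proof -
    have 1: "continuous_on S (\<lambda>z. f (snd z))"
      by (rule continuous_on_compose2[OF assms(1) continuous_on_snd[OF continuous_on_id]]) (auto simp: S_def)
    have 2: "continuous_on S (\<lambda>z. f (fst z))"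
      by (rule continuous_on_compose2[OF assms(1) continuous_on_fst[OF continuous_on_id]]) (auto simp: S_def)
    have 3: "continuous_on S (\<lambda>z. norm (snd z - fst z) powr (1 + b))"
      by (intro continuous_on_powr continuous_intros) (auto simp: S_def)
    show ?thesis
      unfolding \<phi>_def by (intro continuous_on_divide continuous_on_rabs continuous_on_diff 1 2 3) (auto simp: S_def)
  qed
  ultimately have "open (S \<inter> \<phi> -` {lam<..})"
    by (intro continuous_open_preimage) auto
  \<comment> \<open>As \<open>lam\<close> is positive, the diagonal, where \<open>diff_quot\<close>
    is 0, does not meet the level set.\<close>
  also have "S \<inter> \<phi> -` {lam<..} = level_set \<Omega> lam b f"
    using lam by (auto simp: S_def \<phi>_def level_set_def diff_quot_def split: if_splits)
  finally show ?thesis .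
qed

lemma nn_integral_restrict_AE_eq:
  fixes u :: "'a::euclidean_space \<Rightarrow> real"
  assumes "AE x in lborel. ennreal (u x) * indicator \<Omega> x = U x"
  shows "(\<integral>\<^sup>+x\<in>B \<inter> \<Omega>. ennreal (u x) \<partial>lebesgue) = (\<integral>\<^sup>+x\<in>B. U x \<partial>lborel)"
  unfolding nn_integral_completion using assms
  by (intro nn_integral_cong_AE, eventually_elim) (auto split: split_indicator)

text \<open>Required by the convention 0 * top = 0: if the constant is 0, the asserted bound is 0
  even when the gradient integral is infinite. The weight inequality with g = 1 and Q the ball
  itself shows that u vanishes almost everywhere in \<Omega>.\<close>

lemma Aq_const_eq_0_imp_AE:
  fixes u w :: "'a::euclidean_space \<Rightarrow> real"
  assumes q: "1 \<le> q" and Om: "\<Omega> \<in> sets lebesgue" and A: "Aq_pair q \<Omega> u w" and K: "Aq_const q \<Omega> u w = 0"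
    and U: "AE x in lborel. ennreal (u x) * indicator \<Omega> x = U x" and Um [measurable]: "U \<in> borel_measurable borel"
  shows "AE x in lborel. U x = 0"
proof -
  have "AE x in lborel. U x * indicator (ball 0 (real (Suc n))) x = 0" for n
  proof -
    let ?B = "ball (0::'a) (real (Suc n))"
    have "(\<integral>\<^sup>+x\<in>?B \<inter> \<Omega>. ennreal (u x) \<partial>lebesgue) * epowr (\<integral>\<^sup>+x\<in>?B \<inter> \<Omega>. ennreal 1 \<partial>lebesgue) q \<le> 0"
      using Aq_pair_ball_le[OF q _ Om A, of "real (Suc n)" ?B 0 "\<lambda>_. 1"] K by auto
    moreover have "(\<integral>\<^sup>+x\<in>?B \<inter> \<Omega>. ennreal 1 \<partial>lebesgue) = emeasure lebesgue (?B \<inter> \<Omega>)"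
    proof -
      have "?B \<inter> \<Omega> \<in> sets lebesgue" using Om by auto
      then show ?thesis by simp
    qed
    ultimately have "(\<integral>\<^sup>+x\<in>?B \<inter> \<Omega>. ennreal (u x) \<partial>lebesgue) = 0 \<or> emeasure lebesgue (?B \<inter> \<Omega>) = 0"
      using q by (auto simp: epowr_eq_0_iff)
    moreover have "(\<integral>\<^sup>+x\<in>?B \<inter> \<Omega>. ennreal (u x) \<partial>lebesgue) = 0" if "emeasure lebesgue (?B \<inter> \<Omega>) = 0"
      by (rule nn_integral_null_set, rule null_setsI) (use that Om in auto)
    ultimately have "(\<integral>\<^sup>+x\<in>?B. U x \<partial>lborel) = 0"
      unfolding nn_integral_restrict_AE_eq[OF U] by blast
    moreover have m: "(\<lambda>x. U x * indicator ?B x) \<in> borel_measurable lborel"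
      using Um by (intro borel_measurable_times_ennreal borel_measurable_indicator) auto
    ultimately show ?thesis by (simp only: nn_integral_0_iff_AE[OF m])
  qed
  then have "AE x in lborel. \<forall>n. U x * indicator (ball 0 (real (Suc n))) x = 0"
    unfolding AE_all_countable by blast
  then show ?thesis
  proof eventually_elim
    fix x assume *: "\<forall>n. U x * indicator (ball 0 (real (Suc n))) x = 0"
    obtain n where "norm x < real n" using reals_Archimedean2 by blast
    then have "x \<in> ball 0 (real (Suc n))" by simp
    then show "U x = 0" using *[rule_format, of n] by simp
  qed
qed

lemma Aq_pair_cube_weights:
  fixes u w :: "'a::euclidean_space \<Rightarrow> real"
  assumes q: "1 \<le> q" and qp: "q \<le> p" and op: "open \<Omega>" and f: "C1_on f \<Omega>" and A: "Aq_pair q \<Omega> u w"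
    and U: "AE x in lborel. ennreal (u x) * indicator \<Omega> x = U x" and Um: "U \<in> borel_measurable borel"
    and fin: "(\<integral>\<^sup>+y\<in>\<Omega>. ennreal (norm (gradient f y) powr p * w y) \<partial>lebesgue) \<noteq> top"
  shows "cube_weights U (\<lambda>y. ennreal (norm (gradient f y) powr p * w y) * indicator \<Omega> y)
    (\<lambda>v. ennreal (grad_norm \<Omega> f v powr (p / q))) (Aq_const q \<Omega> u w) q \<gamma> (real DIM('a) + \<gamma> / q)"
proof
  have Om [measurable]: "\<Omega> \<in> sets lebesgue" using op by auto
  have gm [measurable]: "grad_norm \<Omega> f \<in> borel_measurable borel" by (rule grad_norm_measurable[OF f op])
  have gl [measurable]: "grad_norm \<Omega> f \<in> borel_measurable lebesgue"
    using measurable_completion[of "grad_norm \<Omega> f" lborel borel] gm by simp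
  define w' where "w' x = (if x \<in> \<Omega> then w x else 0)" for x
  have [measurable]: "w' \<in> borel_measurable lebesgue"
    using A Om unfolding w'_def Aq_pair_def weight_on_def by (simp add: borel_measurable_if)
  have "(\<lambda>y. ennreal (grad_norm \<Omega> f y powr p * w' y) * indicator \<Omega> y) \<in> borel_measurable lebesgue"
    by measurable
  also have "(\<lambda>y. ennreal (grad_norm \<Omega> f y powr p * w' y) * indicator \<Omega> y) =
      (\<lambda>y. ennreal (norm (gradient f y) powr p * w y) * indicator \<Omega> y)"
    by (auto simp: w'_def grad_norm_def split: split_indicator)
  finally show "(\<lambda>y. ennreal (norm (gradient f y) powr p * w y) * indicator \<Omega> y) \<in> borel_measurable lebesgue" .
  show "Aq_const q \<Omega> u w \<noteq> top" using A by (simp add: Aq_pair_def less_top)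
  fix k :: int and a b :: 'a and R :: real
  assume R: "0 < R" and sub: "cube k a \<subseteq> ball b R"
  show "(\<integral>\<^sup>+x\<in>ball b R. U x \<partial>lborel) * epowr (cube_mass (\<lambda>v. ennreal (grad_norm \<Omega> f v powr (p / q))) k a) q \<le>
      Aq_const q \<Omega> u w * epowr (emeasure lborel (ball b R)) q *
      (\<integral>\<^sup>+v\<in>cube k a. ennreal (norm (gradient f v) powr p * w v) * indicator \<Omega> v \<partial>lebesgue)"
  proof -
    have Q: "cube k a \<in> sets lebesgue" using cube_borel[of k a] by (simp only: sets_completionI_sets sets_lborel)
    have "(\<integral>\<^sup>+x\<in>ball b R \<inter> \<Omega>. ennreal (u x) \<partial>lebesgue) *
        epowr (\<integral>\<^sup>+x\<in>cube k a \<inter> \<Omega>. ennreal (grad_norm \<Omega> f x powr (p / q)) \<partial>lebesgue) q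
      \<le> Aq_const q \<Omega> u w * epowr (emeasure lebesgue (ball b R)) q *
        (\<integral>\<^sup>+x\<in>cube k a \<inter> \<Omega>. ennreal ((grad_norm \<Omega> f x powr (p / q)) powr q * w x) \<partial>lebesgue)"
      by (intro Aq_pair_ball_le q R Om A Q sub) auto
    moreover have "(\<integral>\<^sup>+x\<in>cube k a \<inter> \<Omega>. ennreal (grad_norm \<Omega> f x powr (p / q)) \<partial>lebesgue) =
        cube_mass (\<lambda>v. ennreal (grad_norm \<Omega> f v powr (p / q))) k a"
      unfolding cube_mass_def nn_integral_completion
      by (intro nn_integral_cong) (auto simp: grad_norm_def split: split_indicator)
    moreover have "(\<integral>\<^sup>+x\<in>cube k a \<inter> \<Omega>. ennreal ((grad_norm \<Omega> f x powr (p / q)) powr q * w x) \<partial>lebesgue) =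
        (\<integral>\<^sup>+v\<in>cube k a. ennreal (norm (gradient f v) powr p * w v) * indicator \<Omega> v \<partial>lebesgue)"
      using q by (intro nn_integral_cong) (auto simp: grad_norm_def powr_powr split: split_indicator)
    ultimately show ?thesis by (simp add: nn_integral_restrict_AE_eq[OF U])
  qed
qed (use q Um fin in auto)

lemma weak_type_estimate:
  fixes u w f :: "'a::euclidean_space \<Rightarrow> real" and p q \<gamma> lam :: real
  assumes q: "1 \<le> q" and qp: "q \<le> p" and pd: "p > real DIM('a) * (q - 1)" and \<gamma>: "\<gamma> \<notin> {- (q * real DIM('a))..0}"
    and dom: "is_domain \<Omega>" and conv: "convex \<Omega>" and dev: "ball_dev \<Omega> < top"
    and A: "Aq_pair q \<Omega> u w" and f: "C1_on f \<Omega>" and lam: "0 < lam"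
  shows "emeasure (mu_weight \<Omega> u \<gamma>) (level_set \<Omega> lam (\<gamma> / p) f)
         \<le> ennreal (\<bar>weak_type_const DIM('a) p q \<gamma>\<bar> + 1) * Aq_const q \<Omega> u w * epowr (ball_dev \<Omega> / ennreal lam) p *
            (\<integral>\<^sup>+y\<in>\<Omega>. ennreal (norm (gradient f y) powr p * w y) \<partial>lebesgue)"
proof -
  let ?K = "Aq_const q \<Omega> u w" and ?I = "\<integral>\<^sup>+y\<in>\<Omega>. ennreal (norm (gradient f y) powr p * w y) \<partial>lebesgue"
  \<comment> \<open>Adding 1 makes the constant positive: where the gradient integral is infinite, a
    constant 0 would turn the right side into 0.\<close>
  let ?C = "\<bar>weak_type_const DIM('a) p q \<gamma>\<bar> + 1"
  define \<kappa> where "\<kappa> = enn2real (ball_dev \<Omega>)"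
  define E where "E = level_set \<Omega> lam (\<gamma> / p) f"
  have op: "open \<Omega>" using dom by (simp add: is_domain_def)
  have Om [measurable]: "\<Omega> \<in> sets lebesgue" using op by auto
  have p: "0 < p" using q qp by simp
  have u0: "0 \<le> u x" if "x \<in> \<Omega>" for x using A that by (auto simp: Aq_pair_def weight_on_def)
  have "(\<lambda>x. if x \<in> \<Omega> then u x else 0) \<in> borel_measurable lebesgue"
    using A Om unfolding Aq_pair_def weight_on_def by (simp add: borel_measurable_if)
  then have "(\<lambda>x. ennreal (if x \<in> \<Omega> then u x else 0)) \<in> borel_measurable lebesgue" by measurable
  then obtain U where Um [measurable]: "U \<in> borel_measurable lborel" and
    "AE x in lborel. ennreal (if x \<in> \<Omega> then u x else 0) = U x"
    using completion_ex_borel_measurable by blast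
  then have U: "AE x in lborel. ennreal (u x) * indicator \<Omega> x = U x"
    by (auto elim!: eventually_mono split: split_indicator)
  let ?M = "weight_kernel_measure U \<gamma>"
  have fc: "continuous_on \<Omega> f"
    using f unfolding C1_on_def
    by (auto intro!: continuous_at_imp_continuous_on differentiable_imp_continuous_within)
  have Eop: "open E" unfolding E_def by (rule open_level_set[OF fc op lam])
  have Em: "E \<in> sets (borel \<Otimes>\<^sub>M borel)" unfolding borel_prod using Eop by simp
  have sub: "E \<subseteq> \<Omega> \<times> \<Omega>" by (auto simp: E_def level_set_def)
  have le: "emeasure (mu_weight \<Omega> u \<gamma>) E \<le> emeasure ?M E"
    using Um Eop by (intro mu_weight_le[OF op u0 U _ sub]) auto
  show ?thesis
  proof (cases "E = {}")
    case True
    then show ?thesis by (simp add: E_def)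
  next
    case False
    then obtain x0 y0 where xy0: "x0 \<in> \<Omega>" "y0 \<in> \<Omega>" "x0 \<noteq> y0"
    proof -
      obtain z where "z \<in> E" using False by blast
      then show thesis using that[of "fst z" "snd z"] lam by (auto simp: E_def level_set_def diff_quot_def split: if_splits)
    qed
    have \<kappa>: "0 < \<kappa>" unfolding \<kappa>_def by (rule ball_dev_pos[OF dev op xy0])
    have dev': "epowr (ball_dev \<Omega> / ennreal lam) p = ennreal ((\<kappa> / lam) powr p)"
    proof -
      have "ball_dev \<Omega> / ennreal lam = ennreal (\<kappa> / lam)"
        using dev \<kappa> lam by (simp add: \<kappa>_def divide_ennreal[symmetric])
      then show ?thesis using \<kappa> lam by (simp add: epowr_ennreal)
    qed
    have pos: "0 < (\<kappa> / lam) powr p" using \<kappa> lam by simp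
    \<comment> \<open>The covering estimate needs a finite gradient integral. If the integral is
      infinite, so is the right side, unless the A_q constant is 0; that case is settled
      first.\<close>
    consider (zero) "?K = 0" | (inf) "?K \<noteq> 0" "?I = top" | (fin) "?I \<noteq> top" by blast
    then show ?thesis
    proof cases
      case zero
      have "AE x in lborel. U x = 0" using Um by (intro Aq_const_eq_0_imp_AE[OF q Om A zero U]) auto
      then have AE0: "AE z in lborel \<Otimes>\<^sub>M lborel. U (fst (z :: 'a \<times> 'a)) = 0" by (rule AE_lborel_pair_fst)
      have "emeasure ?M E \<le> (\<integral>\<^sup>+z. (case z of (x, y) \<Rightarrow> U x * ennreal (norm (y - x) powr (\<gamma> - real DIM('a)))) * indicator E z \<partial>(lborel \<Otimes>\<^sub>M lborel))"
        unfolding weight_kernel_measure_def by (rule emeasure_density_le)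
      also have "\<dots> = (\<integral>\<^sup>+z. 0 \<partial>(lborel \<Otimes>\<^sub>M lborel :: ('a \<times> 'a) measure))"
        using AE0 by (intro nn_integral_cong_AE, eventually_elim) (auto simp: case_prod_beta)
      finally show ?thesis using le by (simp add: E_def zero)
    next
      case inf
      have C: "0 < ?C" by simp
      show ?thesis unfolding inf(2) dev' using inf(1) pos C
        by (simp add: ennreal_mult_top ennreal_eq_0_iff not_le)
    next
      case fin
      let ?h = "\<lambda>y. ennreal (norm (gradient f y) powr p * w y) * indicator \<Omega> y"
      define B where "B = ennreal (weak_type_const DIM('a) p q \<gamma> * (\<kappa> / lam) powr p) * (?K * ?I)"
      \<comment> \<open>These sets exhaust the level set, as |x - y| is positive and finite on it;
        continuity from below then removes N, the bound being independent of it.\<close>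
      define EN where "EN N = {(x, y) \<in> E. 2 powr - real N < norm (y - x) \<and> norm (y - x) \<le> 2 powr real N}" for N :: nat
      have cw: "cube_weights U ?h (\<lambda>v. ennreal (grad_norm \<Omega> f v powr (p / q))) ?K q \<gamma> (real DIM('a) + \<gamma> / q)"
        using Um by (intro Aq_pair_cube_weights[OF q qp op f A U _ fin]) auto
      have EN: "emeasure ?M (EN N) \<le> B" for N
        unfolding EN_def E_def B_def \<kappa>_def
        by (rule truncated_level_set_bound[OF q qp pd \<gamma> f conv op dev lam cw])
      have ENm: "EN N \<in> sets ?M" for N
      proof -
        have "EN N = E \<inter> {z \<in> space (borel \<Otimes>\<^sub>M borel). 2 powr - real N < norm (snd z - fst z) \<and> norm (snd z - fst z) \<le> 2 powr real N}"
          by (auto simp: EN_def space_pair_measure)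
        also have "\<dots> \<in> sets (borel \<Otimes>\<^sub>M borel)" by (intro sets.Int Em) measurable
        finally show ?thesis by (simp add: sets_weight_kernel_measure)
      qed
      have inc: "incseq EN"
      proof (rule incseq_SucI, clarify)
        fix N x y assume "(x, y) \<in> EN N"
        then have xy: "(x, y) \<in> E" "2 powr - real N < norm (y - x)" "norm (y - x) \<le> 2 powr real N"
          by (auto simp: EN_def)
        have mono: "2 powr - real (Suc N) \<le> 2 powr - real N" "2 powr real N \<le> 2 powr real (Suc N)" by simp_all
        show "(x, y) \<in> EN (Suc N)"
          unfolding EN_def using xy(1) le_less_trans[OF mono(1) xy(2)] order_trans[OF xy(3) mono(2)] by simp
      qed
      have "E \<subseteq> (\<Union>N. EN N)"
      proof clarify
        fix x y assume E: "(x, y) \<in> E"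
        then have r: "0 < norm (y - x)" using lam by (auto simp: E_def level_set_def diff_quot_def split: if_splits)
        obtain N :: nat where N: "\<bar>log 2 (norm (y - x))\<bar> < real N" using reals_Archimedean2 by blast
        have "2 powr - real N < 2 powr (log 2 (norm (y - x)))" "2 powr (log 2 (norm (y - x))) \<le> 2 powr real N"
          using N by (intro powr_less_mono powr_mono; simp)+
        moreover have "2 powr (log 2 (norm (y - x))) = norm (y - x)" using r by simp
        ultimately have "2 powr - real N < norm (y - x) \<and> norm (y - x) \<le> 2 powr real N"
          by (simp only: conj_absorb)
        then have "(x, y) \<in> EN N" using E by (simp add: EN_def)
        then show "(x, y) \<in> (\<Union>N. EN N)" by blast
      qed
      then have "emeasure ?M E \<le> emeasure ?M (\<Union>N. EN N)"
        using ENm by (intro emeasure_mono) auto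
      also have "\<dots> = (SUP N. emeasure ?M (EN N))"
        using ENm inc by (intro SUP_emeasure_incseq[symmetric]) auto
      also have "\<dots> \<le> B" by (intro SUP_least EN)
      also have "\<dots> \<le> ennreal (?C * (\<kappa> / lam) powr p) * (?K * ?I)"
        unfolding B_def by (intro mult_right_mono ennreal_leI) (auto simp: abs_if)
      also have "\<dots> = ennreal ?C * ?K * epowr (ball_dev \<Omega> / ennreal lam) p * ?I"
        unfolding dev' by (simp add: ennreal_mult mult_ac)
      finally show ?thesis using le by (simp add: E_def)
    qed
  qed
qed

theorem theorem1p1:
  fixes p q \<gamma> :: real
  assumes "1 \<le> q" and "q \<le> p"
    and "p > real DIM('a::euclidean_space) * (q - 1)"
    and "\<gamma> \<notin> {- (q * real DIM('a))..0}"
  shows "\<exists>C::real. 0 \<le> C \<and>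
    (\<forall>(\<Omega>::'a set) (u::'a \<Rightarrow> real) (w::'a \<Rightarrow> real) (f::'a \<Rightarrow> real) (lam::real).
       is_domain \<Omega> \<longrightarrow> convex \<Omega> \<longrightarrow> ball_dev \<Omega> < top \<longrightarrow> Aq_pair q \<Omega> u w \<longrightarrow>
       C1_on f \<Omega> \<longrightarrow> 0 < lam \<longrightarrow>
       emeasure (mu_weight \<Omega> u \<gamma>) (level_set \<Omega> lam (\<gamma> / p) f)
         \<le> ennreal C * Aq_const q \<Omega> u w * epowr (ball_dev \<Omega> / ennreal lam) p *
            (\<integral>\<^sup>+y\<in>\<Omega>. ennreal (norm (gradient f y) powr p * w y) \<partial>lebesgue))"
  using weak_type_estimate[OF assms]
  by (intro exI[of _ "\<bar>weak_type_const DIM('a) p q \<gamma>\<bar> + 1"]) auto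

end
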